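(* Consider an $s$-stage stochastic partitioned Runge–Kutta method with two partitions and coefficients $Z^{(q,m)}_{i,j}$, $\gamma^{(q,m)}_i$ ($q=1,2$, $m=0,\dots,M$, $i,j=1,\dots,s$), applied to Stratonovich SDEs, and assume that $$\gamma_i^{(1,m_1)}\gamma_j^{(2,m_2)}=\gamma_j^{(2,m_2)}Z_{j,i}^{(1,m_1)}+\gamma_i^{(1,m_1)}Z_{i,j}^{(2,m_2)}\qquad\forall\, i,j=1,\dots,s,\ \forall\, m_1,m_2=0,1,\dots,M.$$ Let $\hat\tau$ be an unrooted tree (obtained from some tree in $TS$ by forgetting its root) of order $q\le p$. (i) If $\phi(\tau)(h)=\Phi(\tau)(h)+\mathcal O(h^{p+\frac12})$ for one rooted tree $\tau\in\widehat{TS}(\hat\tau)$ and for all rooted trees $\tau$ of order less than $q$, then $\phi(\tau)(h)=\Phi(\tau)(h)+\mathcal O(h^{p+\frac12})$ for all $\tau\in\widehat{TS}(\hat\tau)$. (ii) Similarly, if $E\phi(\tau)(h)=E\Phi(\tau)(h)+\mathcal O(h^{p+\frac12})$ for one rooted tree $\tau\in\widehat{TS}(\hat\tau)$ and $\phi(\tau)(h)=\Phi(\tau)(h)+\mathcal O(h^{p+\frac12})$ for all rooted trees $\tau$ of order less than $q$, then $E\phi(\tau)(h)=E\Phi(\tau)(h)+\mathcal O(h^{p+\frac12})$ for all $\tau\in\widehat{TS}(\hat\tau)$.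
   Context: Underlying problem: separable Stratonovich SDEs $dX^{(1)}=\sum_{m=0}^M g^{(1)}_m(X^{(2)})\circ dW_m$, $dX^{(2)}=\sum_{m=0}^M g^{(2)}_m(X^{(1)})\circ dW_m$, with $W_1,\dots,W_M$ independent Wiener processes (starting at $0$) and $W_0(t)=t$. The method is $H^{(q)}_i=Y^{(q)}_n+\sum_{m}\sum_j Z^{(q,m)}_{i,j}g^{(q)}_m(H^{(1)}_j,H^{(2)}_j)$, $Y^{(q)}_{n+1}=Y^{(q)}_n+\sum_m\sum_i\gamma^{(q,m)}_ig^{(q)}_m(H^{(1)}_i,H^{(2)}_i)$, where the coefficients $Z^{(q,m)}_{i,j},\gamma^{(q,m)}_i$ are random variables depending on the step size $h$. Trees (with $Q=2$). $T=T_1\cup T_2$, $T_q=\{\emptyset_q\}\cup T_{q,0}\cup\dots\cup T_{q,M}$, defined recursively: the one-vertex graph $\bullet_{q,m}$ (vertex of shape $q\in\{1,2\}$ and color $m\in\{0,\dots,M\}$) is in $T_{q,m}$; if $\tau_1,\dots,\tau_\kappa\in T\setminus\{\emptyset_1,\emptyset_2\}$ then $[\tau_1,\dots,\tau_\kappa]_{q,m}\in T_{q,m}$, the tree formed by joining $\tau_1,\dots,\tau_\kappa$ each by one branch to a common root of shape $q$ and color $m$ (order of subtrees irrelevant). The order $\rho(\tau)$ of a tree is the number of its vertices of color $0$ plus one half the number of its vertices of color $\neq0$ ($\rho(\emptyset_q)=0$); the order of an unrooted tree is defined in the same way. $TS\subset T$ is the set of (nonempty) trees in which a node of one shape is never directly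 followed by (adjacent to) a node of the same shape. For $\tau\in TS$, $\hat\tau$ denotes the corresponding unrooted tree (shapes and colors of nodes are kept), and $\widehat{TS}(\hat\tau)\subset TS$ is the set of rooted trees obtained from $\hat\tau$ by choosing one of its nodes as the root. Weights of the exact solution: $\phi(\emptyset_q)(h)=1$, $\phi(\bullet_{q,m})(h)=W_m(h)$, $\phi([\tau_1,\dots,\tau_\kappa]_{q,m})(h)=\int_0^h\prod_{k=1}^\kappa\phi(\tau_k)(s)\circ dW_m(s)$ (Stratonovich for $m\ge1$, $ds$ for $m=0$). Weights of the numerical solution: $\Psi_i(\emptyset_q)(h)=1$, $\Psi_i(\bullet_{q,m})(h)=\sum_jZ^{(q,m)}_{i,j}$, $\Psi_i([\tau_1,\dots,\tau_\kappa]_{q,m})(h)=\sum_jZ^{(q,m)}_{i,j}\prod_k\Psi_j(\tau_k)(h)$; $\Phi(\emptyset_q)(h)=1$, $\Phi(\bullet_{q,m})(h)=\sum_i\gamma^{(q,m)}_i$, $\Phi([\tau_1,\dots,\tau_\kappa]_{q,m})(h)=\sum_i\gamma^{(q,m)}_i\prod_k\Psi_i(\tau_k)(h)$. Conventions. $p$ is a positive integer or half-integer. $\mathcal O(\cdot)$ refers to $h\to0$, and for random variables to the $L^2$-norm. Standing assumption on the method: $\Phi(\tau)(h)=\mathcal O(h^{\rho(\tau)})$ for all $\tau\in T$, and $E\prod_{k=1}^\kappa\Phi(\tau_k)(h)=\mathcal O(h^{\sum_{k=1}^\kappa\rho(\tau_k)})$ for all $\kappa\in\mathbb N$ and $\tau_1,\dots,\tau_\kappa\in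 T$. *)

theory Defs
  imports "HOL-Probability.Probability" "HOL-Library.Multiset" "HOL-Library.Landau_Symbols"
begin

section \<open>Rooted trees\<close>

datatype shape = Shape1 | Shape2

text \<open>
  \<open>Node q m ts\<close> is the tree $[\tau_1,\dots,\tau_\kappa]_{q,m}$ with multiset of subtrees \<open>ts\<close>;
  the one-vertex tree $\bullet_{q,m}$ is \<open>Node q m {#}\<close>. That the empty tree is never a proper
  subtree is part of the definition of \<open>trees\<close>, not of the type.
\<close>

datatype tree = Empty shape | Node shape nat "tree multiset"

inductive_set trees :: "nat \<Rightarrow> tree set" for M :: nat where
  Empty: "Empty q \<in> trees M"
| Node: "m \<le> M \<Longrightarrow> \<forall>\<tau>\<in>#ts. \<tau> \<in> trees M \<and> (\<forall>q'. \<tau> \<noteq> Empty q') \<Longrightarrow> Node q m ts \<in> trees M"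

primrec root_shape :: "tree \<Rightarrow> shape" where
  "root_shape (Empty q) = q"
| "root_shape (Node q m ts) = q"

definition color_weight :: "nat \<Rightarrow> real" where
  "color_weight m = (if m = 0 then 1 else 1 / 2)"

primrec order_tree :: "tree \<Rightarrow> real" where
  "order_tree (Empty q) = 0"
| "order_tree (Node q m ts) = color_weight m + (\<Sum>\<tau>\<in>#ts. order_tree \<tau>)"

inductive_set TS :: "nat \<Rightarrow> tree set" for M :: nat where
  Node: "m \<le> M \<Longrightarrow> \<forall>\<tau>\<in>#ts. \<tau> \<in> TS M \<and> root_shape \<tau> \<noteq> q \<Longrightarrow> Node q m ts \<in> TS M"

lemma TS_nonempty_tree: "\<tau> \<in> TS M \<Longrightarrow> \<tau> \<noteq> Empty q"
  by (auto elim: TS.cases)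

lemma TS_subset_trees: "TS M \<subseteq> trees M"
proof
  fix \<tau> assume "\<tau> \<in> TS M"
  then show "\<tau> \<in> trees M"
    by induction (auto intro!: trees.Node dest: TS_nonempty_tree)
qed

section \<open>Unrooted trees\<close>

record 'v labelled_graph =
  verts :: "'v set"
  edges :: "('v \<times> 'v) set"
  shape_at :: "'v \<Rightarrow> shape"
  color_at :: "'v \<Rightarrow> nat"

definition has_cycle :: "('v, 'b) labelled_graph_scheme \<Rightarrow> bool" where
  "has_cycle G \<longleftrightarrow> (\<exists>xs. length xs \<ge> 3 \<and> distinct xs \<and>
     (\<forall>k<length xs. (xs ! k, xs ! (Suc k mod length xs)) \<in> edges G))"

definition unrooted_tree :: "('v, 'b) labelled_graph_scheme \<Rightarrow> bool" where
  "unrooted_tree G \<longleftrightarrow>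
     finite (verts G) \<and> verts G \<noteq> {} \<and>
     edges G \<subseteq> verts G \<times> verts G \<and> sym (edges G) \<and> irrefl (edges G) \<and>
     (\<forall>u\<in>verts G. \<forall>v\<in>verts G. (u, v) \<in> (edges G)\<^sup>*) \<and>
     \<not> has_cycle G"

definition order_unrooted :: "('v, 'b) labelled_graph_scheme \<Rightarrow> real" where
  "order_unrooted G = (\<Sum>v\<in>verts G. color_weight (color_at G v))"

text \<open>
  \<open>hanging G A v \<tau>\<close>: \<open>\<tau>\<close> is the rooted tree hanging at the vertex \<open>v\<close>, where \<open>A\<close> contains the
  parent of \<open>v\<close>, if there is one. For \<open>A = {}\<close>, this is the whole of \<open>G\<close> with root \<open>v\<close>.
\<close>

inductive hanging :: "('v, 'b) labelled_graph_scheme \<Rightarrow> 'v set \<Rightarrow> 'v \<Rightarrow> tree \<Rightarrow> bool"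
  for G :: "('v, 'b) labelled_graph_scheme" where
  "\<forall>w \<in> edges G `` {v} - A. hanging G {v} w (f w) \<Longrightarrow>
   hanging G A v (Node (shape_at G v) (color_at G v) (image_mset f (mset_set (edges G `` {v} - A))))"

definition rooted_at :: "('v, 'b) labelled_graph_scheme \<Rightarrow> 'v \<Rightarrow> tree \<Rightarrow> bool" where
  "rooted_at G v \<tau> \<longleftrightarrow> v \<in> verts G \<and> hanging G {} v \<tau>"

text \<open>
  Unrooted trees matter only up to isomorphism: \<open>G\<close> represents $\hat\tau$ if and only if
  \<open>rooted_at G v \<tau>\<close> for some \<open>v\<close>.
\<close>

definition TS_hat :: "nat \<Rightarrow> ('v, 'b) labelled_graph_scheme \<Rightarrow> tree set" where
  "TS_hat M G = {\<tau> \<in> TS M. \<exists>v. rooted_at G v \<tau>}"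

section \<open>Wiener processes and Stratonovich integrals\<close>

definition continuous_process :: "'w measure \<Rightarrow> (real \<Rightarrow> 'w \<Rightarrow> real) \<Rightarrow> bool" where
  "continuous_process P X \<longleftrightarrow>
     (\<forall>t\<ge>0. X t \<in> borel_measurable P) \<and>
     (AE \<omega> in P. continuous_on {0..} (\<lambda>t. X t \<omega>))"

definition wiener_process :: "'w measure \<Rightarrow> (real \<Rightarrow> 'w \<Rightarrow> real) \<Rightarrow> bool" where
  "wiener_process P W \<longleftrightarrow>
     continuous_process P W \<and>
     (AE \<omega> in P. W 0 \<omega> = 0) \<and>
     (\<forall>s t. 0 \<le> s \<and> s < t \<longrightarrow>
        distributed P lborel (\<lambda>\<omega>. W t \<omega> - W s \<omega>) (normal_density 0 (sqrt (t - s)))) \<and>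
     (\<forall>n (t :: nat \<Rightarrow> real). 0 \<le> t 0 \<and> (\<forall>k<n. t k \<le> t (Suc k)) \<longrightarrow>
        prob_space.indep_vars P (\<lambda>_. borel) (\<lambda>k \<omega>. W (t (Suc k)) \<omega> - W (t k) \<omega>) {..<n})"

text \<open>
  The independence of $W_1,\dots,W_M$ is independence as processes, that is, of the path-valued
  random variables with values in the product space $\mathbb R^{[0,\infty)}$.
\<close>

definition driving_processes :: "'w measure \<Rightarrow> nat \<Rightarrow> (nat \<Rightarrow> real \<Rightarrow> 'w \<Rightarrow> real) \<Rightarrow> bool" where
  "driving_processes P M W \<longleftrightarrow>
     (\<forall>t \<omega>. W 0 t \<omega> = t) \<and>
     (\<forall>m\<in>{1..M}. wiener_process P (W m)) \<and>
     prob_space.indep_vars P (\<lambda>_. PiM {0..} (\<lambda>_. borel)) (\<lambda>m \<omega>. \<lambda>t\<in>{0..}. W m t \<omega>) {1..M}"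

definition is_partition :: "real \<Rightarrow> nat \<Rightarrow> (nat \<Rightarrow> real) \<Rightarrow> bool" where
  "is_partition h n t \<longleftrightarrow> t 0 = 0 \<and> t n = h \<and> (\<forall>k<n. t k < t (Suc k))"

definition stratonovich_sum ::
  "(real \<Rightarrow> 'w \<Rightarrow> real) \<Rightarrow> (real \<Rightarrow> 'w \<Rightarrow> real) \<Rightarrow> nat \<Rightarrow> (nat \<Rightarrow> real) \<Rightarrow> 'w \<Rightarrow> real" where
  "stratonovich_sum X V n t \<omega> =
     (\<Sum>k<n. (X (t k) \<omega> + X (t (Suc k)) \<omega>) / 2 * (V (t (Suc k)) \<omega> - V (t k) \<omega>))"

text \<open>
  \<open>Y\<close> is a continuous version of the process $\int_0^\cdot X \circ dV$: for every $h \ge 0$, the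
  trapezoidal sums on $[0,h]$ converge to $Y(h)$ in probability as the mesh of the partition
  tends to $0$.
\<close>

definition stratonovich_integral ::
  "'w measure \<Rightarrow> (real \<Rightarrow> 'w \<Rightarrow> real) \<Rightarrow> (real \<Rightarrow> 'w \<Rightarrow> real) \<Rightarrow> (real \<Rightarrow> 'w \<Rightarrow> real) \<Rightarrow> bool" where
  "stratonovich_integral P X V Y \<longleftrightarrow>
     continuous_process P Y \<and>
     (\<forall>h\<ge>0. \<forall>\<epsilon>>0. \<exists>\<delta>>0. \<forall>n t. is_partition h n t \<and> (\<forall>k<n. t (Suc k) - t k < \<delta>) \<longrightarrow>
        measure P {\<omega> \<in> space P. \<bar>stratonovich_sum X V n t \<omega> - Y h \<omega>\<bar> > \<epsilon>} < \<epsilon>)"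

definition time_integral ::
  "'w measure \<Rightarrow> (real \<Rightarrow> 'w \<Rightarrow> real) \<Rightarrow> (real \<Rightarrow> 'w \<Rightarrow> real) \<Rightarrow> bool" where
  "time_integral P X Y \<longleftrightarrow>
     continuous_process P Y \<and>
     (AE \<omega> in P. \<forall>h\<ge>0. Y h \<omega> = integral {0..h} (\<lambda>s. X s \<omega>))"

section \<open>Weights of the exact and of the numerical solution\<close>

text \<open>
  Stochastic integrals are determined only up to null sets, so the recursion for the exact weights
  is a relation: \<open>\<phi>\<close> is any family of versions satisfying it.
\<close>

definition exact_weights ::
  "'w measure \<Rightarrow> nat \<Rightarrow> (nat \<Rightarrow> real \<Rightarrow> 'w \<Rightarrow> real) \<Rightarrow> (tree \<Rightarrow> real \<Rightarrow> 'w \<Rightarrow> real) \<Rightarrow> bool" where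
  "exact_weights P M W \<phi> \<longleftrightarrow>
     (\<forall>q. \<forall>h\<ge>0. \<forall>\<omega>\<in>space P. \<phi> (Empty q) h \<omega> = 1) \<and>
     (\<forall>q. \<forall>m\<le>M. \<forall>h\<ge>0. \<forall>\<omega>\<in>space P. \<phi> (Node q m {#}) h \<omega> = W m h \<omega>) \<and>
     (\<forall>q m ts. ts \<noteq> {#} \<and> Node q m ts \<in> trees M \<longrightarrow>
        (if m = 0 then time_integral P (\<lambda>s \<omega>. \<Prod>\<tau>\<in>#ts. \<phi> \<tau> s \<omega>) (\<phi> (Node q m ts))
         else stratonovich_integral P (\<lambda>s \<omega>. \<Prod>\<tau>\<in>#ts. \<phi> \<tau> s \<omega>) (W m) (\<phi> (Node q m ts))))"

type_synonym 'w Z_coeffs = "shape \<Rightarrow> nat \<Rightarrow> nat \<Rightarrow> nat \<Rightarrow> real \<Rightarrow> 'w \<Rightarrow> real"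
type_synonym 'w \<gamma>_coeffs = "shape \<Rightarrow> nat \<Rightarrow> nat \<Rightarrow> real \<Rightarrow> 'w \<Rightarrow> real"

text \<open>
  \<open>Z q m i j h\<close> and \<open>\<gamma> q m i h\<close> are the random coefficients $Z^{(q,m)}_{i,j}$ and
  $\gamma^{(q,m)}_i$ for the step size \<open>h\<close>.
\<close>

definition method_coefficients ::
  "'w measure \<Rightarrow> nat \<Rightarrow> nat \<Rightarrow> 'w Z_coeffs \<Rightarrow> 'w \<gamma>_coeffs \<Rightarrow> bool" where
  "method_coefficients P M s Z \<gamma> \<longleftrightarrow>
     (\<forall>q. \<forall>m\<le>M. \<forall>i\<in>{1..s}. \<forall>h>0.
        \<gamma> q m i h \<in> borel_measurable P \<and> (\<forall>j\<in>{1..s}. Z q m i j h \<in> borel_measurable P))"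

primrec stage_weight :: "nat \<Rightarrow> 'w Z_coeffs \<Rightarrow> tree \<Rightarrow> nat \<Rightarrow> real \<Rightarrow> 'w \<Rightarrow> real" where
  "stage_weight s Z (Empty q) = (\<lambda>i h \<omega>. 1)"
| "stage_weight s Z (Node q m ts) =
     (\<lambda>i h \<omega>. \<Sum>j=1..s. Z q m i j h \<omega> * (\<Prod>\<tau>\<in>#ts. stage_weight s Z \<tau> j h \<omega>))"

primrec numerical_weight :: "nat \<Rightarrow> 'w Z_coeffs \<Rightarrow> 'w \<gamma>_coeffs \<Rightarrow> tree \<Rightarrow> real \<Rightarrow> 'w \<Rightarrow> real" where
  "numerical_weight s Z \<gamma> (Empty q) = (\<lambda>h \<omega>. 1)"
| "numerical_weight s Z \<gamma> (Node q m ts) =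
     (\<lambda>h \<omega>. \<Sum>i=1..s. \<gamma> q m i h \<omega> * (\<Prod>\<tau>\<in>#ts. stage_weight s Z \<tau> i h \<omega>))"

section \<open>Order of convergence\<close>

text \<open>
  Expectations and norms are Bochner integrals, which are $0$ for non-integrable functions;
  therefore the estimates include (square-)integrability for all small $h > 0$.
\<close>

definition L2_bigo :: "'w measure \<Rightarrow> (real \<Rightarrow> 'w \<Rightarrow> real) \<Rightarrow> real \<Rightarrow> bool" where
  "L2_bigo P X r \<longleftrightarrow>
     (\<forall>\<^sub>F h in at_right 0. X h \<in> borel_measurable P \<and> integrable P (\<lambda>\<omega>. (X h \<omega>)\<^sup>2)) \<and>
     (\<lambda>h. sqrt (\<integral>\<omega>. (X h \<omega>)\<^sup>2 \<partial>P)) \<in> O[at_right 0](\<lambda>h. h powr r)"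

definition moment_condition ::
  "'w measure \<Rightarrow> nat \<Rightarrow> nat \<Rightarrow> 'w Z_coeffs \<Rightarrow> 'w \<gamma>_coeffs \<Rightarrow> bool" where
  "moment_condition P M s Z \<gamma> \<longleftrightarrow>
     (\<forall>\<tau>\<in>trees M. L2_bigo P (numerical_weight s Z \<gamma> \<tau>) (order_tree \<tau>)) \<and>
     (\<forall>ts. set ts \<subseteq> trees M \<longrightarrow>
        (\<forall>\<^sub>F h in at_right 0. integrable P (\<lambda>\<omega>. \<Prod>\<tau>\<leftarrow>ts. numerical_weight s Z \<gamma> \<tau> h \<omega>)) \<and>
        (\<lambda>h. \<integral>\<omega>. (\<Prod>\<tau>\<leftarrow>ts. numerical_weight s Z \<gamma> \<tau> h \<omega>) \<partial>P)
          \<in> O[at_right 0](\<lambda>h. h powr (\<Sum>\<tau>\<leftarrow>ts. order_tree \<tau>)))"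

definition strong_match ::
  "'w measure \<Rightarrow> (tree \<Rightarrow> real \<Rightarrow> 'w \<Rightarrow> real) \<Rightarrow> (tree \<Rightarrow> real \<Rightarrow> 'w \<Rightarrow> real) \<Rightarrow> real \<Rightarrow> tree \<Rightarrow> bool"
  where "strong_match P \<phi> \<Phi> r \<tau> \<longleftrightarrow> L2_bigo P (\<lambda>h \<omega>. \<phi> \<tau> h \<omega> - \<Phi> \<tau> h \<omega>) r"

definition weak_match ::
  "'w measure \<Rightarrow> (tree \<Rightarrow> real \<Rightarrow> 'w \<Rightarrow> real) \<Rightarrow> (tree \<Rightarrow> real \<Rightarrow> 'w \<Rightarrow> real) \<Rightarrow> real \<Rightarrow> tree \<Rightarrow> bool"
  where "weak_match P \<phi> \<Phi> r \<tau> \<longleftrightarrow>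
    (\<lambda>h. (\<integral>\<omega>. \<phi> \<tau> h \<omega> \<partial>P) - (\<integral>\<omega>. \<Phi> \<tau> h \<omega> \<partial>P)) \<in> O[at_right 0](\<lambda>h. h powr r)"

end

theory Submission
  imports Defs
begin

text \<open>
  As \<open>G\<close> is connected, it suffices to move the root along one edge. The edge joins two trees \<open>\<tau>\<^sub>1\<close>, \<open>\<tau>\<^sub>2\<close> of lower order, and
  the two rootings graft one onto the root of the other, giving \<open>\<tau>\<^sub>1 \<circ> \<tau>\<^sub>2\<close> and \<open>\<tau>\<^sub>2 \<circ> \<tau>\<^sub>1\<close>. The
  Stratonovich product rule gives \<open>\<phi>(\<tau>\<^sub>1) \<phi>(\<tau>\<^sub>2) = \<phi>(\<tau>\<^sub>1 \<circ> \<tau>\<^sub>2) + \<phi>(\<tau>\<^sub>2 \<circ> \<tau>\<^sub>1)\<close>, and the condition on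
  the coefficients gives the same identity for \<open>\<Phi>\<close>. Hence the errors of the two rootings add
  up to \<open>\<phi>(\<tau>\<^sub>1) \<phi>(\<tau>\<^sub>2) - \<Phi>(\<tau>\<^sub>1) \<Phi>(\<tau>\<^sub>2)\<close>, which inherits the order of the errors of \<open>\<tau>\<^sub>1\<close> and
  \<open>\<tau>\<^sub>2\<close> because all moments of the weights are under control.

  No stochastic calculus is presupposed: moments of the iterated integrals are bounded on the level of
  trapezoidal sums, uniformly in the partition, and passed to the limit. The product rule holds since
  its defect over \<open>[s, t]\<close> is additive over adjacent intervals and of size \<open>(t - s)\<^bsup>3/2\<^esup>\<close>.
\<close>

subsection \<open>Trees and their grafts\<close>

text \<open>The integrals are specified only as limits in probability, while the claim concerns L^2
  norms; Fatou's lemma bridges the gap, which is why no constant may depend on the partition. All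
  even moments are carried along because Cauchy-Schwarz doubles their order at each product, and
  weights are products nested to any depth. Cancellation is used at one place only,
  \<open>mbound_adapted_sum\<close>: over an interval of length L, a sum of increments with
  past-dependent factors of bounded moments has size sqrt L. Everything else is the triangle
  inequality, and this is where the exponent 3/2 is decisive: n defects of size (h/n)^(3/2) add up
  to O(n^(-1/2)) even without cancellation, whereas the order 1 of the local trapezoidal error alone
  would not do. The filtration behind the cancellation is not given; it is generated by the Wiener
  processes, and its independence of later increments is assembled from the independence of finitely
  many increments of one process and that of the processes from each other.\<close>

lemma color_weight_ge: "color_weight m \<ge> 1 / 2"
  by (simp add: color_weight_def)

lemma sum_image_mset_nonneg:
  "(\<And>x. x \<in># A \<Longrightarrow> f x \<ge> 0) \<Longrightarrow> (\<Sum>x\<in>#A. f x :: real) \<ge> 0"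
  by (induction A) auto

lemma order_tree_nonneg: "order_tree \<tau> \<ge> 0"
proof (induction \<tau>)
  case (Node q m ts)
  have "0 \<le> (\<Sum>\<tau>\<in>#ts. order_tree \<tau>)"
    by (rule sum_image_mset_nonneg) (use Node in auto)
  then show ?case using color_weight_ge[of m] by simp
qed simp

lemma order_tree_Node_ge: "order_tree (Node q m ts) \<ge> 1 / 2"
proof -
  have "0 \<le> (\<Sum>\<tau>\<in>#ts. order_tree \<tau>)"
    by (rule sum_image_mset_nonneg) (auto simp: order_tree_nonneg)
  then show ?thesis using color_weight_ge[of m] by simp
qed

lemma Node_in_TS_iff:
  "Node q m ts \<in> TS M \<longleftrightarrow> m \<le> M \<and> (\<forall>\<tau>\<in>#ts. \<tau> \<in> TS M \<and> root_shape \<tau> \<noteq> q)"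
  by (auto elim: TS.cases intro: TS.Node)

lemma sum_image_insert_mset_set:
  "finite A \<Longrightarrow> a \<in> A \<Longrightarrow>
    image_mset f (mset_set A) = add_mset (f a) (image_mset f (mset_set (A - {a})))"
  by (simp add: mset_set.remove)

subsection \<open>Changing the root\<close>

lemma hanging_unique:
  assumes "hanging G A v \<tau>" "hanging G A v \<tau>'"
  shows "\<tau> = \<tau>'"
  using assms
proof (induction arbitrary: \<tau>' rule: hanging.induct)
  case (1 v A f)
  from "1.prems" obtain g where
    g: "\<forall>w \<in> edges G `` {v} - A. hanging G {v} w (g w)"
    and \<tau>': "\<tau>' = Node (shape_at G v) (color_at G v) (image_mset g (mset_set (edges G `` {v} - A)))"
    by (auto elim: hanging.cases)
  have "f w = g w" if "w \<in># mset_set (edges G `` {v} - A)" for w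
  proof -
    \<comment> \<open>For an infinite neighbourhood \<open>mset_set\<close> is empty by convention,
      so there is no \<open>w\<close> to compare.\<close>
    have "w \<in> edges G `` {v} - A"
      using that by (cases "finite (edges G `` {v} - A)") auto
    then show ?thesis using 1(1) g by blast
  qed
  then show ?case unfolding \<tau>' by (metis image_mset_cong)
qed

text \<open>The branches away from the edge between \<open>u\<close> and \<open>v\<close> are the
  same in both rootings, so the derivation for the root \<open>u\<close> already contains nearly all
  that the root \<open>v\<close> needs. The only new branch is the one at \<open>u\<close>, and it
  is the old tree without its branch at \<open>v\<close>.\<close>

lemma hanging_neighbour:
  assumes fin: "finite (edges G `` {u})" "finite (edges G `` {v})"
    and sym: "(u, v) \<in> edges G" "(v, u) \<in> edges G"
    and h: "hanging G {} u \<tau>"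
  shows "\<exists>ts ts'. \<tau> = Node (shape_at G u) (color_at G u)
        (add_mset (Node (shape_at G v) (color_at G v) ts') ts) \<and>
      hanging G {} v (Node (shape_at G v) (color_at G v)
        (add_mset (Node (shape_at G u) (color_at G u) ts) ts'))"
proof -
  from h obtain f where
    f: "\<forall>w \<in> edges G `` {u}. hanging G {u} w (f w)"
    and \<tau>: "\<tau> = Node (shape_at G u) (color_at G u) (image_mset f (mset_set (edges G `` {u})))"
    by (auto elim: hanging.cases)
  have "hanging G {u} v (f v)" using f sym by blast
  then obtain g where
    g: "\<forall>w \<in> edges G `` {v} - {u}. hanging G {v} w (g w)"
    and fv: "f v = Node (shape_at G v) (color_at G v) (image_mset g (mset_set (edges G `` {v} - {u})))"
    by (auto elim: hanging.cases)
  define ts where "ts = image_mset f (mset_set (edges G `` {u} - {v}))"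
  define ts' where "ts' = image_mset g (mset_set (edges G `` {v} - {u}))"
  define \<tau>1 where "\<tau>1 = Node (shape_at G u) (color_at G u) ts"
  have h1: "hanging G {v} u \<tau>1"
    unfolding \<tau>1_def ts_def by (rule hanging.intros) (use f in blast)
  \<comment> \<open>\<open>g\<close> describes the branches at \<open>v\<close> except towards its
    former parent \<open>u\<close>; overriding it at \<open>u\<close> supplies the missing
    one.\<close>
  have "hanging G {} v (Node (shape_at G v) (color_at G v)
      (image_mset (g(u := \<tau>1)) (mset_set (edges G `` {v} - {}))))"
    by (rule hanging.intros) (use g h1 in auto)
  moreover have "image_mset (g(u := \<tau>1)) (mset_set (edges G `` {v} - {}))
      = add_mset \<tau>1 (image_mset (g(u := \<tau>1)) (mset_set (edges G `` {v} - {u})))"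
    using sum_image_insert_mset_set[of "edges G `` {v}" u "g(u := \<tau>1)"] fin sym by simp
  moreover have "image_mset (g(u := \<tau>1)) (mset_set (edges G `` {v} - {u})) = ts'"
    unfolding ts'_def by (rule image_mset_cong) (use fin in auto)
  moreover have "\<tau> = Node (shape_at G u) (color_at G u) (add_mset (f v) ts)"
    unfolding \<tau> ts_def using sum_image_insert_mset_set[of "edges G `` {u}" v f] fin sym by simp
  ultimately show ?thesis
    unfolding fv \<tau>1_def ts'_def[symmetric] by auto
qed

subsection \<open>The order of a rooted tree is at most that of the graph\<close>

text \<open>Turns reachability into a list without repetition, the form in which
  \<open>has_cycle\<close> speaks of cycles.\<close>

lemma rtrancl_distinct_path:
  assumes "(x, y) \<in> r\<^sup>*"
  shows "\<exists>xs. xs \<noteq> [] \<and> distinct xs \<and> hd xs = x \<and> last xs = y \<and>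
    (\<forall>k. Suc k < length xs \<longrightarrow> (xs ! k, xs ! Suc k) \<in> r)"
  using assms
proof (induction rule: rtrancl_induct)
  case base
  show ?case by (rule exI[of _ "[x]"]) simp
next
  case (step y z)
  then obtain xs where xs: "xs \<noteq> []" "distinct xs" "hd xs = x" "last xs = y"
    "\<And>k. Suc k < length xs \<Longrightarrow> (xs ! k, xs ! Suc k) \<in> r" by blast
  show ?case
  proof (cases "z \<in> set xs")
    case True
    then obtain i where i: "i < length xs" "xs ! i = z" by (auto simp: in_set_conv_nth)
    show ?thesis
    \<comment> \<open>Here \<open>z\<close> has been visited before, and the path is cut at that
      visit.\<close>
    proof (intro exI[of _ "take (Suc i) xs"] conjI allI impI)
      show "last (take (Suc i) xs) = z" using i by (simp add: take_Suc_conv_app_nth)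
    qed (use xs i in \<open>auto simp: hd_conv_nth\<close>)
  next
    case False
    have "(( xs @ [z]) ! k, (xs @ [z]) ! Suc k) \<in> r" if "Suc k < length (xs @ [z])" for k
    proof (cases "Suc k < length xs")
      case True
      then show ?thesis using xs(5)[of k] by (simp add: nth_append)
    next
      case False
      then have k: "Suc k = length xs" using that by simp
      then have "xs ! k = y" using xs(1,4) by (metis diff_Suc_1 last_conv_nth)
      then show ?thesis using k step(2) by (simp add: nth_append)
    qed
    then show ?thesis
      by (intro exI[of _ "xs @ [z]"]) (use xs False in auto)
  qed
qed

text \<open>With \<open>A\<close> the parent of \<open>w\<close>, the vertices reachable from
  \<open>w\<close> along this relation are those of the branch hanging at \<open>w\<close>.\<close>

definition avoiding :: "('v, 'b) labelled_graph_scheme \<Rightarrow> 'v set \<Rightarrow> ('v \<times> 'v) set" where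
  "avoiding G A = {(x, y) \<in> edges G. x \<notin> A \<and> y \<notin> A}"

lemma avoiding_rtrancl_notin:
  assumes "(x, y) \<in> (avoiding G A)\<^sup>*" "x \<notin> A"
  shows "y \<notin> A"
  using assms by (induction rule: rtrancl_induct) (auto simp: avoiding_def)

text \<open>A simple path from \<open>w\<close> to \<open>w'\<close> that misses \<open>v\<close>
  closes up through \<open>v\<close>; as \<open>w\<close> and \<open>w'\<close> differ, the
  resulting cycle has at least three vertices. So distinct branches at \<open>v\<close> meet only in
  \<open>v\<close>.\<close>

lemma cycle_through:
  assumes "unrooted_tree G"
    and e: "(v, w) \<in> edges G" "(v, w') \<in> edges G" and ne: "w \<noteq> w'"
    and path: "(w, w') \<in> (avoiding G {v})\<^sup>*"
  shows False
proof -
  have sym: "sym (edges G)" and irr: "irrefl (edges G)" and nc: "\<not> has_cycle G"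
    using assms(1) by (auto simp: unrooted_tree_def)
  have wv: "w \<noteq> v" using e irr by (auto simp: irrefl_def)
  from rtrancl_distinct_path[OF path] obtain xs where
    xs: "xs \<noteq> []" "distinct xs" "hd xs = w" "last xs = w'"
    "\<And>k. Suc k < length xs \<Longrightarrow> (xs ! k, xs ! Suc k) \<in> avoiding G {v}" by blast
  have len: "length xs \<ge> 2"
  proof (rule ccontr)
    assume "\<not> ?thesis"
    then obtain a where "xs = [a]" using xs(1) by (cases xs) (auto simp: Suc_le_eq)
    then show False using xs ne by simp
  qed
  \<comment> \<open>With at least two entries, each entry has a successor or a predecessor on the
    path, and no edge of \<open>avoiding G {v}\<close> touches \<open>v\<close>.\<close>
  have v: "v \<notin> set xs"
  proof
    assume "v \<in> set xs"
    then obtain i where i: "i < length xs" "xs ! i = v" by (auto simp: in_set_conv_nth)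
    show False
    proof (cases "Suc i < length xs")
      case True
      then show ?thesis using xs(5)[of i] i by (auto simp: avoiding_def)
    next
      case False
      then obtain j where j: "i = Suc j" using len i by (cases i) auto
      then show ?thesis using xs(5)[of j] i by (auto simp: avoiding_def)
    qed
  qed
  have "has_cycle G"
    unfolding has_cycle_def
  proof (intro exI conjI allI impI)
    show "3 \<le> length (v # xs)" using len by simp
    show "distinct (v # xs)" using v xs by simp
    fix k assume k: "k < length (v # xs)"
    consider "k = 0" | j where "k = Suc j" "Suc j < length xs" | j where "k = Suc j" "Suc j = length xs"
      using k by (cases k) (auto simp: less_Suc_eq)
    then show "((v # xs) ! k, (v # xs) ! (Suc k mod length (v # xs))) \<in> edges G"
    proof cases
      case 1
      then show ?thesis using xs(1,3) e by (simp add: hd_conv_nth)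
    next
      case 2
      then show ?thesis using xs(5)[of j] by (auto simp: avoiding_def)
    next
      case 3
      then have "xs ! j = w'" using xs(1,4) by (metis diff_Suc_1 last_conv_nth)
      moreover have "(w', v) \<in> edges G" using e sym by (auto simp: sym_def)
      moreover have "(v # xs) ! Suc j = w'" using \<open>xs ! j = w'\<close> by simp
      moreover have "Suc (Suc j) mod length (v # xs) = 0" using 3(2) by simp
      ultimately show ?thesis unfolding 3(1) by (simp only: nth_Cons_0)
    qed
  qed
  then show False using nc by blast
qed

text \<open>The branches at the children of \<open>v\<close> occupy disjoint sets of vertices, none
  containing \<open>v\<close> or its parent, so no vertex is counted twice. The inequality is what
  later makes the two parts of a tree cut at an edge fall strictly below the order of the
  graph.\<close>

lemma order_tree_hanging_le:
  assumes G: "unrooted_tree G" and "hanging G A v \<tau>"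
    and "v \<in> verts G" "v \<notin> A" "A = {} \<or> (\<exists>a. A = {a} \<and> (v, a) \<in> edges G)"
  shows "order_tree \<tau> \<le> (\<Sum>x\<in>{x. (v, x) \<in> (avoiding G A)\<^sup>*}. color_weight (color_at G x))"
  using assms(2-)
proof (induction rule: hanging.induct)
  case (1 v A f)
  define cw where "cw x = color_weight (color_at G x)" for x
  have cw0: "cw x \<ge> 0" for x unfolding cw_def using color_weight_ge[of "color_at G x"] by simp
  define R where "R B u = {x. (u, x) \<in> (avoiding G B)\<^sup>*}" for B u
  have fV: "finite (verts G)" and eV: "edges G \<subseteq> verts G \<times> verts G"
    and sym: "sym (edges G)" and irr: "irrefl (edges G)"
    using G by (auto simp: unrooted_tree_def)
  have RV: "R B u \<subseteq> verts G" if "u \<in> verts G" for B u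
  proof
    fix x assume "x \<in> R B u"
    then have "(u, x) \<in> (avoiding G B)\<^sup>*" by (simp add: R_def)
    then show "x \<in> verts G"
      using that eV by (induction rule: rtrancl_induct) (auto simp: avoiding_def)
  qed
  then have finR: "finite (R B u)" if "u \<in> verts G" for B u
    using that fV finite_subset by blast
  define N where "N = edges G `` {v} - A"
  have NV: "N \<subseteq> verts G" using eV by (auto simp: N_def)
  then have finN: "finite N" using fV finite_subset by blast
  have Nv: "w \<noteq> v" if "w \<in> N" for w using that irr by (auto simp: N_def irrefl_def)
  have IH: "order_tree (f w) \<le> sum cw (R {v} w)" if "w \<in> N" for w
  proof -
    have "(w, v) \<in> edges G" using that sym by (auto simp: N_def sym_def)
    then show ?thesis
      using 1(1) that NV Nv[OF that] unfolding N_def R_def cw_def by blast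
  qed
  have disj: "R {v} w \<inter> R {v} w' = {}" if "w \<in> N" "w' \<in> N" "w \<noteq> w'" for w w'
  proof (rule ccontr)
    assume "\<not> ?thesis"
    then obtain x where x: "(w, x) \<in> (avoiding G {v})\<^sup>*" "(w', x) \<in> (avoiding G {v})\<^sup>*"
      by (auto simp: R_def)
    have "sym (avoiding G {v})" using sym by (auto simp: sym_def avoiding_def)
    then have "(x, w') \<in> (avoiding G {v})\<^sup>*" using x(2) by (metis sym_rtrancl symD)
    with x have "(w, w') \<in> (avoiding G {v})\<^sup>*" by auto
    then show False using cycle_through[OF G _ _ that(3)] that by (auto simp: N_def)
  qed
  have sub: "R {v} w \<subseteq> R A v - {v}" if w: "w \<in> N" for w
  proof
    fix x assume "x \<in> R {v} w"
    then have p: "(w, x) \<in> (avoiding G {v})\<^sup>*" by (simp add: R_def)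
    then have "x \<noteq> v" using avoiding_rtrancl_notin[OF p] Nv[OF w] by auto
    moreover have "(v, x) \<in> (avoiding G A)\<^sup>*" using p
    proof (induction rule: rtrancl_induct)
      case base
      then show ?case using w "1.prems" by (auto simp: avoiding_def N_def)
    next
      case (step y z)
      have yA: "y \<notin> A" using avoiding_rtrancl_notin[OF step.IH] "1.prems" by auto
      have "(w, z) \<in> (avoiding G {v})\<^sup>*" using step by auto
      \<comment> \<open>\<open>A\<close> can only hold the parent of \<open>v\<close>; reaching it
        from the child \<open>w\<close> without passing \<open>v\<close> would close a
        cycle.\<close>
      then have "z \<notin> A"
        using cycle_through[OF G, of v w z] "1.prems"(3) w by (auto simp: N_def)
      then show ?case using step yA by (auto simp: avoiding_def intro: rtrancl_into_rtrancl)
    qed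
    ultimately show "x \<in> R A v - {v}" by (simp add: R_def)
  qed
  have "order_tree (Node (shape_at G v) (color_at G v) (image_mset f (mset_set N)))
      = cw v + (\<Sum>w\<in>N. order_tree (f w))"
    by (simp add: cw_def sum_unfold_sum_mset multiset.map_comp comp_def)
  also have "(\<Sum>w\<in>N. order_tree (f w)) \<le> (\<Sum>w\<in>N. sum cw (R {v} w))"
    by (rule sum_mono) (rule IH)
  also have "\<dots> = sum cw (\<Union>w\<in>N. R {v} w)"
    by (rule sum.UNION_disjoint[symmetric]) (use finN finR NV disj in auto)
  also have "\<dots> \<le> sum cw (R A v - {v})"
    by (rule sum_mono2) (use finR[OF "1.prems"(1)] sub cw0 in auto)
  also have "cw v + sum cw (R A v - {v}) = sum cw (R A v)"
    by (rule sum.remove[symmetric]) (use finR[OF "1.prems"(1)] in \<open>auto simp: R_def\<close>)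
  finally show ?case by (simp add: R_def cw_def N_def)
qed

lemma order_tree_rooted_at_le:
  assumes G: "unrooted_tree G" and "rooted_at G v \<tau>"
  shows "order_tree \<tau> \<le> order_unrooted G"
proof -
  have v: "v \<in> verts G" "hanging G {} v \<tau>" using assms(2) by (auto simp: rooted_at_def)
  have fV: "finite (verts G)" and eV: "edges G \<subseteq> verts G \<times> verts G"
    using G by (auto simp: unrooted_tree_def)
  have "{x. (v, x) \<in> (avoiding G {})\<^sup>*} \<subseteq> verts G"
  proof clarify
    fix x assume "(v, x) \<in> (avoiding G {})\<^sup>*"
    then show "x \<in> verts G" using v(1) eV
      by (induction rule: rtrancl_induct) (auto simp: avoiding_def)
  qed
  then have "(\<Sum>x\<in>{x. (v, x) \<in> (avoiding G {})\<^sup>*}. color_weight (color_at G x)) \<le> order_unrooted G"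
    unfolding order_unrooted_def
    by (intro sum_mono2 fV) (auto intro: order_trans[OF _ color_weight_ge])
  with order_tree_hanging_le[OF G v(2,1)] show ?thesis by simp
qed

lemma TS_hat_induct:
  assumes G: "unrooted_tree G" and t0: "\<tau>\<^sub>0 \<in> TS_hat M G" "Q \<tau>\<^sub>0" and t: "\<tau> \<in> TS_hat M G"
    and step: "\<And>q\<^sub>1 m\<^sub>1 ts\<^sub>1 q\<^sub>2 m\<^sub>2 ts\<^sub>2.
      Node q\<^sub>1 m\<^sub>1 (add_mset (Node q\<^sub>2 m\<^sub>2 ts\<^sub>2) ts\<^sub>1) \<in> TS M \<Longrightarrow>
      Node q\<^sub>2 m\<^sub>2 (add_mset (Node q\<^sub>1 m\<^sub>1 ts\<^sub>1) ts\<^sub>2) \<in> TS M \<Longrightarrow>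
      order_tree (Node q\<^sub>1 m\<^sub>1 ts\<^sub>1) < order_unrooted G \<Longrightarrow>
      order_tree (Node q\<^sub>2 m\<^sub>2 ts\<^sub>2) < order_unrooted G \<Longrightarrow>
      Q (Node q\<^sub>1 m\<^sub>1 (add_mset (Node q\<^sub>2 m\<^sub>2 ts\<^sub>2) ts\<^sub>1)) \<Longrightarrow>
      Q (Node q\<^sub>2 m\<^sub>2 (add_mset (Node q\<^sub>1 m\<^sub>1 ts\<^sub>1) ts\<^sub>2))"
  shows "Q \<tau>"
proof -
  have fV: "finite (verts G)" and eV: "edges G \<subseteq> verts G \<times> verts G"
    and sym: "sym (edges G)" and conn: "\<forall>u\<in>verts G. \<forall>v\<in>verts G. (u, v) \<in> (edges G)\<^sup>*"
    using G by (auto simp: unrooted_tree_def)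
  from t0 obtain v0 where v0: "rooted_at G v0 \<tau>\<^sub>0" "\<tau>\<^sub>0 \<in> TS M" by (auto simp: TS_hat_def)
  from t obtain v where v: "rooted_at G v \<tau>" by (auto simp: TS_hat_def)
  have "(v0, v) \<in> (edges G)\<^sup>*" using v0 v conn by (auto simp: rooted_at_def)
  \<comment> \<open>Membership in \<open>TS M\<close> is carried along the walk: moving the root
    keeps adjacent shapes different.\<close>
  then have "\<exists>\<sigma>. rooted_at G v \<sigma> \<and> \<sigma> \<in> TS M \<and> Q \<sigma>"
  proof (induction rule: rtrancl_induct)
    case base
    then show ?case using v0 t0 by blast
  next
    case (step y z)
    then obtain \<sigma> where \<sigma>: "rooted_at G y \<sigma>" "\<sigma> \<in> TS M" "Q \<sigma>" by blast
    have fin: "finite (edges G `` {x})" for x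
      by (rule finite_subset[OF _ fV]) (use eV in auto)
    have zy: "(z, y) \<in> edges G" using step(2) sym by (auto simp: sym_def)
    from hanging_neighbour[OF fin fin step(2) zy] \<sigma>(1) obtain ts ts' where
      eq: "\<sigma> = Node (shape_at G y) (color_at G y)
        (add_mset (Node (shape_at G z) (color_at G z) ts') ts)" (is "_ = Node ?q ?m (add_mset ?t' ts)")
      and h: "hanging G {} z (Node (shape_at G z) (color_at G z)
        (add_mset (Node (shape_at G y) (color_at G y) ts) ts'))" (is "hanging _ _ _ ?\<sigma>'")
      unfolding rooted_at_def by blast
    have root: "rooted_at G z ?\<sigma>'" using h step(2) eV by (auto simp: rooted_at_def)
    have TS: "?\<sigma>' \<in> TS M" using \<sigma>(2) unfolding eq by (auto simp: Node_in_TS_iff)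
    \<comment> \<open>The order splits over the cut edge, and each part contributes at least 1/2
      through its own root; hence both parts are strictly smaller than the whole.\<close>
    have "order_tree \<sigma> = order_tree (Node ?q ?m ts) + order_tree ?t'"
      unfolding eq by (simp add: algebra_simps)
    then have "order_tree (Node ?q ?m ts) < order_unrooted G" "order_tree ?t' < order_unrooted G"
      using order_tree_rooted_at_le[OF G \<sigma>(1)] order_tree_Node_ge[of ?q ?m ts]
        order_tree_Node_ge[of "shape_at G z" "color_at G z" ts'] by linarith+
    then have "Q ?\<sigma>'" using assms(5)[of ?q ?m _ _ ts' ts] \<sigma> TS unfolding eq by blast
    then show ?case using root TS by blast
  qed
  \<comment> \<open>The walk yields some tree rooted at \<open>v\<close>, and there is only
    one.\<close>
  then show ?thesis using v hanging_unique by (metis rooted_at_def)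
qed

subsection \<open>The product rule for the numerical weights\<close>

text \<open>After expanding the product of the two sums, the condition replaces each product of two
  \<open>\<gamma>\<close> coefficients. Summing \<open>Z\<close> of the first shape over
  \<open>i\<close> then forms the stage weight of the first tree at stage \<open>j\<close>, which
  thereby becomes a branch of the second tree; the other term is symmetric.\<close>

lemma numerical_weight_product:
  assumes eq: "\<And>i j. i \<in> {1..s} \<Longrightarrow> j \<in> {1..s} \<Longrightarrow>
      \<gamma> q\<^sub>1 m\<^sub>1 i h w * \<gamma> q\<^sub>2 m\<^sub>2 j h w =
      \<gamma> q\<^sub>2 m\<^sub>2 j h w * Z q\<^sub>1 m\<^sub>1 j i h w + \<gamma> q\<^sub>1 m\<^sub>1 i h w * Z q\<^sub>2 m\<^sub>2 i j h w"
  shows "numerical_weight s Z \<gamma> (Node q\<^sub>1 m\<^sub>1 ts\<^sub>1) h w * numerical_weight s Z \<gamma> (Node q\<^sub>2 m\<^sub>2 ts\<^sub>2) h w =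
    numerical_weight s Z \<gamma> (Node q\<^sub>1 m\<^sub>1 (add_mset (Node q\<^sub>2 m\<^sub>2 ts\<^sub>2) ts\<^sub>1)) h w +
    numerical_weight s Z \<gamma> (Node q\<^sub>2 m\<^sub>2 (add_mset (Node q\<^sub>1 m\<^sub>1 ts\<^sub>1) ts\<^sub>2)) h w"
proof -
  define A where "A i = (\<Prod>\<tau>\<in>#ts\<^sub>1. stage_weight s Z \<tau> i h w)" for i
  define B where "B i = (\<Prod>\<tau>\<in>#ts\<^sub>2. stage_weight s Z \<tau> i h w)" for i
  have "(\<Sum>i=1..s. \<gamma> q\<^sub>1 m\<^sub>1 i h w * A i) * (\<Sum>j=1..s. \<gamma> q\<^sub>2 m\<^sub>2 j h w * B j)
      = (\<Sum>i=1..s. \<Sum>j=1..s. (\<gamma> q\<^sub>1 m\<^sub>1 i h w * \<gamma> q\<^sub>2 m\<^sub>2 j h w) * (A i * B j))"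
    by (simp add: sum_product mult_ac)
  also have "\<dots> = (\<Sum>i=1..s. \<Sum>j=1..s. \<gamma> q\<^sub>2 m\<^sub>2 j h w * Z q\<^sub>1 m\<^sub>1 j i h w * (A i * B j)
      + \<gamma> q\<^sub>1 m\<^sub>1 i h w * Z q\<^sub>2 m\<^sub>2 i j h w * (A i * B j))"
    by (intro sum.cong refl) (simp add: eq algebra_simps)
  also have "\<dots> = (\<Sum>j=1..s. \<Sum>i=1..s. \<gamma> q\<^sub>2 m\<^sub>2 j h w * Z q\<^sub>1 m\<^sub>1 j i h w * (A i * B j))
      + (\<Sum>i=1..s. \<Sum>j=1..s. \<gamma> q\<^sub>1 m\<^sub>1 i h w * Z q\<^sub>2 m\<^sub>2 i j h w * (A i * B j))"
    by (subst sum.swap) (simp add: sum.distrib)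
  also have "\<dots> = (\<Sum>j=1..s. \<gamma> q\<^sub>2 m\<^sub>2 j h w * ((\<Sum>i=1..s. Z q\<^sub>1 m\<^sub>1 j i h w * A i) * B j))
      + (\<Sum>i=1..s. \<gamma> q\<^sub>1 m\<^sub>1 i h w * ((\<Sum>j=1..s. Z q\<^sub>2 m\<^sub>2 i j h w * B j) * A i))"
    by (simp add: sum_distrib_left sum_distrib_right mult_ac)
  finally show ?thesis by (simp add: A_def B_def)
qed

subsection \<open>Independence of the increments of the driving processes from the past\<close>

text \<open>Adding the end points turns finitely many times into a partition of [0, s], the form in
  which increments of a Wiener process are known to be independent.\<close>

lemma sorted_list_of_set_enumeration:
  fixes s :: real
  assumes J: "finite J" "J \<subseteq> {0..s}" and "0 \<le> s"
  obtains xs where "xs \<noteq> []" "set xs = insert 0 (insert s J)" "sorted xs"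
    "xs ! 0 = 0" "xs ! (length xs - 1) = s"
proof
  let ?xs = "sorted_list_of_set (insert 0 (insert s J))"
  show ne: "?xs \<noteq> []" using J by (simp add: sorted_list_of_set_eq_Nil_iff del: sorted_list_of_set_insert_remove)
  show set: "set ?xs = insert 0 (insert s J)" using J by (intro set_sorted_list_of_set) simp
  show sorted: "sorted ?xs" by (rule sorted_sorted_list_of_set)
  have r: "0 \<le> x \<and> x \<le> s" if "x \<in> set ?xs" for x using that set assms by auto
  have "0 \<in> set ?xs" "s \<in> set ?xs" using set by auto
  then obtain i j where i: "i < length ?xs" "?xs ! i = 0" and j: "j < length ?xs" "?xs ! j = s"
    by (metis in_set_conv_nth)
  have "?xs ! 0 \<le> ?xs ! i" by (rule sorted_nth_mono[OF sorted]) (use i in auto)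
  moreover have "0 \<le> ?xs ! 0" using r[of "?xs ! 0"] ne by (metis length_greater_0_conv nth_mem)
  ultimately show "?xs ! 0 = 0" using i by linarith
  have "?xs ! j \<le> ?xs ! (length ?xs - 1)" by (rule sorted_nth_mono[OF sorted]) (use j in auto)
  moreover have "?xs ! (length ?xs - 1) \<le> s"
    using r[of "?xs ! (length ?xs - 1)"] ne by (metis diff_less length_greater_0_conv nth_mem zero_less_one)
  ultimately show "?xs ! (length ?xs - 1) = s" using j by linarith
qed

lemma sets_Collect_finite_Ball_vimage:
  assumes "finite J" "\<And>u. u \<in> J \<Longrightarrow> X u \<in> measurable M N" "\<And>u. u \<in> J \<Longrightarrow> B u \<in> sets N"
  shows "{w\<in>space M. \<forall>u\<in>J. X u w \<in> B u} \<in> sets M"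
  using assms
proof (induction J)
  case (insert u J)
  have "{w\<in>space M. \<forall>u\<in>insert u J. X u w \<in> B u}
      = (X u -` B u \<inter> space M) \<inter> {w\<in>space M. \<forall>u\<in>J. X u w \<in> B u}" by auto
  moreover have "X u -` B u \<inter> space M \<in> sets M" using insert.prems by (auto intro: measurable_sets)
  moreover have "{w\<in>space M. \<forall>u\<in>J. X u w \<in> B u} \<in> sets M" using insert by auto
  ultimately show ?case by simp
qed simp

lemma Int_stable_vimage: "Int_stable {Y -` A \<inter> \<Omega> |A. A \<in> sets N}"
proof (rule Int_stableI)
  fix a b assume "a \<in> {Y -` A \<inter> \<Omega> |A. A \<in> sets N}" "b \<in> {Y -` A \<inter> \<Omega> |A. A \<in> sets N}"
  then obtain C C' where "C \<in> sets N" "C' \<in> sets N" "a \<inter> b = Y -` (C \<inter> C') \<inter> \<Omega>" by auto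
  then show "a \<inter> b \<in> {Y -` A \<inter> \<Omega> |A. A \<in> sets N}" by (auto intro!: exI[of _ "C \<inter> C'"])
qed

section \<open>A single Wiener process: increments and the path before them\<close>

context prob_space
begin

definition past_events :: "(real \<Rightarrow> 'a \<Rightarrow> real) \<Rightarrow> real \<Rightarrow> 'a set set" where
  "past_events X s = {X u -` B \<inter> space M | u B. 0 \<le> u \<and> u \<le> s \<and> B \<in> sets borel}"

text \<open>Up to \<open>W 0\<close>, the value at a time of \<open>J\<close> is a sum of increments
  over a partition of [0, s], and these increments are jointly independent of the one over
  [s, t].\<close>

lemma wiener_increment_indep_finite:
  assumes W: "wiener_process M W" and st: "0 \<le> s" "s \<le> t"
    and J: "finite J" "J \<subseteq> {0..s}" and B: "\<And>u. u \<in> J \<Longrightarrow> B u \<in> sets borel" and C: "C \<in> sets borel"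
  shows "prob ({w\<in>space M. \<forall>u\<in>J. W u w \<in> B u} \<inter> {w\<in>space M. W t w - W s w \<in> C}) =
    prob {w\<in>space M. \<forall>u\<in>J. W u w \<in> B u} * prob {w\<in>space M. W t w - W s w \<in> C}"
proof -
  obtain xs where xs: "xs \<noteq> []" "set xs = insert 0 (insert s J)" "sorted xs"
    "xs ! 0 = 0" "xs ! (length xs - 1) = s"
    using sorted_list_of_set_enumeration[OF J st(1)] .
  define n where "n = length xs - 1"
  have len: "length xs = Suc n" using xs(1) by (simp add: n_def)
  \<comment> \<open>The enumeration reaches \<open>s\<close> at index \<open>n\<close>; one further
    point \<open>t\<close> makes the increment over [s, t] the one with index
    \<open>n\<close>.\<close>
  define \<tau> where "\<tau> k = (if k < length xs then xs ! k else t)" for k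
  have \<tau>n: "\<tau> n = s" "\<tau> (Suc n) = t" using xs(5) len by (auto simp: \<tau>_def)
  have \<tau>0: "\<tau> 0 = 0" using xs(4) len by (auto simp: \<tau>_def)
  have mono: "\<tau> k \<le> \<tau> (Suc k)" if "k < Suc n" for k
  proof (cases "k = n")
    case True then show ?thesis using \<tau>n st by simp
  next
    case False
    then show ?thesis using that len sorted_nth_mono[OF xs(3), of k "Suc k"] by (simp add: \<tau>_def)
  qed
  define inc where "inc = (\<lambda>k w. W (\<tau> (Suc k)) w - W (\<tau> k) w)"
  have "\<forall>n t. 0 \<le> t 0 \<and> (\<forall>k<n. t k \<le> t (Suc k)) \<longrightarrow>
      indep_vars (\<lambda>_. borel) (\<lambda>k w. W (t (Suc k)) w - W (t k) w) {..<n}"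
    using W by (simp add: wiener_process_def)
  from this[rule_format, of \<tau> "Suc n"] have ind: "indep_vars (\<lambda>_. borel) inc {..<Suc n}"
    using mono \<tau>0 by (simp add: inc_def)
  have Wm: "W u \<in> borel_measurable M" if "0 \<le> u" for u
    using W that by (auto simp: wiener_process_def continuous_process_def)
  have W0: "AE w in M. W 0 w = 0" using W by (auto simp: wiener_process_def)
  have iv: "indep_var (PiM {..<n} (\<lambda>_. borel)) (\<lambda>w. restrict (\<lambda>i. inc i w) {..<n})
      (PiM {n} (\<lambda>_. borel)) (\<lambda>w. restrict (\<lambda>i. inc i w) {n})"
    by (rule indep_var_restrict[OF ind]) auto
  have "\<exists>k. k \<le> n \<and> xs ! k = u" if "u \<in> J" for u
  proof -
    have "u \<in> set xs" using that xs(2) by blast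
    then show ?thesis using len by (metis in_set_conv_nth less_Suc_eq_le)
  qed
  then obtain k where k: "\<And>u. u \<in> J \<Longrightarrow> k u \<le> n" "\<And>u. u \<in> J \<Longrightarrow> xs ! k u = u" by metis
  have sum_inc: "(\<Sum>j<k u. inc j w) = W u w - W 0 w" if "u \<in> J" for u w
  proof -
    have "(\<Sum>j<k u. inc j w) = W (\<tau> (k u)) w - W (\<tau> 0) w"
      unfolding inc_def by (rule sum_lessThan_telescope)
    then show ?thesis using k[OF that] len \<tau>0 by (simp add: \<tau>_def)
  qed
  define Ea where "Ea = {v \<in> space (PiM {..<n} (\<lambda>_. borel :: real measure)). \<forall>u\<in>J. (\<Sum>j<k u. v j) \<in> B u}"
  define Eb where "Eb = {v \<in> space (PiM {n} (\<lambda>_. borel :: real measure)). v n \<in> C}"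
  have Ea: "Ea \<in> sets (PiM {..<n} (\<lambda>_. borel))"
    unfolding Ea_def
  proof (rule sets_Collect_finite_Ball_vimage[OF J(1)])
    show "(\<lambda>v. \<Sum>j<k u. v j) \<in> borel_measurable (PiM {..<n} (\<lambda>_. borel :: real measure))" if "u \<in> J" for u
      by (intro borel_measurable_sum measurable_component_singleton) (use k(1)[OF that] in auto)
  qed (rule B)
  have Eb: "Eb \<in> sets (PiM {n} (\<lambda>_. borel))"
    unfolding Eb_def using C by measurable
  \<comment> \<open>\<open>W 0\<close> vanishes only almost surely, so the event is first phrased
    with \<open>W u - W 0\<close> and compared with \<open>A\<close> up to a null set.\<close>
  define E where "E = {w\<in>space M. \<forall>u\<in>J. W u w - W 0 w \<in> B u}"
  define D where "D = {w\<in>space M. W t w - W s w \<in> C}"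
  define A where "A = {w\<in>space M. \<forall>u\<in>J. W u w \<in> B u}"
  have v1: "(\<lambda>w. restrict (\<lambda>i. inc i w) {..<n}) -` Ea \<inter> space M = E"
  proof -
    have "(\<Sum>j<k u. restrict (\<lambda>i. inc i w) {..<n} j) = W u w - W 0 w" if "u \<in> J" for u w
      unfolding sum_inc[OF that, symmetric] by (rule sum.cong) (use k(1)[OF that] in auto)
    then show ?thesis by (auto simp: Ea_def E_def space_PiM)
  qed
  have v2: "(\<lambda>w. restrict (\<lambda>i. inc i w) {n}) -` Eb \<inter> space M = D"
    by (auto simp: Eb_def D_def space_PiM inc_def \<tau>n)
  have "prob (E \<inter> D) = prob E * prob D"
  proof -
    have "(\<lambda>x. (restrict (\<lambda>i. inc i x) {..<n}, restrict (\<lambda>i. inc i x) {n})) -` (Ea \<times> Eb) \<inter> space M = E \<inter> D"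
      unfolding v1[symmetric] v2[symmetric] by auto
    then show ?thesis using indep_varD[OF iv Ea Eb] unfolding v1 v2 by simp
  qed
  moreover have Es: "E \<in> events"
    unfolding v1[symmetric] using indep_var_rv1[OF iv] Ea by (rule measurable_sets)
  moreover have Ds: "D \<in> events"
    unfolding v2[symmetric] using indep_var_rv2[OF iv] Eb by (rule measurable_sets)
  moreover have As: "A \<in> events"
    unfolding A_def
    by (rule sets_Collect_finite_Ball_vimage[of _ _ _ borel]) (use J Wm B in auto)
  moreover have "prob (E \<inter> D) = prob (A \<inter> D)"
    by (rule finite_measure_eq_AE)
      (use W0 Es Ds As in \<open>auto simp: E_def A_def elim!: eventually_mono\<close>)
  moreover have "prob E = prob A"
    by (rule finite_measure_eq_AE)
      (use W0 Es As in \<open>auto simp: E_def A_def elim!: eventually_mono\<close>)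
  ultimately show ?thesis unfolding A_def D_def by simp
qed

text \<open>\<open>past_events\<close> need not be stable under intersection. The cylinder sets over
  finitely many times are, and they contain it; independence then extends to the generated
  sigma-algebra.\<close>

lemma wiener_increment_indep_past:
  assumes W: "wiener_process M W" and st: "0 \<le> s" "s \<le> t"
  shows "indep_set (sigma_sets (space M) (past_events W s))
    {(\<lambda>w. W t w - W s w) -` C \<inter> space M | C. C \<in> sets borel}" (is "indep_set _ ?D")
proof -
  let ?\<Pi> = "{{w\<in>space M. \<forall>u\<in>J. W u w \<in> B u} | J B. finite J \<and> J \<subseteq> {0..s} \<and> (\<forall>u\<in>J. B u \<in> sets borel)}"
  have Wm: "W u \<in> borel_measurable M" if "0 \<le> u" for u
    using W that by (auto simp: wiener_process_def continuous_process_def)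
  have \<Pi>: "?\<Pi> \<subseteq> events"
  proof safe
    fix J :: "real set" and B :: "real \<Rightarrow> real set"
    assume J: "finite J" "J \<subseteq> {0..s}" and B: "\<forall>u\<in>J. B u \<in> sets borel"
    show "{w\<in>space M. \<forall>u\<in>J. W u w \<in> B u} \<in> events"
      by (rule sets_Collect_finite_Ball_vimage[of _ _ _ borel]) (use J Wm B in auto)
  qed
  have D: "?D \<subseteq> events"
    using measurable_sets[OF borel_measurable_diff[OF Wm Wm], of t s] st by auto
  have ind: "indep_set ?\<Pi> ?D"
  proof (rule indep_setI[OF \<Pi> D])
    fix a b assume a: "a \<in> ?\<Pi>" and b: "b \<in> ?D"
    from b obtain C where C: "C \<in> sets borel" and b: "b = {w\<in>space M. W t w - W s w \<in> C}" by auto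
    from a show "prob (a \<inter> b) = prob a * prob b"
      unfolding b using wiener_increment_indep_finite[OF W st _ _ _ C] by blast
  qed
  have st\<Pi>: "Int_stable ?\<Pi>"
  proof (rule Int_stableI)
    fix a b assume "a \<in> ?\<Pi>" "b \<in> ?\<Pi>"
    then obtain J B J' B' where
      a: "a = {w\<in>space M. \<forall>u\<in>J. W u w \<in> B u}" "finite J" "J \<subseteq> {0..s}" "\<forall>u\<in>J. B u \<in> sets borel" and
      b: "b = {w\<in>space M. \<forall>u\<in>J'. W u w \<in> B' u}" "finite J'" "J' \<subseteq> {0..s}" "\<forall>u\<in>J'. B' u \<in> sets borel"
      by blast
    define C where "C u = (if u \<in> J then B u else UNIV) \<inter> (if u \<in> J' then B' u else UNIV)" for u
    have "a \<inter> b = {w\<in>space M. \<forall>u\<in>J \<union> J'. W u w \<in> C u}"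
      unfolding a(1) b(1) C_def by auto
    moreover have "\<forall>u\<in>J \<union> J'. C u \<in> sets borel" using a(4) b(4) by (auto simp: C_def)
    ultimately show "a \<inter> b \<in> ?\<Pi>" using a(2,3) b(2,3) by blast
  qed
  have sub: "past_events W s \<subseteq> ?\<Pi>"
  proof
    fix a assume "a \<in> past_events W s"
    then obtain u B where "0 \<le> u" "u \<le> s" "B \<in> sets borel" "a = W u -` B \<inter> space M"
      by (auto simp: past_events_def)
    then show "a \<in> ?\<Pi>"
      by (intro CollectI exI[of _ "{u}"] exI[of _ "\<lambda>_. B"]) auto
  qed
  have "indep_set (sigma_sets (space M) ?\<Pi>) (sigma_sets (space M) ?D)"
    by (rule indep_set_sigma_sets[OF ind st\<Pi> Int_stable_vimage])
  then show ?thesis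
    unfolding indep_set_def
    by (rule indep_sets_mono_sets) (use sigma_sets_mono'[OF sub] in \<open>auto split: bool.split\<close>)
qed

end

section \<open>All driving processes together and their joint past\<close>

locale driven_space = prob_space P for P :: "'w measure" +
  fixes M :: nat and W :: "nat \<Rightarrow> real \<Rightarrow> 'w \<Rightarrow> real"
  assumes driving: "driving_processes P M W"
begin

lemma W_0: "W 0 t w = t"
  using driving by (simp add: driving_processes_def)

lemma wiener: "1 \<le> m \<Longrightarrow> m \<le> M \<Longrightarrow> wiener_process P (W m)"
  using driving by (simp add: driving_processes_def)

lemma W_measurable: "m \<le> M \<Longrightarrow> 0 \<le> t \<Longrightarrow> W m t \<in> borel_measurable P"
proof (cases "m = 0")
  case True
  then have "W m t = (\<lambda>_. t)" using W_0 by auto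
  then show ?thesis by simp
next
  assume "m \<le> M" "0 \<le> t" "m \<noteq> 0"
  then show ?thesis
    using wiener[of m] by (auto simp: wiener_process_def continuous_process_def)
qed

text \<open>The natural filtration of all Wiener processes jointly, not completed by null sets;
  \<open>adapted\<close> makes up for that.\<close>

definition history :: "real \<Rightarrow> 'w measure" where
  "history s = sigma (space P) (\<Union>m\<in>{1..M}. past_events (W m) s)"

lemma sets_history: "sets (history s) = sigma_sets (space P) (\<Union>m\<in>{1..M}. past_events (W m) s)"
  unfolding history_def
  by (rule sets_measure_of) (auto simp: past_events_def)

lemma space_history [simp]: "space (history s) = space P"
  unfolding history_def
  by (rule space_measure_of) (auto simp: past_events_def)

text \<open>The increment of one process must be independent of the pasts of all processes at once.
  The pasts of the others are separated from it by independence of the processes, its own past by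
  \<open>wiener_increment_indep_past\<close>; together they give one independent family that can be
  regrouped.\<close>

lemma increment_indep_history:
  assumes m: "1 \<le> m" "m \<le> M" and st: "0 \<le> s" "s \<le> t"
  shows "indep_set (sets (history s)) {(\<lambda>w. W m t w - W m s w) -` C \<inter> space P | C. C \<in> sets borel}"
proof -
  define \<D> where "\<D> = {(\<lambda>w. W m t w - W m s w) -` C \<inter> space P | C. C \<in> sets borel}"
  \<comment> \<open>Index 0 is free, as the Wiener processes are numbered from 1, and is given to
    the increment; \<open>V i\<close> below is the sigma-algebra of the whole path of
    \<open>W i\<close>.\<close>
  define G where "G i = (if i = 0 then \<D> else sigma_sets (space P) (past_events (W i) s))" for i
  define V where "V i = vimage_algebra (space P) (\<lambda>w. \<lambda>t\<in>{0..}. W i t w) (PiM {0::real..} (\<lambda>_. borel :: real measure))" for i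
  have setsV: "sets (V i) = {(\<lambda>w. \<lambda>t\<in>{0..}. W i t w) -` A \<inter> space P |A. A \<in> sets (PiM {0::real..} (\<lambda>_. borel))}" for i
    unfolding V_def by (rule sets_vimage_algebra2) (auto simp: space_PiM PiE_def extensional_def)
  have spV [simp]: "space (V i) = space P" for i by (simp add: V_def)
  have indV: "indep_sets (\<lambda>i. sets (V i)) {1..M}"
    using driving unfolding driving_processes_def indep_vars_def2 setsV by simp
  have WV: "W i u \<in> borel_measurable (V i)" if "0 \<le> u" for i u
  proof -
    have "(\<lambda>w. (\<lambda>t\<in>{0..}. W i t w) u) \<in> borel_measurable (V i)"
      unfolding V_def
      by (rule measurable_compose[OF measurable_vimage_algebra1 measurable_component_singleton])
        (use that in \<open>auto simp: space_PiM PiE_def extensional_def\<close>)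
    then show ?thesis using that by simp
  qed
  have pastV: "sigma_sets (space P) (past_events (W i) s) \<subseteq> sets (V i)" for i
  proof -
    have "past_events (W i) s \<subseteq> sets (V i)"
      using measurable_sets[OF WV] by (auto simp: past_events_def)
    from sets.sigma_sets_subset[OF this] show ?thesis by simp
  qed
  have DV: "\<D> \<subseteq> sets (V m)"
  proof -
    have "(\<lambda>w. W m t w - W m s w) \<in> borel_measurable (V m)"
      using WV[of t m] WV[of s m] st by (intro borel_measurable_diff) auto
    from measurable_sets[OF this] show ?thesis by (auto simp: \<D>_def)
  qed
  have Vev: "sets (V i) \<subseteq> events" if "i \<in> {1..M}" for i
    using indV that by (auto simp: indep_sets_def)
  have Dsp: "space P \<in> \<D>" by (auto simp: \<D>_def intro!: exI[of _ UNIV])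
  have psp: "space P \<in> sigma_sets (space P) (past_events (W i) s)" for i
    by (rule sigma_sets_top)
  have Gfin: "indep_sets G {0..M}"
  proof (subst indep_sets_finite)
    show "G i \<subseteq> events" if "i \<in> {0..M}" for i
      using that pastV[of i] Vev[of i] DV Vev[of m] m by (cases "i = 0") (auto simp: G_def)
    show "space P \<in> G i" if "i \<in> {0..M}" for i
      using Dsp psp by (auto simp: G_def)
    show "\<forall>A\<in>Pi {0..M} G. prob (\<Inter>j\<in>{0..M}. A j) = (\<Prod>j\<in>{0..M}. prob (A j))"
    proof
      fix A assume A: "A \<in> Pi {0..M} G"
      have A0: "A 0 \<in> \<D>" using Pi_mem[OF A, of 0] by (simp add: G_def)
      have Ai: "A i \<in> sigma_sets (space P) (past_events (W i) s)" if "i \<in> {1..M}" for i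
        using Pi_mem[OF A, of i] that by (simp add: G_def)
      \<comment> \<open>The event of the increment and the past event of \<open>W m\<close> both
        concern the path of \<open>W m\<close>, so they are merged before independence of the
        processes is applied.\<close>
      define A' where "A' i = (if i = m then A 0 \<inter> A m else A i)" for i
      have split: "{0..M} = insert 0 {1..M}" "{1..M} = insert m ({1..M} - {m})" using m by auto
      have A'V: "A' i \<in> sets (V i)" if "i \<in> {1..M}" for i
        using Ai[OF that] pastV[of i] A0 DV that by (auto simp: A'_def)
      have "(\<Inter>j\<in>{0..M}. A j) = (\<Inter>j\<in>{1..M}. A' j)"
        using m by (auto simp: split(1) A'_def)
      then have "prob (\<Inter>j\<in>{0..M}. A j) = (\<Prod>j\<in>{1..M}. prob (A' j))"
        using indep_setsD[OF indV, of "{1..M}" A'] A'V m by auto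
      also have "\<dots> = prob (A 0 \<inter> A m) * (\<Prod>j\<in>{1..M} - {m}. prob (A j))"
        by (subst split(2), subst prod.insert) (auto simp: A'_def)
      \<comment> \<open>The merged event is split again by independence within the single process
        \<open>W m\<close>.\<close>
      also have "prob (A 0 \<inter> A m) = prob (A 0) * prob (A m)"
        using indep_setD[OF wiener_increment_indep_past[OF wiener[OF m] st] Ai[of m] A0[unfolded \<D>_def]] m
        by (simp add: Int_commute)
      also have "prob (A 0) * prob (A m) * (\<Prod>j\<in>{1..M} - {m}. prob (A j))
          = prob (A 0) * (\<Prod>j\<in>{1..M}. prob (A j))"
        by (subst (2) split(2), subst prod.insert) auto
      also have "\<dots> = (\<Prod>j\<in>{0..M}. prob (A j))"
        by (subst split(1), subst prod.insert) auto
      finally show "prob (\<Inter>j\<in>{0..M}. A j) = (\<Prod>j\<in>{0..M}. prob (A j))" .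
    qed
  qed auto
  \<comment> \<open>Regrouping: all pasts on one side, the increment on the other.\<close>
  define I where "I b = (if b then {1..M} else {0})" for b
  have UI: "(\<Union>b\<in>UNIV. I b) = {0..M}" by (auto simp: I_def split: if_splits)
  have "indep_sets (\<lambda>b. sigma_sets (space P) (\<Union>i\<in>I b. G i)) UNIV"
  proof (rule indep_sets_collect_sigma)
    show "indep_sets G (\<Union>b\<in>UNIV. I b)" unfolding UI by (rule Gfin)
    show "disjoint_family_on I UNIV" by (auto simp: I_def disjoint_family_on_def)
    fix i b assume "i \<in> I b"
    have "Int_stable \<D>" unfolding \<D>_def by (rule Int_stable_vimage)
    moreover have "Int_stable (sigma_sets (space P) (past_events (W i) s))"
    proof -
      have "past_events (W i) s \<subseteq> Pow (space P)" by (auto simp: past_events_def)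
      then interpret sigma_algebra "space P" "sigma_sets (space P) (past_events (W i) s)"
        by (rule sigma_algebra_sigma_sets)
      show ?thesis by (rule Int_stableI) auto
    qed
    ultimately show "Int_stable (G i)" by (simp add: G_def)
  qed
  then show ?thesis
    unfolding indep_set_def \<D>_def[symmetric]
  proof (rule indep_sets_mono_sets)
    fix b :: bool
    have "sigma_sets (space P) (\<Union>m\<in>{1..M}. past_events (W m) s) \<subseteq> sigma_sets (space P) (\<Union>i\<in>{1..M}. G i)"
      by (rule sigma_sets_mono') (force simp: G_def)
    then show "(case b of True \<Rightarrow> sets (history s) | False \<Rightarrow> \<D>) \<subseteq> sigma_sets (space P) (\<Union>i\<in>I b. G i)"
      by (cases b) (simp add: sets_history I_def, auto simp: I_def G_def)
  qed
qed

subsection \<open>Adapted random variables\<close>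

text \<open>Equality almost everywhere is built in because the integrals are limits in probability,
  hence measurable for \<open>history s\<close> only after a change on a null set.\<close>

definition adapted :: "real \<Rightarrow> ('w \<Rightarrow> real) \<Rightarrow> bool" where
  "adapted s X \<longleftrightarrow> (\<exists>X'\<in>borel_measurable (history s). AE w in P. X w = X' w)"

lemma adapted_const: "adapted s (\<lambda>_. c)"
  unfolding adapted_def by (rule bexI[of _ "\<lambda>_. c"]) auto

lemma adapted_add:
  assumes "adapted s X" "adapted s Y" shows "adapted s (\<lambda>w. X w + Y w)"
proof -
  from assms obtain X' Y' where [measurable]: "X' \<in> borel_measurable (history s)" "Y' \<in> borel_measurable (history s)"
    and *: "AE w in P. X w = X' w" "AE w in P. Y w = Y' w" by (auto simp: adapted_def)
  have "AE w in P. X w + Y w = X' w + Y' w" using * by eventually_elim simp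
  then show ?thesis unfolding adapted_def by (intro bexI[of _ "\<lambda>w. X' w + Y' w"]) auto
qed

lemma adapted_mult:
  assumes "adapted s X" "adapted s Y" shows "adapted s (\<lambda>w. X w * Y w)"
proof -
  from assms obtain X' Y' where [measurable]: "X' \<in> borel_measurable (history s)" "Y' \<in> borel_measurable (history s)"
    and *: "AE w in P. X w = X' w" "AE w in P. Y w = Y' w" by (auto simp: adapted_def)
  have "AE w in P. X w * Y w = X' w * Y' w" using * by eventually_elim simp
  then show ?thesis unfolding adapted_def by (intro bexI[of _ "\<lambda>w. X' w * Y' w"]) auto
qed

lemma adapted_diff:
  assumes "adapted s X" "adapted s Y" shows "adapted s (\<lambda>w. X w - Y w)"
  using adapted_add[OF assms(1) adapted_mult[OF adapted_const[of s "-1"] assms(2)]] by simp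

lemma adapted_power: "adapted s X \<Longrightarrow> adapted s (\<lambda>w. X w ^ n)"
  by (induction n) (auto intro: adapted_const adapted_mult)

lemma adapted_sum: "(\<And>i. i \<in> I \<Longrightarrow> adapted s (X i)) \<Longrightarrow> adapted s (\<lambda>w. \<Sum>i\<in>I. X i w)"
  by (induction I rule: infinite_finite_induct) (auto intro: adapted_const adapted_add)

lemma adapted_mono:
  assumes "adapted s X" "s \<le> t" shows "adapted t X"
proof -
  have "sets (history s) \<subseteq> sets (history t)"
    unfolding sets_history using assms(2) by (intro sigma_sets_mono') (force simp: past_events_def)
  then have "X' \<in> borel_measurable (history t)" if "X' \<in> borel_measurable (history s)" for X'
    using that measurable_mono[of borel borel "history s" "history t"] by auto
  then show ?thesis using assms(1) by (auto simp: adapted_def)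
qed

lemma adapted_W:
  assumes "m \<le> M" "0 \<le> s" shows "adapted s (W m s)"
proof (cases "m = 0")
  case True
  then have "W m s = (\<lambda>_. s)" using W_0 by auto
  then show ?thesis by (simp add: adapted_const)
next
  case False
  have "W m s \<in> borel_measurable (history s)"
  proof (rule measurableI)
    fix B :: "real set" assume "B \<in> sets borel"
    then show "W m s -` B \<inter> space (history s) \<in> sets (history s)"
      unfolding sets_history using False assms
      by (intro sigma_sets.Basic UN_I[of m]) (auto simp: past_events_def)
  qed simp
  then show ?thesis unfolding adapted_def by blast
qed

lemma adapted_AE_limit:
  assumes "\<And>n. adapted s (X n)" and lim: "AE w in P. (\<lambda>n. X n w) \<longlonglongrightarrow> Y w"
  shows "adapted s Y"
proof -
  from assms(1) obtain X' where X': "\<And>n. X' n \<in> borel_measurable (history s)"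
    "\<And>n. AE w in P. X n w = X' n w" unfolding adapted_def Bex_def by metis
  have "AE w in P. \<forall>n. X n w = X' n w" using X'(2) by (simp add: AE_all_countable)
  then have "AE w in P. Y w = lim (\<lambda>n. X' n w)"
    using lim by eventually_elim (simp add: limI)
  moreover have "(\<lambda>w. lim (\<lambda>n. X' n w)) \<in> borel_measurable (history s)"
    using X'(1) by (rule borel_measurable_lim_metric)
  ultimately show ?thesis unfolding adapted_def by (rule bexI)
qed

text \<open>The version of \<open>X\<close> measurable for \<open>history s\<close> is independent
  of the increment, and passing to it changes no integral.\<close>

lemma adapted_increment_expectation:
  assumes m: "1 \<le> m" "m \<le> M" and st: "0 \<le> s" "s \<le> t"
    and X: "adapted s X" "integrable P X"
    and g: "g \<in> borel_measurable borel" "integrable P (\<lambda>w. g (W m t w - W m s w))"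
  shows "integrable P (\<lambda>w. X w * g (W m t w - W m s w))"
    and "(\<integral>w. X w * g (W m t w - W m s w) \<partial>P) =
      (\<integral>w. X w \<partial>P) * (\<integral>w. g (W m t w - W m s w) \<partial>P)"
proof -
  let ?\<Delta> = "\<lambda>w. W m t w - W m s w"
  have \<Delta>m: "?\<Delta> \<in> borel_measurable P" using W_measurable[OF m(2)] st by (intro borel_measurable_diff) auto
  from X(1)[unfolded adapted_def] obtain X' where
    X': "X' \<in> borel_measurable (history s)" and eq: "AE w in P. X w = X' w" by (elim bexE)
  note ind = increment_indep_history[OF m st, unfolded indep_sets2_eq]
  have sub: "sets (history s) \<subseteq> events"
    by (rule conjunct1[OF ind])
  then have X'm: "X' \<in> borel_measurable P"
    using X' measurable_mono[of borel borel "history s" P] by auto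
  have Xm: "X \<in> borel_measurable P" using X(2) by auto
  have X'sub: "{X' -` A \<inter> space P |A. A \<in> sets borel} \<subseteq> sets (history s)"
    using measurable_sets[OF X'] by auto
  have "indep_set {X' -` A \<inter> space P |A. A \<in> sets borel} {?\<Delta> -` C \<inter> space P |C. C \<in> sets borel}"
    unfolding indep_sets2_eq using ind X'sub by (meson subset_iff subset_trans)
  from indep_set_sigma_sets[OF this Int_stable_vimage Int_stable_vimage]
  have iv0: "indep_var borel X' borel ?\<Delta>" using X'm \<Delta>m by (simp add: indep_var_eq)
  have iv: "indep_var borel X' borel (\<lambda>w. g (?\<Delta> w))"
    using indep_var_compose[OF iv0 measurable_ident g(1)] by (simp add: comp_def)
  have X'i: "integrable P X'" using X(2) integrable_cong_AE[OF Xm X'm eq] by simp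
  have eq2: "AE w in P. X w * g (?\<Delta> w) = X' w * g (?\<Delta> w)" using eq by eventually_elim simp
  have gm: "(\<lambda>w. g (?\<Delta> w)) \<in> borel_measurable P" using g(2) by auto
  show "integrable P (\<lambda>w. X w * g (?\<Delta> w))"
    using indep_var_integrable[OF iv X'i g(2)] integrable_cong_AE[OF _ _ eq2] Xm X'm gm by auto
  have "(\<integral>w. X w * g (?\<Delta> w) \<partial>P) = (\<integral>w. X' w * g (?\<Delta> w) \<partial>P)"
    by (rule integral_cong_AE[OF _ _ eq2]) (use Xm X'm gm in auto)
  also have "\<dots> = (\<integral>w. X' w \<partial>P) * (\<integral>w. g (?\<Delta> w) \<partial>P)"
    by (rule indep_var_lebesgue_integral[OF iv X'i g(2)])
  also have "(\<integral>w. X' w \<partial>P) = (\<integral>w. X w \<partial>P)"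
    by (rule integral_cong_AE) (use Xm X'm eq in \<open>auto elim: eventually_mono\<close>)
  finally show "(\<integral>w. X w * g (?\<Delta> w) \<partial>P) = (\<integral>w. X w \<partial>P) * (\<integral>w. g (?\<Delta> w) \<partial>P)" .
qed

section \<open>Moments of the driving increments\<close>

lemma wiener_increment_moment:
  assumes m: "1 \<le> m" "m \<le> M" and st: "0 \<le> s" "s < t"
  shows "integrable P (\<lambda>w. (W m t w - W m s w) ^ i)"
    and "odd i \<Longrightarrow> (\<integral>w. (W m t w - W m s w) ^ i \<partial>P) = 0"
    and "(\<integral>w. (W m t w - W m s w) ^ (2 * k) \<partial>P) = fact (2 * k) / (2 ^ k * fact k) * (t - s) ^ k"
proof -
  let ?\<sigma> = "sqrt (t - s)"
  \<comment> \<open>A normal density needs positive variance, hence \<open>s < t\<close>; the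
    degenerate case is treated in \<open>increment_moment_bound\<close>.\<close>
  have \<sigma>: "0 < ?\<sigma>" using st by simp
  have d: "distributed P lborel (\<lambda>w. W m t w - W m s w) (normal_density 0 ?\<sigma>)"
    using wiener[OF m] st by (auto simp: wiener_process_def)
  have I: "(\<integral>w. (W m t w - W m s w) ^ i \<partial>P) = (\<integral>x. normal_density 0 ?\<sigma> x * x ^ i \<partial>lborel)" for i
    by (rule distributed_integral[OF d, symmetric]) auto
  show "integrable P (\<lambda>w. (W m t w - W m s w) ^ i)"
    using distributed_integrable[OF d, of "\<lambda>x. x ^ i"] integrable_normal_moment[OF \<sigma>, of 0 i] by auto
  show "(\<integral>w. (W m t w - W m s w) ^ i \<partial>P) = 0" if "odd i"
  proof -
    from that obtain k where "i = 2 * k + 1" by (elim oddE)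
    then show ?thesis using integral_normal_moment_odd[OF \<sigma>, of 0 k] unfolding I by simp
  qed
  show "(\<integral>w. (W m t w - W m s w) ^ (2 * k) \<partial>P) = fact (2 * k) / (2 ^ k * fact k) * (t - s) ^ k"
    using integral_normal_moment_even[OF \<sigma>, of 0 k] st unfolding I
    by (simp add: power_divide field_simps)
qed

text \<open>
  The bound is shared by the Wiener processes and by the process $t$, for which the first moment of
  the increment does not vanish; the restriction $L \le 1$ is needed for the latter only.
\<close>

lemma increment_moment_bound:
  assumes m: "m \<le> M" and st: "0 \<le> s" "s \<le> t" and L: "t - s \<le> L" "0 < L" "L \<le> 1" and i: "0 < i"
    and X: "adapted s X" "integrable P X"
  shows "integrable P (\<lambda>w. X w * (W m t w - W m s w) ^ i)"
    and "\<bar>\<integral>w. X w * (W m t w - W m s w) ^ i \<partial>P\<bar> \<le>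
      fact i * (\<integral>w. \<bar>X w\<bar> \<partial>P) * (sqrt L ^ i * ((t - s) / L))"
proof -
  define \<delta> where "\<delta> = t - s"
  have \<delta>: "0 \<le> \<delta>" "\<delta> \<le> L" using st L by (auto simp: \<delta>_def)
  have EX: "\<bar>\<integral>w. X w \<partial>P\<bar> \<le> (\<integral>w. \<bar>X w\<bar> \<partial>P)" by (rule integral_abs_bound)
  \<comment> \<open>The bound is linear in \<open>\<delta>\<close>, so that the steps of a partition
    of an interval of length at most \<open>L\<close> have shares \<open>\<delta> / L\<close>
    summing to at most 1. All further powers are estimated through \<open>L\<close>: for
    \<open>i = 2 * k\<close>, the factor \<open>\<delta> ^ k\<close> is at most
    \<open>L ^ k * (\<delta> / L)\<close>.\<close>
  have key: "\<bar>(\<integral>w. X w \<partial>P) * c\<bar> \<le> fact i * (\<integral>w. \<bar>X w\<bar> \<partial>P) * (sqrt L ^ i * (\<delta> / L))"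
    if "\<bar>c\<bar> \<le> fact i * (sqrt L ^ i * (\<delta> / L))" for c
    using mult_mono[OF EX that] by (simp add: abs_mult mult_ac)
  have "integrable P (\<lambda>w. X w * (W m t w - W m s w) ^ i) \<and>
    \<bar>\<integral>w. X w * (W m t w - W m s w) ^ i \<partial>P\<bar> \<le> fact i * (\<integral>w. \<bar>X w\<bar> \<partial>P) * (sqrt L ^ i * (\<delta> / L))"
  \<comment> \<open>In both cases the increment is deterministic: \<open>\<delta>\<close> for the
    process t, and 0 for an empty interval.\<close>
  proof (cases "m = 0 \<or> s = t")
    case True
    define d where "d = (if m = 0 then \<delta> else 0)"
    have \<Delta>: "W m t w - W m s w = d" for w using True by (auto simp: W_0 \<delta>_def d_def)
    have "sqrt L \<le> 1" "0 < sqrt L" using L by auto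
    have "d ^ i \<le> sqrt L ^ i * (\<delta> / L)"
    proof -
      obtain j where j: "i = Suc j" using i by (cases i) auto
      have "d \<le> \<delta>" "0 \<le> d" using \<delta> by (auto simp: d_def)
      then have "d ^ i \<le> \<delta> ^ Suc j" unfolding j by (intro power_mono)
      also have "\<dots> = L ^ i * (\<delta> / L) ^ j * (\<delta> / L)"
        using L by (simp add: j power_divide)
      also have "\<dots> \<le> L ^ i * 1 * (\<delta> / L)"
        using \<delta> L by (intro mult_right_mono mult_left_mono power_le_one) auto
      also have "\<dots> \<le> sqrt L ^ i * (\<delta> / L)"
      proof -
        have "L \<le> sqrt L"
          by (rule real_le_rsqrt) (use L in \<open>simp add: power2_eq_square mult_left_le\<close>)
        then have "L ^ i \<le> sqrt L ^ i" using L by (intro power_mono) auto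
        then show ?thesis using \<delta> L by (simp add: mult_right_mono divide_right_mono)
      qed
      finally show ?thesis .
    qed
    also have "\<dots> \<le> fact i * (sqrt L ^ i * (\<delta> / L))"
      using \<delta> L mult_right_mono[of 1 "fact i" "sqrt L ^ i * (\<delta> / L)"] by simp
    finally have "\<bar>d ^ i\<bar> \<le> fact i * (sqrt L ^ i * (\<delta> / L))"
      using \<delta> by (simp add: d_def)
    from key[OF this] show ?thesis unfolding \<Delta> using X(2) by simp
  next
    case False
    then have m1: "1 \<le> m" and st': "s < t" using st by auto
    note mom = wiener_increment_moment[OF m1 m st(1) st']
    have "\<bar>\<integral>w. (W m t w - W m s w) ^ i \<partial>P\<bar> \<le> fact i * (sqrt L ^ i * (\<delta> / L))"
    proof (cases "odd i")
      case True
      then show ?thesis using mom(2)[OF True] \<delta> L by simp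
    next
      case False
      then obtain k where k: "i = 2 * k" by (auto elim: evenE)
      obtain j where j: "k = Suc j" using k i by (cases k) auto
      have "fact (2 * k) / (2 ^ k * fact k) \<le> (fact (2 * k) :: real)"
      proof -
        have "(1 :: real) \<le> 2 ^ k * fact k" using mult_mono[of 1 "2 ^ k :: real" 1 "fact k"] by simp
        then show ?thesis by (simp add: divide_le_eq mult_le_cancel_left1)
      qed
      moreover have "\<delta> ^ k \<le> L ^ k * (\<delta> / L)"
      proof -
        have "\<delta> ^ k = L ^ k * (\<delta> / L) ^ j * (\<delta> / L)" using L by (simp add: j power_divide)
        also have "\<dots> \<le> L ^ k * 1 * (\<delta> / L)"
          using \<delta> L by (intro mult_right_mono mult_left_mono power_le_one) auto
        finally show ?thesis by simp
      qed
      ultimately have "fact (2 * k) / (2 ^ k * fact k) * \<delta> ^ k \<le> fact (2 * k) * (L ^ k * (\<delta> / L))"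
        using \<delta> L by (intro mult_mono) auto
      moreover have "sqrt L ^ i = L ^ k" using L by (simp add: k power_mult)
      ultimately show ?thesis using mom(3)[of k] \<delta> unfolding k by (simp add: \<delta>_def)
    qed
    from key[OF this] show ?thesis
      using adapted_increment_expectation[OF m1 m st X, of "\<lambda>x. x ^ i"] mom(1)[of i] by simp
  qed
  then show "integrable P (\<lambda>w. X w * (W m t w - W m s w) ^ i)"
    and "\<bar>\<integral>w. X w * (W m t w - W m s w) ^ i \<partial>P\<bar> \<le>
      fact i * (\<integral>w. \<bar>X w\<bar> \<partial>P) * (sqrt L ^ i * ((t - s) / L))"
    by (simp_all add: \<delta>_def)
qed

end

subsection \<open>Uniform moment bounds\<close>

text \<open>A crude form of Young's inequality: both factors are replaced by the larger of the
  two.\<close>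

lemma abs_power_mult_le_sum:
  fixes x y :: real
  assumes "i \<le> n"
  shows "\<bar>x\<bar> ^ i * \<bar>y\<bar> ^ (n - i) \<le> \<bar>x\<bar> ^ n + \<bar>y\<bar> ^ n"
proof -
  let ?z = "max \<bar>x\<bar> \<bar>y\<bar>"
  have "\<bar>x\<bar> ^ i * \<bar>y\<bar> ^ (n - i) \<le> ?z ^ i * ?z ^ (n - i)"
    by (intro mult_mono power_mono) auto
  also have "\<dots> = ?z ^ n" using assms by (simp flip: power_add)
  also have "\<dots> \<le> \<bar>x\<bar> ^ n + \<bar>y\<bar> ^ n" by (simp add: max_def)
  finally show ?thesis .
qed

lemma even_power_add_le:
  fixes x y :: real
  shows "(x + y) ^ (2 * r) \<le> 4 ^ r * (x ^ (2 * r) + y ^ (2 * r))"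
proof -
  let ?z = "max \<bar>x\<bar> \<bar>y\<bar>"
  have "(x + y) ^ (2 * r) = \<bar>x + y\<bar> ^ (2 * r)" by (simp add: power_even_abs)
  also have "\<dots> \<le> (2 * ?z) ^ (2 * r)" by (intro power_mono) auto
  also have "\<dots> = 4 ^ r * ?z ^ (2 * r)" by (simp add: power_mult_distrib power_mult)
  also have "?z ^ (2 * r) \<le> \<bar>x\<bar> ^ (2 * r) + \<bar>y\<bar> ^ (2 * r)" by (simp add: max_def)
  also have "\<dots> = x ^ (2 * r) + y ^ (2 * r)" by (simp add: power_even_abs)
  finally show ?thesis by simp
qed

text \<open>Jensen's inequality for the average of the \<open>x k\<close>; the leading factor undoes
  the averaging.\<close>

lemma even_power_sum_le:
  fixes x :: "nat \<Rightarrow> real"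
  assumes "n > 0"
  shows "(\<Sum>k<n. x k) ^ (2 * r) \<le> real n ^ (2 * r) * (\<Sum>k<n. x k ^ (2 * r) / n)"
proof -
  have "(\<Sum>k<n. (1 / n) *\<^sub>R x k) ^ (2 * r) \<le> (\<Sum>k<n. (1 / n) * x k ^ (2 * r))"
    by (rule convex_on_sum[OF _ _ convex_power_even[of "2 * r"]]) (use assms in auto)
  then have "real n ^ (2 * r) * (\<Sum>k<n. x k / n) ^ (2 * r) \<le> real n ^ (2 * r) * (\<Sum>k<n. x k ^ (2 * r) / n)"
    by (intro mult_left_mono) auto
  moreover have "real n ^ (2 * r) * (\<Sum>k<n. x k / n) ^ (2 * r) = (\<Sum>k<n. x k) ^ (2 * r)"
    using assms by (simp add: power_mult_distrib[symmetric] sum_divide_distrib[symmetric])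
  ultimately show ?thesis by simp
qed

context prob_space
begin

lemma expectation_Cauchy_Schwarz:
  fixes X Y :: "'a \<Rightarrow> real"
  assumes m: "X \<in> borel_measurable M" "Y \<in> borel_measurable M"
    and i: "integrable M (\<lambda>w. (X w)\<^sup>2)" "integrable M (\<lambda>w. (Y w)\<^sup>2)"
  shows "integrable M (\<lambda>w. X w * Y w)"
    and "(expectation (\<lambda>w. \<bar>X w * Y w\<bar>))\<^sup>2 \<le> expectation (\<lambda>w. (X w)\<^sup>2) * expectation (\<lambda>w. (Y w)\<^sup>2)"
proof -
  show int: "integrable M (\<lambda>w. X w * Y w)"
  proof (rule Bochner_Integration.integrable_bound)
    show "integrable M (\<lambda>w. (X w)\<^sup>2 + (Y w)\<^sup>2)" using i by simp
    show "AE w in M. norm (X w * Y w) \<le> norm ((X w)\<^sup>2 + (Y w)\<^sup>2)"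
    proof (rule AE_I2)
      fix w
      show "norm (X w * Y w) \<le> norm ((X w)\<^sup>2 + (Y w)\<^sup>2)"
        using abs_power_mult_le_sum[of 1 2 "X w" "Y w"] by (simp add: abs_mult)
    qed
  qed (use m in simp)
  let ?a = "expectation (\<lambda>w. (X w)\<^sup>2)" and ?b = "expectation (\<lambda>w. (Y w)\<^sup>2)"
    and ?c = "expectation (\<lambda>w. \<bar>X w * Y w\<bar>)"
  \<comment> \<open>The weights \<open>u\<close> and \<open>v\<close> stay free so that one
    quadratic inequality serves both the main case and the degenerate case
    \<open>?a = 0\<close>.\<close>
  have q: "2 * u * v * ?c \<le> u\<^sup>2 * ?a + v\<^sup>2 * ?b" for u v :: real
  proof -
    have "2 * u * v * ?c = expectation (\<lambda>w. 2 * u * v * \<bar>X w * Y w\<bar>)" by simp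
    also have "\<dots> \<le> expectation (\<lambda>w. u\<^sup>2 * (X w)\<^sup>2 + v\<^sup>2 * (Y w)\<^sup>2)"
    proof (rule integral_mono)
      fix w
      have "0 \<le> (u * \<bar>X w\<bar> - v * \<bar>Y w\<bar>)\<^sup>2" by simp
      then show "2 * u * v * \<bar>X w * Y w\<bar> \<le> u\<^sup>2 * (X w)\<^sup>2 + v\<^sup>2 * (Y w)\<^sup>2"
        by (simp add: power2_diff power_mult_distrib abs_mult algebra_simps)
    qed (use int i in auto)
    also have "\<dots> = u\<^sup>2 * ?a + v\<^sup>2 * ?b" using i by simp
    finally show ?thesis .
  qed
  have pos: "0 \<le> ?a" "0 \<le> ?b" "0 \<le> ?c" by auto
  show "?c\<^sup>2 \<le> ?a * ?b"
  proof (cases "?a = 0")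
    case False
    have "?a * ?c\<^sup>2 \<le> ?a * (?a * ?b)"
    proof -
      have "2 * ?c * ?a * ?c = 2 * (?a * ?c\<^sup>2)" "?c\<^sup>2 * ?a = ?a * ?c\<^sup>2" "?a\<^sup>2 * ?b = ?a * (?a * ?b)"
        by (simp_all add: power2_eq_square)
      then show ?thesis using q[of ?c ?a] by linarith
    qed
    moreover have "0 < ?a" using False pos(1) by linarith
    ultimately show ?thesis by (simp only: mult_le_cancel_left_pos)
  next
    case a: True
    show ?thesis
    proof (cases "?c = 0")
      case False
      \<comment> \<open>With \<open>?a = 0\<close> and \<open>?c\<close> positive, this weight would
        give 2 (b + 1) \<le> b with b \<ge> 0, a contradiction.\<close>
      have "2 * ((?b + 1) / ?c) * 1 * ?c \<le> ((?b + 1) / ?c)\<^sup>2 * ?a + 1\<^sup>2 * ?b" by (rule q)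
      then show ?thesis using a False pos by simp
    qed (use pos in simp)
  qed
qed

definition moment_le :: "nat \<Rightarrow> ('a \<Rightarrow> real) \<Rightarrow> real \<Rightarrow> bool" where
  "moment_le k X C \<longleftrightarrow> X \<in> borel_measurable M \<and> integrable M (\<lambda>w. X w ^ (2 * k)) \<and>
    expectation (\<lambda>w. X w ^ (2 * k)) \<le> C"

lemma moment_leD:
  assumes "moment_le k X C"
  shows "X \<in> borel_measurable M" "integrable M (\<lambda>w. X w ^ (2 * k))"
    "expectation (\<lambda>w. X w ^ (2 * k)) \<le> C" "0 \<le> C"
proof -
  show "X \<in> borel_measurable M" "integrable M (\<lambda>w. X w ^ (2 * k))" and E: "expectation (\<lambda>w. X w ^ (2 * k)) \<le> C"
    using assms by (simp_all add: moment_le_def)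
  show "0 \<le> C"
    by (rule order_trans[OF Bochner_Integration.integral_nonneg E]) (simp add: zero_le_even_power)
qed

lemma moment_le_mono: "moment_le k X C \<Longrightarrow> C \<le> D \<Longrightarrow> moment_le k X D"
  unfolding moment_le_def by linarith

lemma moment_le_cmult:
  "moment_le k X C \<Longrightarrow> moment_le k (\<lambda>w. a * X w) (a ^ (2 * k) * C)"
  unfolding moment_le_def
  by (intro conjI borel_measurable_times borel_measurable_const)
    (simp_all add: power_mult_distrib mult_left_mono zero_le_even_power)

lemma moment_le_add:
  assumes X: "moment_le k X C" and Y: "moment_le k Y D"
  shows "moment_le k (\<lambda>w. X w + Y w) (4 ^ k * (C + D))"
proof -
  have int: "integrable M (\<lambda>w. 4 ^ k * (X w ^ (2 * k) + Y w ^ (2 * k)))"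
    using moment_leD(2)[OF X] moment_leD(2)[OF Y] by simp
  have m: "(\<lambda>w. X w + Y w) \<in> borel_measurable M"
    using moment_leD(1)[OF X] moment_leD(1)[OF Y] by simp
  have i: "integrable M (\<lambda>w. (X w + Y w) ^ (2 * k))"
    by (rule Bochner_Integration.integrable_bound[OF int])
      (use m in \<open>auto intro!: AE_I2 order_trans[OF even_power_add_le]\<close>)
  have "expectation (\<lambda>w. (X w + Y w) ^ (2 * k)) \<le> expectation (\<lambda>w. 4 ^ k * (X w ^ (2 * k) + Y w ^ (2 * k)))"
    by (rule integral_mono[OF i int even_power_add_le])
  also have "\<dots> = 4 ^ k * (expectation (\<lambda>w. X w ^ (2 * k)) + expectation (\<lambda>w. Y w ^ (2 * k)))"
    using moment_leD(2)[OF X] moment_leD(2)[OF Y] by simp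
  also have "\<dots> \<le> 4 ^ k * (C + D)"
    using moment_leD(3)[OF X] moment_leD(3)[OF Y] by (intro mult_left_mono add_mono) auto
  finally show ?thesis using m i by (simp add: moment_le_def)
qed

lemma moment_le_diff:
  "moment_le k X C \<Longrightarrow> moment_le k Y D \<Longrightarrow> moment_le k (\<lambda>w. X w - Y w) (4 ^ k * (C + D))"
  using moment_le_add[OF _ moment_le_cmult[of k Y D "-1"]] by simp

lemma moment_le_mult:
  assumes X: "moment_le (2 * k) X C" and Y: "moment_le (2 * k) Y D"
  shows "moment_le k (\<lambda>w. X w * Y w) (sqrt (C * D))"
proof -
  note [measurable] = moment_leD(1)[OF X] moment_leD(1)[OF Y]
  have sq: "(x ^ (2 * k))\<^sup>2 = x ^ (2 * (2 * k))" for x :: real by (simp add: mult.commute flip: power_mult)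
  have i: "integrable M (\<lambda>w. (X w ^ (2 * k))\<^sup>2)" "integrable M (\<lambda>w. (Y w ^ (2 * k))\<^sup>2)"
    unfolding sq by (rule moment_leD(2)[OF X], rule moment_leD(2)[OF Y])
  note CS = expectation_Cauchy_Schwarz[OF _ _ i]
  have "(expectation (\<lambda>w. (X w * Y w) ^ (2 * k)))\<^sup>2
      \<le> expectation (\<lambda>w. (X w ^ (2 * k))\<^sup>2) * expectation (\<lambda>w. (Y w ^ (2 * k))\<^sup>2)"
    using CS(2) by (simp add: power_mult_distrib)
  also have "\<dots> \<le> C * D"
    unfolding sq using moment_leD[OF X] moment_leD[OF Y]
    by (intro mult_mono Bochner_Integration.integral_nonneg) (auto simp: zero_le_even_power)
  finally show ?thesis
    using CS(1) unfolding moment_le_def by (simp add: power_mult_distrib real_le_rsqrt)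
qed

lemma moment_le_cong_AE:
  assumes X: "moment_le k X C" and eq: "AE w in M. X w = Y w" and Y: "Y \<in> borel_measurable M"
  shows "moment_le k Y C"
proof -
  have m: "(\<lambda>w. X w ^ (2 * k)) \<in> borel_measurable M" "(\<lambda>w. Y w ^ (2 * k)) \<in> borel_measurable M"
    using moment_leD(1)[OF X] Y by simp_all
  have e: "AE w in M. X w ^ (2 * k) = Y w ^ (2 * k)" using eq by eventually_elim simp
  show ?thesis
    using moment_leD[OF X] Y integrable_cong_AE[OF m e] integral_cong_AE[OF m e] by (simp add: moment_le_def)
qed

text \<open>
  A bound on all even moments of \<open>X\<close> in which \<open>a\<close> plays the role of the squared size of \<open>X\<close>:
  sizes multiply under products, and \<open>n\<close> summands of size \<open>a\<close> have size \<open>n\<^sup>2 a\<close>.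
\<close>

definition mbound :: "(nat \<Rightarrow> real) \<Rightarrow> ('a \<Rightarrow> real) \<Rightarrow> real \<Rightarrow> bool" where
  "mbound c X a \<longleftrightarrow> (\<forall>r. 0 \<le> c r) \<and> (\<forall>r>0. moment_le r X (c r * a ^ r))"

lemma mboundI:
  assumes "X \<in> borel_measurable M" "\<And>r. 0 \<le> c r"
    "\<And>r. r > 0 \<Longrightarrow> integrable M (\<lambda>w. X w ^ (2 * r))"
    "\<And>r. r > 0 \<Longrightarrow> expectation (\<lambda>w. X w ^ (2 * r)) \<le> c r * a ^ r"
  shows "mbound c X a"
  using assms by (simp add: mbound_def moment_le_def)

lemma mboundD:
  assumes "mbound c X a"
  shows "X \<in> borel_measurable M" "\<And>r. 0 \<le> c r"
    "\<And>r. r > 0 \<Longrightarrow> integrable M (\<lambda>w. X w ^ (2 * r))"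
    "\<And>r. r > 0 \<Longrightarrow> expectation (\<lambda>w. X w ^ (2 * r)) \<le> c r * a ^ r"
    "\<And>r. r > 0 \<Longrightarrow> moment_le r X (c r * a ^ r)"
  using assms unfolding mbound_def moment_le_def by blast+

lemma mbound_mono:
  assumes X: "mbound c X a" and ab: "0 \<le> a" "a \<le> b"
  shows "mbound c X b"
  unfolding mbound_def
proof (intro conjI allI impI mboundD(2)[OF X])
  fix r :: nat assume "r > 0"
  moreover have "c r * a ^ r \<le> c r * b ^ r"
    using mboundD(2)[OF X] ab by (intro mult_left_mono power_mono) auto
  ultimately show "moment_le r X (c r * b ^ r)" by (intro moment_le_mono[OF mboundD(5)[OF X]])
qed

lemma mbound_const: "mbound (\<lambda>r. k ^ (2 * r)) (\<lambda>_. k) 1"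
  by (rule mboundI) (auto simp: prob_space)

lemma mbound_cmult:
  assumes X: "mbound c X a" shows "mbound c (\<lambda>w. k * X w) (k\<^sup>2 * a)"
  unfolding mbound_def
proof (intro conjI allI impI mboundD(2)[OF X])
  fix r :: nat assume "r > 0"
  from moment_le_cmult[OF mboundD(5)[OF X this], of k]
  show "moment_le r (\<lambda>w. k * X w) (c r * (k\<^sup>2 * a) ^ r)"
    unfolding power_mult[of k 2 r] by (simp only: power_mult_distrib mult_ac)
qed

lemma mbound_add:
  assumes X: "mbound c X a" and Y: "mbound d Y a"
  shows "mbound (\<lambda>r. 4 ^ r * (c r + d r)) (\<lambda>w. X w + Y w) a"
  unfolding mbound_def
  using mboundD(2)[OF X] mboundD(2)[OF Y] moment_le_add[OF mboundD(5)[OF X] mboundD(5)[OF Y]]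
  by (simp add: algebra_simps)

lemma mbound_diff:
  assumes X: "mbound c X a" and Y: "mbound d Y a"
  shows "mbound (\<lambda>r. 4 ^ r * (c r + d r)) (\<lambda>w. X w - Y w) a"
  using mbound_add[OF X mbound_cmult[OF Y, of "-1", simplified]] by simp

text \<open>Cauchy-Schwarz pays for a moment of order 2r of the product with moments of order 4r of
  the factors. This is why the constant is a function of the order and why all orders are bounded at
  once.\<close>

lemma mbound_mult:
  assumes X: "mbound c X a" and Y: "mbound d Y b" and ab: "0 \<le> a" "0 \<le> b"
  shows "mbound (\<lambda>r. sqrt (c (2 * r) * d (2 * r))) (\<lambda>w. X w * Y w) (a * b)"
  unfolding mbound_def
proof (intro conjI allI impI)
  show "0 \<le> sqrt (c (2 * r) * d (2 * r))" for r using mboundD(2)[OF X] mboundD(2)[OF Y] by simp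
  fix r :: nat assume "r > 0"
  then have r: "2 * r > 0" by simp
  have eq: "(c (2 * r) * a ^ (2 * r)) * (d (2 * r) * b ^ (2 * r)) = (c (2 * r) * d (2 * r)) * ((a * b) ^ r)\<^sup>2"
    by (simp add: power_mult_distrib mult_ac flip: power_mult)
  have "sqrt ((c (2 * r) * a ^ (2 * r)) * (d (2 * r) * b ^ (2 * r))) = sqrt (c (2 * r) * d (2 * r)) * (a * b) ^ r"
    unfolding eq using ab by (simp add: real_sqrt_mult)
  then show "moment_le r (\<lambda>w. X w * Y w) (sqrt (c (2 * r) * d (2 * r)) * (a * b) ^ r)"
    using moment_le_mult[OF mboundD(5)[OF X r] mboundD(5)[OF Y r]] by (simp only:)
qed

text \<open>The triangle inequality in L^(2r), obtained from Jensen's inequality; no independence or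
  cancellation enters.\<close>

lemma mbound_sum:
  assumes X: "\<And>k. k < n \<Longrightarrow> mbound c (X k) a" and c: "\<And>r. 0 \<le> c r"
  shows "mbound c (\<lambda>w. \<Sum>k<n. X k w) ((real n)\<^sup>2 * a)"
proof (cases "n = 0")
  case True
  then show ?thesis using c by (intro mboundI) (auto simp: zero_power)
next
  case False
  show ?thesis
  proof (rule mboundI)
    have [measurable]: "X k \<in> borel_measurable M" if "k < n" for k using mboundD(1)[OF X[OF that]] .
    show m: "(\<lambda>w. \<Sum>k<n. X k w) \<in> borel_measurable M" by (rule borel_measurable_sum) auto
    fix r :: nat assume r: "r > 0"
    have int: "integrable M (\<lambda>w. real n ^ (2 * r) * (\<Sum>k<n. X k w ^ (2 * r) / n))"
      using mboundD(3)[OF X r] by auto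
    have le: "(\<Sum>k<n. X k w) ^ (2 * r) \<le> real n ^ (2 * r) * (\<Sum>k<n. X k w ^ (2 * r) / n)" for w
      using False by (intro even_power_sum_le) simp
    show i: "integrable M (\<lambda>w. (\<Sum>k<n. X k w) ^ (2 * r))"
      by (rule Bochner_Integration.integrable_bound[OF int])
        (use m in \<open>auto intro!: AE_I2 order_trans[OF le]\<close>)
    have "expectation (\<lambda>w. (\<Sum>k<n. X k w) ^ (2 * r))
        \<le> expectation (\<lambda>w. real n ^ (2 * r) * (\<Sum>k<n. X k w ^ (2 * r) / n))"
      by (rule integral_mono[OF i int le])
    also have "\<dots> = real n ^ (2 * r) * (\<Sum>k<n. expectation (\<lambda>w. X k w ^ (2 * r)) / n)"
      using mboundD(3)[OF X r] by (simp add: Bochner_Integration.integral_sum)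
    also have "\<dots> \<le> real n ^ (2 * r) * (\<Sum>k<n. (c r * a ^ r) / n)"
      using mboundD(4)[OF X r] by (intro mult_left_mono sum_mono divide_right_mono) auto
    also have "\<dots> = c r * ((real n)\<^sup>2 * a) ^ r"
      using False by (simp add: power_mult_distrib power_mult)
    finally show "expectation (\<lambda>w. (\<Sum>k<n. X k w) ^ (2 * r)) \<le> c r * ((real n)\<^sup>2 * a) ^ r" .
  qed (rule c)
qed

lemma mbound_cong_AE:
  assumes "mbound c X a" "AE w in M. X w = Y w" "Y \<in> borel_measurable M"
  shows "mbound c Y a"
  unfolding mbound_def
  using mboundD(2)[OF assms(1)] moment_le_cong_AE[OF mboundD(5)[OF assms(1)] assms(2,3)] by simp

subsection \<open>Convergence to zero in probability\<close>

text \<open>The mean of min(1, |Z|) metrises convergence in probability. Phrased this way, sums are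
  handled by monotonicity of the integral, and almost surely convergent subsequences come from
  convergence in L^1.\<close>

definition null_in_prob :: "(nat \<Rightarrow> 'a \<Rightarrow> real) \<Rightarrow> bool" where
  "null_in_prob Z \<longleftrightarrow> (\<forall>n. Z n \<in> borel_measurable M) \<and>
    (\<lambda>n. expectation (\<lambda>w. min 1 \<bar>Z n w\<bar>)) \<longlonglongrightarrow> 0"

lemma integrable_min_1: "X \<in> borel_measurable M \<Longrightarrow> integrable M (\<lambda>w. min 1 \<bar>X w :: real\<bar>)"
  by (rule integrable_const_bound[of _ 1]) auto

lemma null_in_prob_add:
  assumes X: "null_in_prob X" and Y: "null_in_prob Y"
  shows "null_in_prob (\<lambda>n w. X n w + Y n w)"
  unfolding null_in_prob_def
proof (intro conjI allI)
  have m: "X n \<in> borel_measurable M" "Y n \<in> borel_measurable M" for n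
    using X Y by (auto simp: null_in_prob_def)
  then show "(\<lambda>w. X n w + Y n w) \<in> borel_measurable M" for n by simp
  show "(\<lambda>n. expectation (\<lambda>w. min 1 \<bar>X n w + Y n w\<bar>)) \<longlonglongrightarrow> 0"
  proof (rule tendsto_sandwich[OF _ _ tendsto_const])
    show "(\<lambda>n. expectation (\<lambda>w. min 1 \<bar>X n w\<bar>) + expectation (\<lambda>w. min 1 \<bar>Y n w\<bar>)) \<longlonglongrightarrow> 0"
      using tendsto_add X Y unfolding null_in_prob_def by fastforce
    have "expectation (\<lambda>w. min 1 \<bar>X n w + Y n w\<bar>)
        \<le> expectation (\<lambda>w. min 1 \<bar>X n w\<bar> + min 1 \<bar>Y n w\<bar>)" for n
      using m by (intro integral_mono integrable_min_1 Bochner_Integration.integrable_add) auto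
    then show "\<forall>\<^sub>F n in sequentially. expectation (\<lambda>w. min 1 \<bar>X n w + Y n w\<bar>)
        \<le> expectation (\<lambda>w. min 1 \<bar>X n w\<bar>) + expectation (\<lambda>w. min 1 \<bar>Y n w\<bar>)"
      using m by (simp add: integrable_min_1)
  qed (auto intro!: always_eventually Bochner_Integration.integral_nonneg)
qed

lemma null_in_prob_uminus:
  "null_in_prob X \<Longrightarrow> null_in_prob (\<lambda>n w. - X n w)"
  by (simp add: null_in_prob_def)

lemma null_in_prob_diff:
  "null_in_prob X \<Longrightarrow> null_in_prob Y \<Longrightarrow> null_in_prob (\<lambda>n w. X n w - Y n w)"
  using null_in_prob_add[OF _ null_in_prob_uminus] by fastforce

text \<open>\<open>U\<close> may be unbounded. It is cut at a height K: below K it costs a factor K,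
  and above K it contributes the mean of min(1, |U/K|), which does not depend on \<open>n\<close>
  and tends to 0 as K grows, by dominated convergence.\<close>

lemma null_in_prob_mult:
  assumes X: "null_in_prob X" and U: "U \<in> borel_measurable M"
  shows "null_in_prob (\<lambda>n w. U w * X n w)"
  unfolding null_in_prob_def
proof (intro conjI allI)
  have m: "X n \<in> borel_measurable M" for n using X by (auto simp: null_in_prob_def)
  then show "(\<lambda>w. U w * X n w) \<in> borel_measurable M" for n using U by simp
  define z where "z n = expectation (\<lambda>w. min 1 \<bar>X n w\<bar>)" for n
  define u where "u k = expectation (\<lambda>w. min 1 \<bar>U w / real (Suc k)\<bar>)" for k
  have z: "z \<longlonglongrightarrow> 0" using X unfolding null_in_prob_def z_def by simp
  have u: "u \<longlonglongrightarrow> 0"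
  proof -
    have "(\<lambda>k. expectation (\<lambda>w. min 1 \<bar>U w / real (Suc k)\<bar>)) \<longlonglongrightarrow> expectation (\<lambda>w. 0)"
    proof (rule integral_dominated_convergence[where w = "\<lambda>_. 1"])
      show "AE w in M. (\<lambda>k. min 1 \<bar>U w / real (Suc k)\<bar>) \<longlonglongrightarrow> 0"
      proof (rule AE_I2)
        fix w
        have "(\<lambda>k. \<bar>U w / real (Suc k)\<bar>) \<longlonglongrightarrow> 0"
          using tendsto_rabs[OF LIMSEQ_Suc[OF lim_const_over_n[of "U w"]]] by simp
        then have "(\<lambda>k. min 1 \<bar>U w / real (Suc k)\<bar>) \<longlonglongrightarrow> min 1 0"
          by (intro tendsto_min tendsto_const)
        then show "(\<lambda>k. min 1 \<bar>U w / real (Suc k)\<bar>) \<longlonglongrightarrow> 0" by simp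
      qed
    qed (use U in auto)
    then show ?thesis unfolding u_def by simp
  qed
  have le: "expectation (\<lambda>w. min 1 \<bar>U w * X n w\<bar>) \<le> real (Suc k) * z n + u k" for n k
  proof -
    have pt: "min 1 \<bar>a * b\<bar> \<le> K * min 1 \<bar>b\<bar> + min 1 \<bar>a / K\<bar>" if "K \<ge> 1" for a b K :: real
    proof (cases "\<bar>b\<bar> \<le> 1 \<and> \<bar>a\<bar> \<le> K")
      case True
      then have "\<bar>a * b\<bar> \<le> K * \<bar>b\<bar>" by (simp add: abs_mult mult_right_mono)
      moreover have "min 1 \<bar>b\<bar> = \<bar>b\<bar>" using True by simp
      moreover have "0 \<le> min 1 \<bar>a / K\<bar>" by simp
      ultimately show ?thesis by (smt (verit) min.cobounded2)
    next
      case False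
      then have "1 \<le> K * min 1 \<bar>b\<bar> \<or> 1 \<le> min 1 \<bar>a / K\<bar>" using that by (auto simp: min_def)
      moreover have "0 \<le> K * min 1 \<bar>b\<bar>" "0 \<le> min 1 \<bar>a / K\<bar>" using that by auto
      ultimately show ?thesis by linarith
    qed
    have "expectation (\<lambda>w. min 1 \<bar>U w * X n w\<bar>)
        \<le> expectation (\<lambda>w. real (Suc k) * min 1 \<bar>X n w\<bar> + min 1 \<bar>U w / real (Suc k)\<bar>)"
      using m U by (intro integral_mono integrable_min_1 Bochner_Integration.integrable_add
          integrable_mult_right pt) auto
    also have "\<dots> = real (Suc k) * z n + u k"
      using integrable_min_1[OF m[of n]] integrable_min_1[of "\<lambda>w. U w / real (Suc k)"] U
      unfolding z_def u_def by (subst Bochner_Integration.integral_add) auto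
    finally show ?thesis .
  qed
  show "(\<lambda>n. expectation (\<lambda>w. min 1 \<bar>U w * X n w\<bar>)) \<longlonglongrightarrow> 0"
  proof (rule LIMSEQ_I)
    fix e :: real assume e: "0 < e"
    from LIMSEQ_D[OF u, of "e / 2"] e obtain k where k: "\<bar>u k\<bar> < e / 2" by auto
    have "(\<lambda>n. real (Suc k) * z n) \<longlonglongrightarrow> real (Suc k) * 0" by (intro tendsto_intros z)
    from LIMSEQ_D[OF this, of "e / 2"] e obtain N where N: "\<And>n. n \<ge> N \<Longrightarrow> \<bar>real (Suc k) * z n\<bar> < e / 2"
      by auto
    have "norm (expectation (\<lambda>w. min 1 \<bar>U w * X n w\<bar>) - 0) < e" if "n \<ge> N" for n
    proof -
      have "0 \<le> expectation (\<lambda>w. min 1 \<bar>U w * X n w\<bar>)" by (intro Bochner_Integration.integral_nonneg) auto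
      then show ?thesis using le[of n k] N[OF that] k unfolding real_norm_def by linarith
    qed
    then show "\<exists>N. \<forall>n\<ge>N. norm (expectation (\<lambda>w. min 1 \<bar>U w * X n w\<bar>) - 0) < e" by blast
  qed
qed

lemma null_in_prob_AE_subseq:
  assumes "null_in_prob Z"
  obtains r where "strict_mono r" "AE w in M. (\<lambda>n. Z (r n) w) \<longlonglongrightarrow> 0"
proof -
  have m: "Z n \<in> borel_measurable M" for n using assms by (auto simp: null_in_prob_def)
  have "(\<lambda>n. (\<integral>w. norm (min 1 \<bar>Z n w\<bar>) \<partial>M)) \<longlonglongrightarrow> 0" using assms by (simp add: null_in_prob_def)
  then obtain r where r: "strict_mono r" "AE w in M. (\<lambda>n. min 1 \<bar>Z (r n) w\<bar>) \<longlonglongrightarrow> 0"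
    using tendsto_L1_AE_subseq[of M "\<lambda>n w. min 1 \<bar>Z n w\<bar>"] m integrable_min_1 by blast
  have "AE w in M. (\<lambda>n. Z (r n) w) \<longlonglongrightarrow> 0"
    using r(2)
  proof eventually_elim
    case (elim w)
    \<comment> \<open>Once the truncated value is below 1, the truncation is inactive.\<close>
    have "\<forall>\<^sub>F n in sequentially. min 1 \<bar>Z (r n) w\<bar> < 1" using elim by (rule order_tendstoD) simp
    then have "\<forall>\<^sub>F n in sequentially. min 1 \<bar>Z (r n) w\<bar> = \<bar>Z (r n) w\<bar>"
      by eventually_elim (auto simp: min_def split: if_splits)
    then have "(\<lambda>n. \<bar>Z (r n) w\<bar>) \<longlonglongrightarrow> 0" using elim by (rule Lim_transform_eventually[rotated])
    then show ?case by (simp add: tendsto_rabs_zero_iff)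
  qed
  then show thesis using r(1) that by blast
qed

lemma null_in_probI:
  assumes m: "\<And>n. Z n \<in> borel_measurable M"
    and lim: "\<And>e. e > 0 \<Longrightarrow> \<exists>N. \<forall>n\<ge>N. prob {w\<in>space M. \<bar>Z n w\<bar> > e} < e"
  shows "null_in_prob Z"
  unfolding null_in_prob_def
proof (intro conjI allI m LIMSEQ_I)
  fix e :: real assume e: "0 < e"
  from lim[of "e / 2"] e obtain N where N: "\<And>n. n \<ge> N \<Longrightarrow> prob {w\<in>space M. \<bar>Z n w\<bar> > e / 2} < e / 2" by auto
  have "norm (expectation (\<lambda>w. min 1 \<bar>Z n w\<bar>) - 0) < e" if "n \<ge> N" for n
  proof -
    define A where "A = {w\<in>space M. \<bar>Z n w\<bar> > e / 2}"
    have A: "A \<in> events" unfolding A_def using m[of n] by measurable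
    have i: "integrable M (indicator A :: 'a \<Rightarrow> real)"
      by (rule integrable_const_bound[of _ 1]) (auto intro: borel_measurable_indicator A)
    have "expectation (\<lambda>w. min 1 \<bar>Z n w\<bar>) \<le> expectation (\<lambda>w. e / 2 + indicator A w)"
    proof (rule integral_mono[OF integrable_min_1[OF m]])
      show "integrable M (\<lambda>w. e / 2 + indicator A w :: real)" using i by simp
      show "min 1 \<bar>Z n w\<bar> \<le> e / 2 + indicator A w" if "w \<in> space M" for w
        using e that by (auto simp: A_def indicator_def min_def)
    qed
    also have "\<dots> = e / 2 + prob A"
      using i A by (simp add: prob_space)
    finally show ?thesis using N[OF that, folded A_def] e Bochner_Integration.integral_nonneg[of M "\<lambda>w. min 1 \<bar>Z n w\<bar>"] by simp
  qed
  then show "\<exists>N. \<forall>n\<ge>N. norm (expectation (\<lambda>w. min 1 \<bar>Z n w\<bar>) - 0) < e" by blast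
qed

text \<open>Fatou's lemma along an almost surely convergent subsequence: the bound survives although
  convergence of the moments themselves is not known.\<close>

lemma mbound_limit:
  assumes B: "\<And>n. mbound c (B n) a" and J: "J \<in> borel_measurable M"
    and lim: "null_in_prob (\<lambda>n w. B n w - J w)"
  shows "mbound c J a"
proof -
  from null_in_prob_AE_subseq[OF lim] obtain q where
    AE0: "AE w in M. (\<lambda>n. B (q n) w - J w) \<longlonglongrightarrow> 0" by blast
  note [measurable] = mboundD(1)[OF B] J
  have c: "0 \<le> c r" for r using mboundD(2)[OF B] by simp
  have *: "integrable M (\<lambda>w. J w ^ (2 * r)) \<and> expectation (\<lambda>w. J w ^ (2 * r)) \<le> c r * a ^ r"
    if r: "r > 0" for r
  proof -
    let ?K = "c r * a ^ r"
    have K: "0 \<le> ?K" 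
      by (rule order_trans[OF Bochner_Integration.integral_nonneg mboundD(4)[OF B[of 0] r]]) simp
    have "AE w in M. ennreal (J w ^ (2 * r)) \<le> liminf (\<lambda>n. ennreal (B (q n) w ^ (2 * r)))"
      using AE0
    proof eventually_elim
      case (elim w)
      have "(\<lambda>n. B (q n) w - J w + J w) \<longlonglongrightarrow> 0 + J w" by (intro tendsto_add elim tendsto_const)
      then have "(\<lambda>n. ennreal (B (q n) w ^ (2 * r))) \<longlonglongrightarrow> ennreal (J w ^ (2 * r))"
        by (intro tendsto_ennrealI tendsto_power) simp
      from lim_imp_Liminf[OF trivial_limit_sequentially this] show ?case by simp
    qed
    then have "(\<integral>\<^sup>+w. ennreal (J w ^ (2 * r)) \<partial>M) \<le> (\<integral>\<^sup>+w. liminf (\<lambda>n. ennreal (B (q n) w ^ (2 * r))) \<partial>M)"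
      by (rule nn_integral_mono_AE)
    also have "\<dots> \<le> liminf (\<lambda>n. \<integral>\<^sup>+w. ennreal (B (q n) w ^ (2 * r)) \<partial>M)"
      by (rule nn_integral_liminf) measurable
    also have "\<dots> = liminf (\<lambda>n. ennreal (expectation (\<lambda>w. B (q n) w ^ (2 * r))))"
      using mboundD(3)[OF B r] by (subst nn_integral_eq_integral) auto
    also have "\<dots> \<le> liminf (\<lambda>n::nat. ennreal ?K)"
      by (intro Liminf_mono always_eventually allI ennreal_leI mboundD(4)[OF B r])
    finally have nn: "(\<integral>\<^sup>+w. ennreal (J w ^ (2 * r)) \<partial>M) \<le> ennreal ?K"
      by (simp add: Liminf_const)
    have i: "integrable M (\<lambda>w. J w ^ (2 * r))"
      by (rule integrableI_nonneg) (use nn in \<open>auto intro: le_less_trans\<close>)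
    then show ?thesis using nn K by (simp add: nn_integral_eq_integral)
  qed
  show ?thesis by (rule mboundI) (use * c J in auto)
qed

end

context driven_space
begin

subsection \<open>Sums of adapted factors times increments\<close>

text \<open>
  Binomial expansion of the next partial sum shows that each step multiplies the moment by at most
  \<open>1 + C \<delta> / L\<close>, where \<open>\<delta>\<close> is the step size, and adds at most \<open>C \<delta> / L\<close> times the claimed bound. The
  discrete Gronwall inequality therefore gives a constant independent of \<open>n\<close> and \<open>L\<close>.
\<close>

lemma mbound_adapted_sum:
  assumes m: "m \<le> M" and t0: "0 \<le> t 0" and mono: "\<And>k. k < n \<Longrightarrow> t k \<le> t (Suc k)"
    and L: "t n - t 0 \<le> L" "0 < L" "L \<le> 1"
    and X: "\<And>k. k < n \<Longrightarrow> mbound c (X k) a" "\<And>k. k < n \<Longrightarrow> adapted (t k) (X k)"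
    and c: "\<And>r. 0 \<le> c r" and a: "0 \<le> a"
  shows "mbound (\<lambda>r. exp (\<Sum>i=1..2 * r. real (2 * r choose i) * fact i) * c r)
    (\<lambda>w. \<Sum>k<n. X k w * (W m (t (Suc k)) w - W m (t k) w)) (a * L)"
proof -
  define S where "S k w = (\<Sum>j<k. X j w * (W m (t (Suc j)) w - W m (t j) w))" for k w
  have tk: "t i \<le> t j" if "i \<le> j" "j \<le> n" for i j
    using that
  proof (induction j rule: dec_induct)
    case (step j)
    then show ?case using mono[of j] by simp
  qed simp
  have t_ge: "0 \<le> t j" if "j \<le> n" for j using tk[of 0 j] t0 that by simp
  have Wm: "W m (t j) \<in> borel_measurable P" if "j \<le> n" for j by (rule W_measurable[OF m t_ge[OF that]])
  have Sm: "S k \<in> borel_measurable P" if "k \<le> n" for k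
    unfolding S_def using that mboundD(1)[OF X(1)] Wm by (intro borel_measurable_sum) auto
  have Sad: "adapted (t k) (S k)" if "k \<le> n" for k
    unfolding S_def
  proof (rule adapted_sum)
    fix j assume "j \<in> {..<k}"
    then have j: "j < n" "Suc j \<le> k" using that by auto
    have "adapted (t k) (X j)" by (rule adapted_mono[OF X(2)[OF j(1)] tk]) (use j that in auto)
    moreover have "adapted (t k) (W m (t (Suc j)))"
      by (rule adapted_mono[OF adapted_W[OF m] tk]) (use j that t_ge in auto)
    moreover have "adapted (t k) (W m (t j))"
      by (rule adapted_mono[OF adapted_W[OF m] tk]) (use j that t_ge in auto)
    ultimately show "adapted (t k) (\<lambda>w. X j w * (W m (t (Suc j)) w - W m (t j) w))"
      by (intro adapted_mult adapted_diff)
  qed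
  show ?thesis
  proof (rule mboundI)
    show "(\<lambda>w. \<Sum>k<n. X k w * (W m (t (Suc k)) w - W m (t k) w)) \<in> borel_measurable P"
      using Sm[of n] by (simp add: S_def[abs_def])
    show "0 \<le> exp (\<Sum>i=1..2 * r. real (2 * r choose i) * fact i) * c r" for r using c by simp
    fix r :: nat assume r: "r > 0"
    define C where "C = (\<Sum>i=1..2 * r. real (2 * r choose i) * fact i)"
    have C0: "0 \<le> C" unfolding C_def by (intro sum_nonneg) auto
    define B where "B = L ^ r * (c r * a ^ r)"
    have B0: "0 \<le> B" using c[of r] a L by (simp add: B_def)
    \<comment> \<open>Subtracting \<open>B\<close> makes the claim true for the empty sum. In terms
      of the moment plus \<open>B\<close>, a step is multiplication by \<open>1 + C * x\<close>,
      which is at most \<open>exp (C * x)\<close>.\<close>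
    have ind: "integrable P (\<lambda>w. S k w ^ (2 * r)) \<and>
        expectation (\<lambda>w. S k w ^ (2 * r)) \<le> (exp (C * ((t k - t 0) / L)) - 1) * B" if "k \<le> n" for k
      using that
    proof (induction k)
      case 0
      then show ?case using r by (simp add: S_def zero_power)
    next
      case (Suc k)
      then have k: "k < n" "k \<le> n" and IH: "integrable P (\<lambda>w. S k w ^ (2 * r))"
        "expectation (\<lambda>w. S k w ^ (2 * r)) \<le> (exp (C * ((t k - t 0) / L)) - 1) * B" by auto
      define \<Delta> where "\<Delta> w = W m (t (Suc k)) w - W m (t k) w" for w
      define x where "x = (t (Suc k) - t k) / L"
      have x0: "0 \<le> x" using mono[OF k(1)] L by (simp add: x_def)
      \<comment> \<open>The coefficient of the i-th power of the new increment in the binomial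
        expansion. It is adapted at time \<open>t k\<close>, so its expectation separates from that
        of the increment.\<close>
      define F where "F i w = X k w ^ i * S k w ^ (2 * r - i)" for i w
      note [measurable] = mboundD(1)[OF X(1)[OF k(1)]] Sm[OF k(2)]
      have Xi: "integrable P (\<lambda>w. X k w ^ (2 * r))" by (rule mboundD(3)[OF X(1)[OF k(1)] r])
      have XK: "expectation (\<lambda>w. X k w ^ (2 * r)) \<le> c r * a ^ r" by (rule mboundD(4)[OF X(1)[OF k(1)] r])
      have Fi: "integrable P (F i)" if "i \<le> 2 * r" for i
      proof (rule Bochner_Integration.integrable_bound)
        show "integrable P (\<lambda>w. X k w ^ (2 * r) + S k w ^ (2 * r))" using Xi IH by simp
        show "F i \<in> borel_measurable P" unfolding F_def[abs_def] by measurable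
        show "AE w in P. norm (F i w) \<le> norm (X k w ^ (2 * r) + S k w ^ (2 * r))"
          using abs_power_mult_le_sum[OF that]
          by (intro AE_I2) (simp add: F_def abs_mult power_abs power_even_abs)
      qed
      \<comment> \<open>The factor \<open>sqrt L ^ i\<close> from the moment of the increment is
        given to \<open>X k\<close>, so that the two quantities compared are of the same
        size.\<close>
      have FE: "expectation (\<lambda>w. \<bar>F i w\<bar>) * sqrt L ^ i \<le> expectation (\<lambda>w. S k w ^ (2 * r)) + B"
        if "i \<le> 2 * r" for i
      proof -
        have "expectation (\<lambda>w. \<bar>F i w\<bar>) * sqrt L ^ i = expectation (\<lambda>w. \<bar>F i w\<bar> * sqrt L ^ i)" by simp
        also have "\<dots> \<le> expectation (\<lambda>w. L ^ r * X k w ^ (2 * r) + S k w ^ (2 * r))"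
        proof (rule integral_mono)
          fix w
          have "\<bar>F i w\<bar> * sqrt L ^ i = \<bar>sqrt L * X k w\<bar> ^ i * \<bar>S k w\<bar> ^ (2 * r - i)"
            using L by (simp add: F_def abs_mult power_abs power_mult_distrib)
          also have "\<dots> \<le> \<bar>sqrt L * X k w\<bar> ^ (2 * r) + \<bar>S k w\<bar> ^ (2 * r)"
            by (rule abs_power_mult_le_sum[OF that])
          also have "\<dots> = L ^ r * X k w ^ (2 * r) + S k w ^ (2 * r)"
          proof -
            have "sqrt L ^ (2 * r) = L ^ r" using L by (simp add: power_mult)
            then show ?thesis by (simp add: power_even_abs power_mult_distrib)
          qed
          finally show "\<bar>F i w\<bar> * sqrt L ^ i \<le> L ^ r * X k w ^ (2 * r) + S k w ^ (2 * r)" .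
        qed (use Fi[OF that] Xi IH in auto)
        also have "\<dots> = L ^ r * expectation (\<lambda>w. X k w ^ (2 * r)) + expectation (\<lambda>w. S k w ^ (2 * r))"
          using Xi IH by simp
        also have "\<dots> \<le> B + expectation (\<lambda>w. S k w ^ (2 * r))"
          unfolding B_def using XK L by (intro add_right_mono mult_left_mono) auto
        finally show ?thesis by simp
      qed
      have Fad: "adapted (t k) (F i)" for i
        unfolding F_def[abs_def] by (intro adapted_mult adapted_power X(2) k Sad)
      have le: "t k \<le> t (Suc k)" "t (Suc k) - t k \<le> L"
        using mono[OF k(1)] tk[of 0 k] tk[of "Suc k" n] k L by auto
      note inc = increment_moment_bound[OF m t_ge[OF k(2)] le L(2,3) _ Fad Fi, folded \<Delta>_def x_def]
      have term_int: "integrable P (\<lambda>w. F i w * \<Delta> w ^ i)" if "i \<le> 2 * r" for i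
        using inc(1)[of i] Fi[OF that] that by (cases "i = 0") auto
      have term_le: "expectation (\<lambda>w. F i w * \<Delta> w ^ i)
          \<le> fact i * x * (expectation (\<lambda>w. S k w ^ (2 * r)) + B)" if "0 < i" "i \<le> 2 * r" for i
      proof -
        have "expectation (\<lambda>w. F i w * \<Delta> w ^ i) \<le> fact i * expectation (\<lambda>w. \<bar>F i w\<bar>) * (sqrt L ^ i * x)"
          using inc(2)[OF that] by linarith
        also have "\<dots> = fact i * x * (expectation (\<lambda>w. \<bar>F i w\<bar>) * sqrt L ^ i)" by simp
        also have "\<dots> \<le> fact i * x * (expectation (\<lambda>w. S k w ^ (2 * r)) + B)"
          using FE[OF that(2)] x0 by (intro mult_left_mono) auto
        finally show ?thesis .
      qed
      have expand: "S (Suc k) w ^ (2 * r) = (\<Sum>i\<le>2 * r. real (2 * r choose i) * (F i w * \<Delta> w ^ i))" for w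
      proof -
        have "S (Suc k) w = X k w * \<Delta> w + S k w" by (simp add: S_def \<Delta>_def)
        then show ?thesis by (simp add: binomial_ring F_def power_mult_distrib mult_ac)
      qed
      let ?E = "expectation (\<lambda>w. S k w ^ (2 * r))"
      have int': "integrable P (\<lambda>w. S (Suc k) w ^ (2 * r))"
        unfolding expand using term_int by (intro Bochner_Integration.integrable_sum integrable_mult_right) auto
      have "expectation (\<lambda>w. S (Suc k) w ^ (2 * r))
          = (\<Sum>i\<le>2 * r. real (2 * r choose i) * expectation (\<lambda>w. F i w * \<Delta> w ^ i))"
        unfolding expand using term_int by (subst Bochner_Integration.integral_sum) auto
      also have "{..2 * r} = insert 0 {1..2 * r}" by auto
      also have "(\<Sum>i\<in>insert 0 {1..2 * r}. real (2 * r choose i) * expectation (\<lambda>w. F i w * \<Delta> w ^ i))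
          = ?E + (\<Sum>i=1..2 * r. real (2 * r choose i) * expectation (\<lambda>w. F i w * \<Delta> w ^ i))"
        by (subst sum.insert) (auto simp: F_def)
      also have "\<dots> \<le> ?E + (\<Sum>i=1..2 * r. real (2 * r choose i) * (fact i * x * (?E + B)))"
        using term_le by (intro add_left_mono sum_mono mult_left_mono) auto
      also have "\<dots> = ?E + C * x * (?E + B)"
        unfolding C_def by (simp add: sum_distrib_right mult.assoc)
      also have "\<dots> = (?E + B) * (1 + C * x) - B" by (simp add: algebra_simps)
      also have "\<dots> \<le> (exp (C * ((t k - t 0) / L)) * B) * exp (C * x) - B"
      proof -
        have "?E + B \<le> exp (C * ((t k - t 0) / L)) * B" using IH(2) by (simp add: algebra_simps)
        moreover have "1 + C * x \<le> exp (C * x)" by (rule exp_ge_add_one_self)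
        moreover have "0 \<le> ?E + B" using B0 by (intro add_nonneg_nonneg Bochner_Integration.integral_nonneg) auto
        moreover have "0 \<le> 1 + C * x" using C0 x0 by simp
        ultimately show ?thesis using B0 by (intro diff_right_mono mult_mono) auto
      qed
      also have "\<dots> = (exp (C * ((t (Suc k) - t 0) / L)) - 1) * B"
      proof -
        have "C * ((t k - t 0) / L) + C * x = C * ((t (Suc k) - t 0) / L)"
          by (simp add: x_def diff_divide_distrib algebra_simps)
        then have "exp (C * ((t k - t 0) / L)) * exp (C * x) = exp (C * ((t (Suc k) - t 0) / L))"
          by (simp flip: exp_add)
        then show ?thesis by (simp add: algebra_simps)
      qed
      finally show ?case using int' by simp
    qed
    show "integrable P (\<lambda>w. (\<Sum>k<n. X k w * (W m (t (Suc k)) w - W m (t k) w)) ^ (2 * r))"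
      using ind[of n] by (simp add: S_def)
    have "expectation (\<lambda>w. S n w ^ (2 * r)) \<le> (exp (C * ((t n - t 0) / L)) - 1) * B"
      using ind[of n] by simp
    also have "\<dots> \<le> exp C * B"
    proof -
      have "C * ((t n - t 0) / L) \<le> C * 1" using L C0 by (intro mult_left_mono) auto
      then have "exp (C * ((t n - t 0) / L)) - 1 \<le> exp C" by (smt (verit) exp_le_cancel_iff)
      then show ?thesis by (rule mult_right_mono[OF _ B0])
    qed
    finally show "expectation (\<lambda>w. (\<Sum>k<n. X k w * (W m (t (Suc k)) w - W m (t k) w)) ^ (2 * r))
        \<le> exp (\<Sum>i=1..2 * r. real (2 * r choose i) * fact i) * c r * (a * L) ^ r"
      by (simp add: S_def B_def C_def power_mult_distrib mult_ac)
  qed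
qed

lemma mbound_zero: "(\<And>r. 0 \<le> c r) \<Longrightarrow> 0 \<le> a \<Longrightarrow> mbound c (\<lambda>_. 0) a"
  by (rule mboundI) (auto simp: zero_power)

lemma mbound_increment:
  assumes m: "m \<le> M" and st: "0 \<le> s" "s \<le> t" "t \<le> 1"
  shows "mbound (\<lambda>r. fact (2 * r)) (\<lambda>w. W m t w - W m s w) (t - s)"
proof (cases "s = t")
  case True
  then show ?thesis using mbound_zero by simp
next
  case False
  \<comment> \<open>Choosing the reference length equal to the step turns the factor
    \<open>(t - s) / L\<close> into 1.\<close>
  then have L: "t - s \<le> t - s" "0 < t - s" "t - s \<le> 1" using st by auto
  have i1: "integrable P (\<lambda>_. 1 :: real)" by simp
  show ?thesis
  proof (rule mboundI)
    show "(\<lambda>w. W m t w - W m s w) \<in> borel_measurable P"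
      using W_measurable[OF m, of t] W_measurable[OF m, of s] st by simp
    fix r :: nat assume "r > 0"
    then have r: "0 < 2 * r" by simp
    note b = increment_moment_bound[OF m st(1,2) L r adapted_const i1]
    show "integrable P (\<lambda>w. (W m t w - W m s w) ^ (2 * r))" using b(1) by simp
    have "sqrt (t - s) ^ (2 * r) = (t - s) ^ r" using L by (simp add: power_mult)
    then show "expectation (\<lambda>w. (W m t w - W m s w) ^ (2 * r)) \<le> fact (2 * r) * (t - s) ^ r"
      using b(2) L by (simp add: prob_space)
  qed simp
qed

subsection \<open>Regular adapted processes\<close>

text \<open>Hoelder continuity of order 1/2 in every L^p, since the last argument of
  \<open>mbound\<close> is a squared size. The time interval [0, 1] suffices, as only small h matter
  in the end.\<close>

definition regular_with :: "(nat \<Rightarrow> real) \<Rightarrow> (nat \<Rightarrow> real) \<Rightarrow> (real \<Rightarrow> 'w \<Rightarrow> real) \<Rightarrow> bool" where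
  "regular_with c d X \<longleftrightarrow> (\<forall>t\<in>{0..1}. adapted t (X t)) \<and> (\<forall>t\<in>{0..1}. mbound c (X t) 1) \<and>
    (\<forall>s t. 0 \<le> s \<and> s \<le> t \<and> t \<le> 1 \<longrightarrow> mbound d (\<lambda>w. X t w - X s w) (t - s))"

lemma regular_withD:
  assumes "regular_with c d X"
  shows "0 \<le> t \<Longrightarrow> t \<le> 1 \<Longrightarrow> adapted t (X t)"
    and "0 \<le> t \<Longrightarrow> t \<le> 1 \<Longrightarrow> mbound c (X t) 1"
    and "0 \<le> s \<Longrightarrow> s \<le> t \<Longrightarrow> t \<le> 1 \<Longrightarrow> mbound d (\<lambda>w. X t w - X s w) (t - s)"
    and "0 \<le> t \<Longrightarrow> t \<le> 1 \<Longrightarrow> X t \<in> borel_measurable P"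
    and "0 \<le> c r" and "0 \<le> d r"
proof -
  show 1: "0 \<le> t \<Longrightarrow> t \<le> 1 \<Longrightarrow> mbound c (X t) 1" for t
    using assms by (simp add: regular_with_def)
  show 2: "0 \<le> s \<Longrightarrow> s \<le> t \<Longrightarrow> t \<le> 1 \<Longrightarrow> mbound d (\<lambda>w. X t w - X s w) (t - s)" for s t
    using assms by (simp add: regular_with_def)
  show "0 \<le> t \<Longrightarrow> t \<le> 1 \<Longrightarrow> adapted t (X t)" using assms by (simp add: regular_with_def)
  show "0 \<le> t \<Longrightarrow> t \<le> 1 \<Longrightarrow> X t \<in> borel_measurable P" by (rule mboundD(1)[OF 1])
  show "0 \<le> c r" using mboundD(2)[OF 1[of 0]] by simp
  show "0 \<le> d r" using mboundD(2)[OF 2[of 0 1]] by simp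
qed

definition regular :: "(real \<Rightarrow> 'w \<Rightarrow> real) \<Rightarrow> bool" where
  "regular X \<longleftrightarrow> (\<exists>c d. regular_with c d X)"

lemma regular_const: "regular (\<lambda>_ _. k)"
proof -
  have "regular_with (\<lambda>r. k ^ (2 * r)) (\<lambda>_. 0) (\<lambda>_ _. k)"
    unfolding regular_with_def using mbound_const[of k] mbound_zero[of "\<lambda>_. 0"] adapted_const by auto
  then show ?thesis unfolding regular_def by blast
qed

lemma regular_mult:
  assumes "regular X" "regular Y"
  shows "regular (\<lambda>t w. X t w * Y t w)"
proof -
  obtain c d where X: "regular_with c d X" using assms(1) unfolding regular_def by blast
  obtain c' d' where Y: "regular_with c' d' Y" using assms(2) unfolding regular_def by blast
  have "regular_with (\<lambda>r. sqrt (c (2 * r) * c' (2 * r)))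
    (\<lambda>r. 4 ^ r * (sqrt (c (2 * r) * d' (2 * r)) + sqrt (c' (2 * r) * d (2 * r)))) (\<lambda>t w. X t w * Y t w)"
    unfolding regular_with_def
  proof (intro conjI ballI allI impI)
    fix t :: real assume t: "t \<in> {0..1}"
    then show "adapted t (\<lambda>w. X t w * Y t w)"
      using regular_withD(1)[OF X] regular_withD(1)[OF Y] by (intro adapted_mult) auto
    have "mbound (\<lambda>r. sqrt (c (2 * r) * c' (2 * r))) (\<lambda>w. X t w * Y t w) (1 * 1)"
      by (rule mbound_mult[OF regular_withD(2)[OF X] regular_withD(2)[OF Y]]) (use t in auto)
    then show "mbound (\<lambda>r. sqrt (c (2 * r) * c' (2 * r))) (\<lambda>w. X t w * Y t w) 1" by simp
  next
    fix s t :: real assume st: "0 \<le> s \<and> s \<le> t \<and> t \<le> 1"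
    have "mbound (\<lambda>r. sqrt (c (2 * r) * d' (2 * r))) (\<lambda>w. X t w * (Y t w - Y s w)) (1 * (t - s))"
      by (rule mbound_mult[OF regular_withD(2)[OF X] regular_withD(3)[OF Y]]) (use st in auto)
    moreover have "mbound (\<lambda>r. sqrt (c' (2 * r) * d (2 * r))) (\<lambda>w. Y s w * (X t w - X s w)) (1 * (t - s))"
      by (rule mbound_mult[OF regular_withD(2)[OF Y] regular_withD(3)[OF X]]) (use st in auto)
    ultimately have "mbound (\<lambda>r. 4 ^ r * (sqrt (c (2 * r) * d' (2 * r)) + sqrt (c' (2 * r) * d (2 * r))))
        (\<lambda>w. X t w * (Y t w - Y s w) + Y s w * (X t w - X s w)) (1 * (t - s))"
      by (rule mbound_add)
    moreover have "X t w * (Y t w - Y s w) + Y s w * (X t w - X s w) = X t w * Y t w - X s w * Y s w" for w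
      by (simp add: algebra_simps)
    ultimately show "mbound (\<lambda>r. 4 ^ r * (sqrt (c (2 * r) * d' (2 * r)) + sqrt (c' (2 * r) * d (2 * r))))
        (\<lambda>w. X t w * Y t w - X s w * Y s w) (t - s)"
      by simp
  qed
  then show ?thesis unfolding regular_def by blast
qed

lemma regular_prod_mset:
  "(\<And>\<tau>. \<tau> \<in># ts \<Longrightarrow> regular (f \<tau>)) \<Longrightarrow> regular (\<lambda>t w. \<Prod>\<tau>\<in>#ts. f \<tau> t w)"
proof (induction ts)
  case empty
  then show ?case using regular_const[of 1] by simp
next
  case (add \<tau> ts)
  then show ?case using regular_mult[of "f \<tau>" "\<lambda>t w. \<Prod>\<tau>\<in>#ts. f \<tau> t w"] by simp
qed

end

subsection \<open>Uniform grids\<close>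

text \<open>With \<open>Suc n\<close> steps the mesh is meaningful for every index, including
  \<open>n = 0\<close>.\<close>

definition grid :: "real \<Rightarrow> real \<Rightarrow> nat \<Rightarrow> nat \<Rightarrow> real" where
  "grid s t n k = s + real k * ((t - s) / real (Suc n))"

lemma grid_0 [simp]: "grid s t n 0 = s"
  by (simp add: grid_def)

lemma grid_last [simp]: "grid s t n (Suc n) = t"
  by (simp add: grid_def del: of_nat_Suc)

lemma grid_step: "grid s t n (Suc k) - grid s t n k = (t - s) / real (Suc n)"
proof -
  have "real (Suc k) * d - real k * d = d" for d by (simp add: algebra_simps)
  from this[of "(t - s) / real (Suc n)"] show ?thesis unfolding grid_def by linarith
qed

lemma grid_mono: "s \<le> t \<Longrightarrow> i \<le> j \<Longrightarrow> grid s t n i \<le> grid s t n j"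
  unfolding grid_def by (intro add_left_mono mult_right_mono divide_nonneg_nonneg) auto

lemma grid_bounds:
  assumes "s \<le> t" "k \<le> Suc n"
  shows "s \<le> grid s t n k" "grid s t n k \<le> t"
  using grid_mono[OF assms(1), of 0 k n] grid_mono[OF assms, of n] by auto

lemma grid_strict: "s < t \<Longrightarrow> grid s t n k < grid s t n (Suc k)"
  using grid_step[of s t n k] by (smt (verit) divide_pos_pos of_nat_0_less_iff zero_less_Suc)

lemma is_partition_grid: "0 < h \<Longrightarrow> is_partition h (Suc n) (grid 0 h n)"
  by (simp add: is_partition_def grid_strict)

lemma is_partition_nonneg:
  assumes "is_partition h n t" "k \<le> n"
  shows "0 \<le> t k" "t k \<le> h"
proof -
  have mono: "t i \<le> t j" if "i \<le> j" "j \<le> n" for i j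
    using that
  proof (induction j rule: dec_induct)
    case (step j)
    then have "t j < t (Suc j)" using assms(1) by (simp add: is_partition_def)
    then show ?case using step by simp
  qed simp
  show "0 \<le> t k" "t k \<le> h" using mono[of 0 k] mono[of k n] assms by (auto simp: is_partition_def)
qed

text \<open>Convergence of Stratonovich sums is known only on intervals that start at 0. The sum
  over [s, t] is recovered as the sum over this partition of [0, t] minus the sum over the grid of
  [0, s].\<close>

definition two_grids :: "real \<Rightarrow> real \<Rightarrow> nat \<Rightarrow> nat \<Rightarrow> real" where
  "two_grids s t n k = (if k \<le> Suc n then grid 0 s n k else grid s t n (k - Suc n))"

lemma two_grids_step:
  "k < Suc n \<Longrightarrow> two_grids s t n (Suc k) - two_grids s t n k = s / real (Suc n)"
  "\<not> k < Suc n \<Longrightarrow> two_grids s t n (Suc k) - two_grids s t n k = (t - s) / real (Suc n)"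
proof -
  assume "k < Suc n"
  then show "two_grids s t n (Suc k) - two_grids s t n k = s / real (Suc n)"
    using grid_step[of 0 s n k] by (simp add: two_grids_def)
next
  assume "\<not> k < Suc n"
  then obtain j where j: "k = Suc n + j" by (metis le_Suc_ex not_less)
  have "two_grids s t n (Suc k) = grid s t n (Suc j)" by (simp add: two_grids_def j)
  moreover have "two_grids s t n k = grid s t n j" by (cases j) (auto simp: two_grids_def j)
  ultimately show "two_grids s t n (Suc k) - two_grids s t n k = (t - s) / real (Suc n)"
    by (simp only: grid_step)
qed

lemma is_partition_two_grids:
  assumes "0 < s" "s < t"
  shows "is_partition t (Suc n + Suc n) (two_grids s t n)"
  unfolding is_partition_def
proof (intro conjI allI impI)
  show "two_grids s t n 0 = 0" by (simp add: two_grids_def)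
  show "two_grids s t n (Suc n + Suc n) = t" by (simp add: two_grids_def)
  fix k
  have "0 < s / real (Suc n)" "0 < (t - s) / real (Suc n)" using assms by auto
  then show "two_grids s t n k < two_grids s t n (Suc k)"
    using two_grids_step[of k n s t] by (cases "k < Suc n") linarith+
qed

lemma sum_lessThan_add: "(\<Sum>k<m + n. f k) = (\<Sum>k<m. f k) + (\<Sum>k<n. f (m + k))"
  for f :: "nat \<Rightarrow> 'b :: comm_monoid_add"
  by (induction n) (auto simp: add.assoc)

lemma stratonovich_sum_two_grids:
  "stratonovich_sum X V (Suc n + Suc n) (two_grids s t n) w =
    stratonovich_sum X V (Suc n) (grid 0 s n) w + stratonovich_sum X V (Suc n) (grid s t n) w"
proof -
  let ?f = "\<lambda>p k. (X (p k) w + X (p (Suc k)) w) / 2 * (V (p (Suc k)) w - V (p k) w)"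
  have "(\<Sum>k<Suc n + Suc n. ?f (two_grids s t n) k)
      = (\<Sum>k<Suc n. ?f (two_grids s t n) k) + (\<Sum>k<Suc n. ?f (two_grids s t n) (Suc n + k))"
    by (rule sum_lessThan_add)
  also have "(\<Sum>k<Suc n. ?f (two_grids s t n) k) = (\<Sum>k<Suc n. ?f (grid 0 s n) k)"
    by (rule sum.cong) (auto simp: two_grids_def)
  also have "(\<Sum>k<Suc n. ?f (two_grids s t n) (Suc n + k)) = (\<Sum>k<Suc n. ?f (grid s t n) k)"
  proof (rule sum.cong)
    fix k
    have "two_grids s t n (Suc n + k) = grid s t n k" by (cases k) (auto simp: two_grids_def)
    moreover have "two_grids s t n (Suc (Suc n + k)) = grid s t n (Suc k)" by (simp add: two_grids_def)
    ultimately show "?f (two_grids s t n) (Suc n + k) = ?f (grid s t n) k" by simp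
  qed simp
  finally show ?thesis by (simp add: stratonovich_sum_def)
qed

context driven_space
begin

subsection \<open>Stratonovich integrals of regular processes\<close>

lemma stratonovich_sum_measurable:
  assumes "\<And>k. k \<le> n \<Longrightarrow> X (t k) \<in> borel_measurable P" "\<And>k. k \<le> n \<Longrightarrow> V (t k) \<in> borel_measurable P"
  shows "stratonovich_sum X V n t \<in> borel_measurable P"
  unfolding stratonovich_sum_def[abs_def]
  by (intro borel_measurable_sum borel_measurable_times borel_measurable_divide borel_measurable_add
      borel_measurable_diff borel_measurable_const assms) auto

lemma stratonovich_integral_modulus:
  assumes "stratonovich_integral P X V Y" "0 \<le> h" "0 < e"
  shows "\<exists>\<delta>>0. \<forall>n t. is_partition h n t \<and> (\<forall>k<n. t (Suc k) - t k < \<delta>) \<longrightarrow>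
    prob {w \<in> space P. \<bar>stratonovich_sum X V n t w - Y h w\<bar> > e} < e"
proof -
  have "\<forall>h\<ge>0. \<forall>e>0. \<exists>\<delta>>0. \<forall>n t. is_partition h n t \<and> (\<forall>k<n. t (Suc k) - t k < \<delta>) \<longrightarrow>
        measure P {w \<in> space P. \<bar>stratonovich_sum X V n t w - Y h w\<bar> > e} < e"
    using assms(1) unfolding stratonovich_integral_def by (rule conjunct2)
  from this[rule_format, OF assms(2,3)] show ?thesis .
qed

lemma stratonovich_integral_null:
  assumes Y: "stratonovich_integral P X V Y" and h: "0 \<le> h" "h \<le> 1"
    and X: "\<And>t. 0 \<le> t \<Longrightarrow> t \<le> 1 \<Longrightarrow> X t \<in> borel_measurable P"
    and V: "\<And>t. 0 \<le> t \<Longrightarrow> t \<le> 1 \<Longrightarrow> V t \<in> borel_measurable P"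
    and p: "\<And>n. is_partition h (N n) (p n)"
    and mesh: "\<And>n k. k < N n \<Longrightarrow> p n (Suc k) - p n k \<le> 1 / real (Suc n)"
  shows "null_in_prob (\<lambda>n w. stratonovich_sum X V (N n) (p n) w - Y h w)"
proof (rule null_in_probI)
  have b: "0 \<le> p n k" "p n k \<le> 1" if "k \<le> N n" for n k
    using is_partition_nonneg[OF p that] h by auto
  have "Y h \<in> borel_measurable P" using Y h by (simp add: stratonovich_integral_def continuous_process_def)
  then show "(\<lambda>w. stratonovich_sum X V (N n) (p n) w - Y h w) \<in> borel_measurable P" for n
    using b by (intro borel_measurable_diff stratonovich_sum_measurable X V)
  fix e :: real assume e: "0 < e"
  from stratonovich_integral_modulus[OF Y h(1) e] obtain \<delta> where \<delta>: "\<delta> > 0"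
    "\<forall>n t. is_partition h n t \<and> (\<forall>k<n. t (Suc k) - t k < \<delta>) \<longrightarrow>
        prob {w \<in> space P. \<bar>stratonovich_sum X V n t w - Y h w\<bar> > e} < e" by (elim exE conjE)
  from reals_Archimedean[OF \<delta>(1)] obtain N0 where N0: "inverse (real (Suc N0)) < \<delta>" by blast
  show "\<exists>N0. \<forall>n\<ge>N0. prob {w\<in>space P. \<bar>stratonovich_sum X V (N n) (p n) w - Y h w\<bar> > e} < e"
  proof (intro exI allI impI)
    fix n assume n: "N0 \<le> n"
    have "1 / real (Suc n) \<le> inverse (real (Suc N0))" using n by (simp add: field_simps)
    then have "p n (Suc k) - p n k < \<delta>" if "k < N n" for k using mesh[OF that] N0 by linarith
    then have "\<forall>k<N n. p n (Suc k) - p n k < \<delta>" by blast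
    then show "prob {w\<in>space P. \<bar>stratonovich_sum X V (N n) (p n) w - Y h w\<bar> > e} < e"
      by (intro \<delta>(2)[rule_format] conjI p)
  qed
qed

lemma null_in_prob_constD:
  assumes "null_in_prob (\<lambda>_. Z)"
  shows "AE w in P. Z w = 0"
proof -
  from null_in_prob_AE_subseq[OF assms] obtain r :: "nat \<Rightarrow> nat"
    where "AE w in P. (\<lambda>n. Z w) \<longlonglongrightarrow> 0" by blast
  then show ?thesis by eventually_elim (simp add: LIMSEQ_const_iff)
qed

lemma stratonovich_integral_0:
  assumes "stratonovich_integral P X V Y"
  shows "AE w in P. Y 0 w = 0"
proof -
  have m: "Y 0 \<in> borel_measurable P"
    using assms by (simp add: stratonovich_integral_def continuous_process_def)
  have "null_in_prob (\<lambda>n::nat. Y 0)"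
  proof (rule null_in_probI[OF m])
    fix e :: real assume e: "0 < e"
    from stratonovich_integral_modulus[OF assms order_refl e] obtain \<delta> where
      "\<forall>n t. is_partition 0 n t \<and> (\<forall>k<n. t (Suc k) - t k < \<delta>) \<longrightarrow>
        prob {w \<in> space P. \<bar>stratonovich_sum X V n t w - Y 0 w\<bar> > e} < e" by (elim exE conjE)
    \<comment> \<open>The interval [0, 0] has only the empty partition, whose sum is 0; hence
      \<open>Y 0\<close> itself must be small in probability for every \<open>e\<close>.\<close>
    from this[rule_format, of 0 "\<lambda>_. 0"]
    have "prob {w \<in> space P. \<bar>stratonovich_sum X V 0 (\<lambda>_. 0) w - Y 0 w\<bar> > e} < e"
      by (simp add: is_partition_def)
    then show "\<exists>N0::nat. \<forall>n\<ge>N0. prob {w\<in>space P. \<bar>Y 0 w\<bar> > e} < e"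
      by (simp add: stratonovich_sum_def)
  qed
  then show ?thesis by (rule null_in_prob_constD)
qed

lemma null_in_prob_cong_AE:
  assumes "null_in_prob Z" "\<And>n. Z' n \<in> borel_measurable P" "\<And>n. AE w in P. Z n w = Z' n w"
  shows "null_in_prob Z'"
proof -
  have "expectation (\<lambda>w. min 1 \<bar>Z n w\<bar>) = expectation (\<lambda>w. min 1 \<bar>Z' n w\<bar>)" for n
  proof (rule integral_cong_AE)
    have m: "Z n \<in> borel_measurable P" using assms(1) by (simp add: null_in_prob_def)
    show "(\<lambda>w. min 1 \<bar>Z n w\<bar>) \<in> borel_measurable P" "(\<lambda>w. min 1 \<bar>Z' n w\<bar>) \<in> borel_measurable P"
      using m assms(2)[of n] by simp_all
    show "AE w in P. min 1 \<bar>Z n w\<bar> = min 1 \<bar>Z' n w\<bar>" using assms(3)[of n] by eventually_elim simp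
  qed
  then show ?thesis using assms by (simp add: null_in_prob_def)
qed

lemma stratonovich_increment_null:
  assumes Y: "stratonovich_integral P X V Y" and st: "0 \<le> s" "s < t" "t \<le> 1"
    and X: "\<And>t. 0 \<le> t \<Longrightarrow> t \<le> 1 \<Longrightarrow> X t \<in> borel_measurable P"
    and V: "\<And>t. 0 \<le> t \<Longrightarrow> t \<le> 1 \<Longrightarrow> V t \<in> borel_measurable P"
  shows "null_in_prob (\<lambda>n w. stratonovich_sum X V (Suc n) (grid s t n) w - (Y t w - Y s w))"
proof -
  have Ym: "Y t \<in> borel_measurable P" if "0 \<le> t" for t
    using Y that by (simp add: stratonovich_integral_def continuous_process_def)
  have grid1: "null_in_prob (\<lambda>n w. stratonovich_sum X V (Suc n) (grid 0 h n) w - Y h w)"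
    if "0 < h" "h \<le> 1" for h
    by (rule stratonovich_integral_null[OF Y _ _ X V is_partition_grid])
      (use that grid_step[of 0 h] in \<open>auto intro: divide_right_mono\<close>)
  show ?thesis
  \<comment> \<open>For \<open>s = 0\<close> the first half of \<open>two_grids\<close> would be
    degenerate and not a partition.\<close>
  proof (cases "s = 0")
    case True
    show ?thesis
    proof (rule null_in_prob_cong_AE[OF grid1[of t]])
      fix n
      have "0 \<le> grid s t n k" "grid s t n k \<le> 1" if "k \<le> Suc n" for k
        using grid_bounds[of s t k n] st that by auto
      then show "(\<lambda>w. stratonovich_sum X V (Suc n) (grid s t n) w - (Y t w - Y s w)) \<in> borel_measurable P"
        using st by (intro borel_measurable_diff stratonovich_sum_measurable X V Ym) auto
      show "AE w in P. stratonovich_sum X V (Suc n) (grid 0 t n) w - Y t w =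
          stratonovich_sum X V (Suc n) (grid s t n) w - (Y t w - Y s w)"
        using stratonovich_integral_0[OF Y] by eventually_elim (simp add: True)
    qed (use st in auto)
  next
    case False
    have "null_in_prob (\<lambda>n w. stratonovich_sum X V (Suc n + Suc n) (two_grids s t n) w - Y t w)"
    proof (rule stratonovich_integral_null[OF Y _ _ X V is_partition_two_grids])
      fix n k
      show "two_grids s t n (Suc k) - two_grids s t n k \<le> 1 / real (Suc n)"
        using two_grids_step[of k n s t] st
        by (cases "k < Suc n") (auto intro!: divide_right_mono simp del: of_nat_Suc)
    qed (use st False in auto)
    from null_in_prob_diff[OF this grid1[of s]] st False
    have "null_in_prob (\<lambda>n w. stratonovich_sum X V (Suc n + Suc n) (two_grids s t n) w - Y t w -
        (stratonovich_sum X V (Suc n) (grid 0 s n) w - Y s w))" by auto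
    moreover have "stratonovich_sum X V (Suc n + Suc n) (two_grids s t n) w - Y t w -
        (stratonovich_sum X V (Suc n) (grid 0 s n) w - Y s w) =
        stratonovich_sum X V (Suc n) (grid s t n) w - (Y t w - Y s w)" for n w
      unfolding stratonovich_sum_two_grids by linarith
    ultimately show ?thesis by (simp only:)
  qed
qed

text \<open>The trapezoidal sum is the left-point sum plus half the sum of the products of
  increments of \<open>X\<close> and \<open>W m\<close>. Once \<open>X s\<close> times the increment
  of \<open>W m\<close> is removed, the first part is a sum with adapted factors of squared size
  \<open>L\<close>, the second is small by the triangle inequality, and both have squared size at
  most \<open>L * L\<close>.\<close>

lemma stratonovich_expansion:
  assumes X: "regular X" and m: "m \<le> M" and Y: "stratonovich_integral P X (W m) Y"
  shows "\<exists>c. \<forall>s t. 0 \<le> s \<and> s \<le> t \<and> t \<le> 1 \<longrightarrow>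
    mbound c (\<lambda>w. Y t w - Y s w - X s w * (W m t w - W m s w)) ((t - s) * (t - s))"
proof -
  obtain c d where R: "regular_with c d X" using X unfolding regular_def by blast
  define e1 where "e1 r = exp (\<Sum>i=1..2 * r. real (2 * r choose i) * fact i) * d r" for r
  define e2 where "e2 r = sqrt (d (2 * r) * fact (2 * (2 * r)))" for r
  have e0: "0 \<le> e1 r" "0 \<le> e2 r" for r
    using regular_withD(6)[OF R] by (auto simp: e1_def e2_def)
  have Ym: "Y t \<in> borel_measurable P" if "0 \<le> t" for t
    using Y that by (simp add: stratonovich_integral_def continuous_process_def)
  show ?thesis
  proof (intro exI allI impI)
    fix s t :: real assume st: "0 \<le> s \<and> s \<le> t \<and> t \<le> 1"
    define L where "L = t - s"
    show "mbound (\<lambda>r. 4 ^ r * (e1 r + e2 r))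
      (\<lambda>w. Y t w - Y s w - X s w * (W m t w - W m s w)) ((t - s) * (t - s))"
    proof (cases "s = t")
      case True
      then show ?thesis using mbound_zero[of "\<lambda>r. 4 ^ r * (e1 r + e2 r)" 0] e0 by simp
    next
      case False
      then have L: "0 < L" "L \<le> 1" using st by (auto simp: L_def)
      define \<tau> where "\<tau> n = grid s t n" for n
      have \<tau>: "0 \<le> \<tau> n k" "s \<le> \<tau> n k" "\<tau> n k \<le> t" "\<tau> n k \<le> 1" if "k \<le> Suc n" for n k
        using grid_bounds[of s t k n] that st by (auto simp: \<tau>_def)
      have \<tau>mono: "\<tau> n k \<le> \<tau> n (Suc k)" for n k using st grid_mono[of s t k "Suc k" n] by (simp add: \<tau>_def)
      have step: "\<tau> n (Suc k) - \<tau> n k = L / real (Suc n)" for n k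
        unfolding \<tau>_def L_def by (rule grid_step)
      define dX where "dX n k w = X (\<tau> n (Suc k)) w - X (\<tau> n k) w" for n k w
      define dW where "dW n k w = W m (\<tau> n (Suc k)) w - W m (\<tau> n k) w" for n k w
      define B where "B n w = (\<Sum>k<Suc n. (X (\<tau> n k) w - X s w) * dW n k w)
        + (\<Sum>k<Suc n. 1 / 2 * (dX n k w * dW n k w))" for n w
      have B: "mbound (\<lambda>r. 4 ^ r * (e1 r + e2 r)) (B n) (L * L)" for n
        unfolding B_def[abs_def]
      proof (rule mbound_add)
        show "mbound e1 (\<lambda>w. \<Sum>k<Suc n. (X (\<tau> n k) w - X s w) * dW n k w) (L * L)"
          unfolding e1_def dW_def
        proof (rule mbound_adapted_sum[OF m])
          show "\<tau> n (Suc n) - \<tau> n 0 \<le> L" by (simp add: \<tau>_def L_def)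
          fix k assume k: "k < Suc n"
          have "mbound d (\<lambda>w. X (\<tau> n k) w - X s w) (\<tau> n k - s)"
            by (rule regular_withD(3)[OF R]) (use \<tau>[of k n] k st in auto)
          then show "mbound d (\<lambda>w. X (\<tau> n k) w - X s w) L"
            by (rule mbound_mono) (use \<tau>[of k n] k in \<open>auto simp: L_def\<close>)
          show "adapted (\<tau> n k) (\<lambda>w. X (\<tau> n k) w - X s w)"
            using \<tau>[of k n] k st
            by (intro adapted_diff adapted_mono[OF regular_withD(1)[OF R, of s]] regular_withD(1)[OF R]) auto
        qed (use L \<tau>mono \<tau>[of 0 n] regular_withD(6)[OF R] in auto)
        have "mbound e2 (\<lambda>w. \<Sum>k<Suc n. 1 / 2 * (dX n k w * dW n k w))
            ((real (Suc n))\<^sup>2 * ((1 / 2)\<^sup>2 * (L / real (Suc n) * (L / real (Suc n)))))"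
        proof (rule mbound_sum[OF mbound_cmult])
          fix k assume k: "k < Suc n"
          have "mbound d (dX n k) (\<tau> n (Suc k) - \<tau> n k)"
            unfolding dX_def by (rule regular_withD(3)[OF R]) (use \<tau>[of k n] \<tau>[of "Suc k" n] \<tau>mono k in auto)
          moreover have "mbound (\<lambda>r. fact (2 * r)) (dW n k) (\<tau> n (Suc k) - \<tau> n k)"
            unfolding dW_def by (rule mbound_increment[OF m]) (use \<tau>[of k n] \<tau>[of "Suc k" n] \<tau>mono k in auto)
          ultimately have "mbound (\<lambda>r. sqrt (d (2 * r) * fact (2 * (2 * r))))
              (\<lambda>w. dX n k w * dW n k w) ((\<tau> n (Suc k) - \<tau> n k) * (\<tau> n (Suc k) - \<tau> n k))"
            by (rule mbound_mult) (use \<tau>mono in auto)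
          then show "mbound e2 (\<lambda>w. dX n k w * dW n k w) (L / real (Suc n) * (L / real (Suc n)))"
            unfolding step e2_def .
        qed (rule e0)
        then show "mbound e2 (\<lambda>w. \<Sum>k<Suc n. 1 / 2 * (dX n k w * dW n k w)) (L * L)"
        proof (rule mbound_mono)
          \<comment> \<open>The square of the number of steps, lost in the triangle inequality,
            cancels against the two step lengths, so the bound is uniform in
            \<open>n\<close>.\<close>
          have eq: "(real (Suc n))\<^sup>2 * ((1 / 2)\<^sup>2 * (L / real (Suc n) * (L / real (Suc n)))) = L * L / 4"
            by (simp add: power2_eq_square field_simps del: of_nat_Suc)
          show "(real (Suc n))\<^sup>2 * ((1 / 2)\<^sup>2 * (L / real (Suc n) * (L / real (Suc n)))) \<le> L * L"
            unfolding eq by simp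
        qed simp
      qed
      have "B n w = stratonovich_sum X (W m) (Suc n) (\<tau> n) w - X s w * (W m t w - W m s w)" for n w
      proof -
        have "W m t w - W m s w = (\<Sum>k<Suc n. dW n k w)"
          unfolding dW_def by (subst sum_lessThan_telescope) (simp add: \<tau>_def)
        then have "X s w * (W m t w - W m s w) = (\<Sum>k<Suc n. X s w * dW n k w)"
          by (simp only: sum_distrib_left)
        then show ?thesis
          unfolding B_def stratonovich_sum_def sum.distrib[symmetric] sum_subtractf[symmetric]
          by (simp only: sum_subtractf[symmetric]) (intro sum.cong refl, simp add: dX_def dW_def field_simps)
      qed
      then have Beq: "B n w - (Y t w - Y s w - X s w * (W m t w - W m s w))
          = stratonovich_sum X (W m) (Suc n) (grid s t n) w - (Y t w - Y s w)" for n w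
        by (simp add: \<tau>_def)
      show ?thesis
      proof (rule mbound_limit[of _ B])
        show "mbound (\<lambda>r. 4 ^ r * (e1 r + e2 r)) (B n) ((t - s) * (t - s))" for n
          using B by (simp add: L_def)
        show "(\<lambda>w. Y t w - Y s w - X s w * (W m t w - W m s w)) \<in> borel_measurable P"
          using Ym[of t] Ym[of s] W_measurable[OF m, of t] W_measurable[OF m, of s] regular_withD(4)[OF R, of s] st
          by simp
        show "null_in_prob (\<lambda>n w. B n w - (Y t w - Y s w - X s w * (W m t w - W m s w)))"
          unfolding Beq
          by (rule stratonovich_increment_null[OF Y _ _ _ regular_withD(4)[OF R] W_measurable[OF m]])
            (use st False in auto)
      qed
    qed
  qed
qed

lemma adapted_stratonovich_integral:
  assumes X: "regular X" and m: "m \<le> M" and Y: "stratonovich_integral P X (W m) Y" and t: "0 \<le> t" "t \<le> 1"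
  shows "adapted t (Y t)"
proof (cases "t = 0")
  case True
  then show ?thesis
    using stratonovich_integral_0[OF Y] unfolding adapted_def by (intro bexI[of _ "\<lambda>_. 0"]) auto
next
  case False
  obtain c d where R: "regular_with c d X" using X unfolding regular_def by blast
  have "null_in_prob (\<lambda>n w. stratonovich_sum X (W m) (Suc n) (grid 0 t n) w - (Y t w - Y 0 w))"
    by (rule stratonovich_increment_null[OF Y _ _ _ regular_withD(4)[OF R] W_measurable[OF m]])
      (use t False in auto)
  from null_in_prob_AE_subseq[OF this] obtain q where
    q: "AE w in P. (\<lambda>n. stratonovich_sum X (W m) (Suc (q n)) (grid 0 t (q n)) w - (Y t w - Y 0 w)) \<longlonglongrightarrow> 0"
    by blast
  show ?thesis
  proof (rule adapted_AE_limit)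
    fix n
    have "0 \<le> grid 0 t (q n) k" "grid 0 t (q n) k \<le> t" if "k \<le> Suc (q n)" for k
      using grid_bounds[of 0 t k "q n"] that t by auto
    then have "adapted t (X (grid 0 t (q n) k))" "adapted t (W m (grid 0 t (q n) k))" if "k \<le> Suc (q n)" for k
      using that t by (auto intro!: adapted_mono[OF regular_withD(1)[OF R]] adapted_mono[OF adapted_W[OF m]]
          intro: order_trans)
    then show "adapted t (stratonovich_sum X (W m) (Suc (q n)) (grid 0 t (q n)))"
      unfolding stratonovich_sum_def[abs_def] divide_inverse
      by (intro adapted_sum adapted_mult adapted_diff adapted_add adapted_const) auto
  next
    show "AE w in P. (\<lambda>n. stratonovich_sum X (W m) (Suc (q n)) (grid 0 t (q n)) w) \<longlonglongrightarrow> Y t w"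
      using q stratonovich_integral_0[OF Y]
    proof eventually_elim
      case (elim w)
      then show ?case by (simp add: LIM_zero_iff)
    qed
  qed
qed

text \<open>Integration stays within the regular processes, which allows the induction over trees.
  On [0, 1] the remainder of squared size (t - s)^2 is dominated by the leading term of squared size
  t - s.\<close>

lemma regular_stratonovich_integral:
  assumes X: "regular X" and m: "m \<le> M" and Y: "stratonovich_integral P X (W m) Y"
  shows "regular Y"
proof -
  obtain c d where R: "regular_with c d X" using X unfolding regular_def by blast
  obtain e where e: "\<And>s t. 0 \<le> s \<Longrightarrow> s \<le> t \<Longrightarrow> t \<le> 1 \<Longrightarrow>
      mbound e (\<lambda>w. Y t w - Y s w - X s w * (W m t w - W m s w)) ((t - s) * (t - s))"
    using stratonovich_expansion[OF assms] by blast
  define e' where "e' r = 4 ^ r * (e r + sqrt (c (2 * r) * fact (2 * (2 * r))))" for r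
  have inc: "mbound e' (\<lambda>w. Y t w - Y s w) (t - s)" if st: "0 \<le> s" "s \<le> t" "t \<le> 1" for s t
  proof -
    have "mbound e (\<lambda>w. Y t w - Y s w - X s w * (W m t w - W m s w)) (t - s)"
      by (rule mbound_mono[OF e[OF st]]) (use st mult_left_le[of "t - s" "t - s"] in auto)
    moreover have "mbound (\<lambda>r. sqrt (c (2 * r) * fact (2 * (2 * r)))) (\<lambda>w. X s w * (W m t w - W m s w)) (1 * (t - s))"
      by (rule mbound_mult[OF regular_withD(2)[OF R] mbound_increment[OF m]]) (use st in auto)
    ultimately have "mbound e' (\<lambda>w. Y t w - Y s w - X s w * (W m t w - W m s w) + X s w * (W m t w - W m s w)) (t - s)"
      unfolding e'_def by (intro mbound_add) simp_all
    then show ?thesis by simp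
  qed
  have "mbound e' (Y t) 1" if t: "0 \<le> t" "t \<le> 1" for t
  proof (rule mbound_mono[OF mbound_cong_AE[OF inc[of 0 t]]])
    show "AE w in P. Y t w - Y 0 w = Y t w" using stratonovich_integral_0[OF Y] by eventually_elim simp
    show "Y t \<in> borel_measurable P" using Y t by (simp add: stratonovich_integral_def continuous_process_def)
  qed (use t in auto)
  then have "regular_with e' e' Y"
    unfolding regular_with_def using inc adapted_stratonovich_integral[OF assms] by auto
  then show ?thesis unfolding regular_def by blast
qed

end

context driven_space
begin

subsection \<open>The product rule for Stratonovich integrals\<close>

text \<open>Passing from the left-point to the trapezoidal value changes only a term of the same
  size as the error, so no order is gained; the trapezoidal form is the one that matches the
  summands of \<open>stratonovich_sum\<close>.\<close>

lemma trapezoid_error: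
  assumes X: "regular X" and m: "m \<le> M" and Y: "stratonovich_integral P X (W m) Y"
  shows "\<exists>c. \<forall>s t. 0 \<le> s \<and> s \<le> t \<and> t \<le> 1 \<longrightarrow>
    mbound c (\<lambda>w. Y t w - Y s w - (X s w + X t w) / 2 * (W m t w - W m s w)) ((t - s) * (t - s))"
proof -
  obtain c d where R: "regular_with c d X" using X unfolding regular_def by blast
  obtain e where e: "\<And>s t. 0 \<le> s \<Longrightarrow> s \<le> t \<Longrightarrow> t \<le> 1 \<Longrightarrow>
      mbound e (\<lambda>w. Y t w - Y s w - X s w * (W m t w - W m s w)) ((t - s) * (t - s))"
    using stratonovich_expansion[OF assms] by blast
  show ?thesis
  proof (intro exI allI impI)
    fix s t :: real assume st: "0 \<le> s \<and> s \<le> t \<and> t \<le> 1"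
    have "mbound (\<lambda>r. sqrt (d (2 * r) * fact (2 * (2 * r))))
        (\<lambda>w. 1 / 2 * ((X t w - X s w) * (W m t w - W m s w))) ((1 / 2)\<^sup>2 * ((t - s) * (t - s)))"
      by (rule mbound_cmult[OF mbound_mult[OF regular_withD(3)[OF R] mbound_increment[OF m]]])
        (use st in auto)
    then have "mbound (\<lambda>r. sqrt (d (2 * r) * fact (2 * (2 * r))))
        (\<lambda>w. 1 / 2 * ((X t w - X s w) * (W m t w - W m s w))) ((t - s) * (t - s))"
      by (rule mbound_mono) (auto simp: power2_eq_square)
    from mbound_diff[OF e this] st
    have "mbound (\<lambda>r. 4 ^ r * (e r + sqrt (d (2 * r) * fact (2 * (2 * r)))))
      (\<lambda>w. (Y t w - Y s w - X s w * (W m t w - W m s w)) -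
        1 / 2 * ((X t w - X s w) * (W m t w - W m s w))) ((t - s) * (t - s))" by auto
    moreover have "(Y t w - Y s w - X s w * (W m t w - W m s w)) -
        1 / 2 * ((X t w - X s w) * (W m t w - W m s w)) =
        Y t w - Y s w - (X s w + X t w) / 2 * (W m t w - W m s w)" for w
      by (simp add: field_simps)
    ultimately show "mbound (\<lambda>r. 4 ^ r * (e r + sqrt (d (2 * r) * fact (2 * (2 * r)))))
      (\<lambda>w. Y t w - Y s w - (X s w + X t w) / 2 * (W m t w - W m s w)) ((t - s) * (t - s))"
      by (simp only:)
  qed
qed

text \<open>
  The contribution of the step \<open>[a, b]\<close> to the difference between a sum for \<open>\<integral> Y' dY\<close> and the
  trapezoidal sum for \<open>\<integral> Y' X \<circ> dW\<close>, with \<open>Y'\<close> replaced by its increment since the left end \<open>s\<close>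
  of the block in the main term.
\<close>

definition cross where
  "cross X Y Y' m s a b w =
    ((Y' a w - Y' s w) + (Y' b w - Y' s w)) / 2 *
      (Y b w - Y a w - (X a w + X b w) / 2 * (W m b w - W m a w))
    - (X b w - X a w) * ((Y' b w - Y' a w) * (W m b w - W m a w)) / 4"

text \<open>The factor \<open>t - s\<close> is the gain over \<open>trapezoid_error\<close>. In the
  first term it comes from measuring \<open>Y'\<close> from the start of the block, in the second
  from the increment of \<open>X\<close>.\<close>

lemma cross_bound:
  assumes X: "regular X" and m: "m \<le> M" and Y: "stratonovich_integral P X (W m) Y" and Y': "regular Y'"
  shows "\<exists>c. (\<forall>r. 0 \<le> c r) \<and> (\<forall>s a b t. 0 \<le> s \<and> s \<le> a \<and> a \<le> b \<and> b \<le> t \<and> t \<le> 1 \<longrightarrow>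
    mbound c (cross X Y Y' m s a b) ((t - s) * ((b - a) * (b - a))))"
proof -
  obtain c d where R: "regular_with c d X" using X unfolding regular_def by blast
  obtain c' d' where R': "regular_with c' d' Y'" using Y' unfolding regular_def by blast
  obtain e where e: "\<And>s t. 0 \<le> s \<Longrightarrow> s \<le> t \<Longrightarrow> t \<le> 1 \<Longrightarrow>
      mbound e (\<lambda>w. Y t w - Y s w - (X s w + X t w) / 2 * (W m t w - W m s w)) ((t - s) * (t - s))"
    using trapezoid_error[OF X m Y] by blast
  define k1 where "k1 r = 4 ^ r * (d' r + d' r)" for r
  define k2 where "k2 r = sqrt (k1 (2 * r) * e (2 * r))" for r
  define k3 where "k3 r = sqrt (d' (2 * r) * fact (2 * (2 * r)))" for r
  define k4 where "k4 r = sqrt (d (2 * r) * k3 (2 * r))" for r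
  have B: "mbound (\<lambda>r. 4 ^ r * (k2 r + k4 r)) (cross X Y Y' m s a b) ((t - s) * ((b - a) * (b - a)))"
    if st: "0 \<le> s" "s \<le> a" "a \<le> b" "b \<le> t" "t \<le> 1" for s a b t
    unfolding cross_def[abs_def]
  proof (rule mbound_diff)
    have "mbound k1 (\<lambda>w. (Y' a w - Y' s w) + (Y' b w - Y' s w)) (t - s)"
      unfolding k1_def
    proof (rule mbound_add)
      show "mbound d' (\<lambda>w. Y' a w - Y' s w) (t - s)"
        by (rule mbound_mono[OF regular_withD(3)[OF R']]) (use st in auto)
      show "mbound d' (\<lambda>w. Y' b w - Y' s w) (t - s)"
        by (rule mbound_mono[OF regular_withD(3)[OF R']]) (use st in auto)
    qed
    from mbound_cmult[OF this, of "1 / 2"]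
    have "mbound k1 (\<lambda>w. 1 / 2 * ((Y' a w - Y' s w) + (Y' b w - Y' s w))) (t - s)"
      by (rule mbound_mono) (use st in \<open>auto simp: power2_eq_square\<close>)
    then have "mbound k1 (\<lambda>w. ((Y' a w - Y' s w) + (Y' b w - Y' s w)) / 2) (t - s)"
      by simp
    from mbound_mult[OF this e[of a b]] st
    show "mbound k2 (\<lambda>w. ((Y' a w - Y' s w) + (Y' b w - Y' s w)) / 2 *
      (Y b w - Y a w - (X a w + X b w) / 2 * (W m b w - W m a w))) ((t - s) * ((b - a) * (b - a)))"
      unfolding k2_def by simp
    have "mbound d (\<lambda>w. X b w - X a w) (t - s)"
      by (rule mbound_mono[OF regular_withD(3)[OF R]]) (use st in auto)
    moreover have "mbound k3 (\<lambda>w. (Y' b w - Y' a w) * (W m b w - W m a w)) ((b - a) * (b - a))"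
      unfolding k3_def by (rule mbound_mult[OF regular_withD(3)[OF R'] mbound_increment[OF m]]) (use st in auto)
    ultimately have "mbound k4 (\<lambda>w. (X b w - X a w) * ((Y' b w - Y' a w) * (W m b w - W m a w)))
        ((t - s) * ((b - a) * (b - a)))"
      unfolding k4_def by (rule mbound_mult) (use st in auto)
    from mbound_cmult[OF this, of "1 / 4"]
    have "mbound k4 (\<lambda>w. 1 / 4 * ((X b w - X a w) * ((Y' b w - Y' a w) * (W m b w - W m a w))))
        ((t - s) * ((b - a) * (b - a)))"
      by (rule mbound_mono) (use st in \<open>auto simp: power2_eq_square mult_left_le_one_le\<close>)
    then show "mbound k4 (\<lambda>w. (X b w - X a w) * ((Y' b w - Y' a w) * (W m b w - W m a w)) / 4)
        ((t - s) * ((b - a) * (b - a)))"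
      by simp
  qed
  have "0 \<le> 4 ^ r * (k2 r + k4 r)" for r using mboundD(2)[OF B[of 0 0 0 0]] by simp
  then show ?thesis
    by (intro exI[of _ "\<lambda>r. 4 ^ r * (k2 r + k4 r)"] conjI allI impI B) auto
qed

text \<open>The squared number of steps cancels against the two factors \<open>b - a\<close> of
  \<open>cross_bound\<close>. The exponent 3 refers to the squared size, that is, 3/2 for the defect
  itself.\<close>

lemma cross_sum_bound:
  assumes "regular X" "m \<le> M" "stratonovich_integral P X (W m) Y" "regular Y'"
  shows "\<exists>c. \<forall>n s t. 0 \<le> s \<and> s \<le> t \<and> t \<le> 1 \<longrightarrow>
    mbound c (\<lambda>w. \<Sum>k<Suc n. cross X Y Y' m s (grid s t n k) (grid s t n (Suc k)) w) ((t - s) ^ 3)"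
proof -
  from cross_bound[OF assms] obtain c where c0: "\<And>r. 0 \<le> c r" and c: "\<And>s a b t. 0 \<le> s \<Longrightarrow> s \<le> a \<Longrightarrow>
    a \<le> b \<Longrightarrow> b \<le> t \<Longrightarrow> t \<le> 1 \<Longrightarrow> mbound c (cross X Y Y' m s a b) ((t - s) * ((b - a) * (b - a)))" by blast
  show ?thesis
  proof (intro exI allI impI)
    fix n and s t :: real assume st: "0 \<le> s \<and> s \<le> t \<and> t \<le> 1"
    have "mbound c (\<lambda>w. \<Sum>k<Suc n. cross X Y Y' m s (grid s t n k) (grid s t n (Suc k)) w)
        ((real (Suc n))\<^sup>2 * ((t - s) * ((t - s) / real (Suc n) * ((t - s) / real (Suc n)))))"
    proof (rule mbound_sum[OF _ c0])
      fix k assume k: "k < Suc n"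
      have "mbound c (cross X Y Y' m s (grid s t n k) (grid s t n (Suc k)))
          ((t - s) * ((grid s t n (Suc k) - grid s t n k) * (grid s t n (Suc k) - grid s t n k)))"
        by (rule c) (use st k grid_bounds[of s t k n] grid_bounds[of s t "Suc k" n] grid_mono[of s t k "Suc k" n] in auto)
      then show "mbound c (cross X Y Y' m s (grid s t n k) (grid s t n (Suc k)))
          ((t - s) * ((t - s) / real (Suc n) * ((t - s) / real (Suc n))))"
        unfolding grid_step .
    qed
    moreover have "(real (Suc n))\<^sup>2 * ((t - s) * ((t - s) / real (Suc n) * ((t - s) / real (Suc n)))) = (t - s) ^ 3"
      by (simp add: power2_eq_square power3_eq_cube field_simps del: of_nat_Suc)
    ultimately show "mbound c (\<lambda>w. \<Sum>k<Suc n. cross X Y Y' m s (grid s t n k) (grid s t n (Suc k)) w) ((t - s) ^ 3)"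
      by (simp only:)
  qed
qed

text \<open>The last term of \<open>cross\<close> arises because the mean of the products of
  \<open>Y'\<close> and \<open>X\<close> at the two ends exceeds the product of their means by a
  quarter of the product of their increments. The part multiplied by \<open>Y' s\<close> tends to 0
  in probability for an integral \<open>Y\<close> of \<open>X\<close>.\<close>

lemma cross_sum_eq:
  "(\<Sum>k<n. cross X Y Y' m s (p k) (p (Suc k)) w) =
    (\<Sum>k<n. (Y' (p k) w + Y' (p (Suc k)) w) / 2 * (Y (p (Suc k)) w - Y (p k) w))
    - stratonovich_sum (\<lambda>t w. Y' t w * X t w) (W m) n p w
    - Y' s w * ((Y (p n) w - Y (p 0) w) - stratonovich_sum X (W m) n p w)"
proof (induction n)
  case (Suc n)
  then show ?case
    by (simp add: stratonovich_sum_def cross_def field_simps)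
qed (simp add: stratonovich_sum_def)

text \<open>With trapezoidal means, summation by parts is exact and leaves no bracket term: the
  discrete reason why the Stratonovich product rule has no Ito correction.\<close>

lemma sum_product_telescope:
  fixes f g :: "nat \<Rightarrow> real"
  shows "(\<Sum>k<n. (f k + f (Suc k)) / 2 * (g (Suc k) - g k)) + (\<Sum>k<n. (g k + g (Suc k)) / 2 * (f (Suc k) - f k))
    = f n * g n - f 0 * g 0"
  by (induction n) (simp_all add: field_simps)

lemma stratonovich_product_rule:
  assumes X\<^sub>1: "regular X\<^sub>1" and m\<^sub>1: "m\<^sub>1 \<le> M" and Y\<^sub>1: "stratonovich_integral P X\<^sub>1 (W m\<^sub>1) Y\<^sub>1"
    and X\<^sub>2: "regular X\<^sub>2" and m\<^sub>2: "m\<^sub>2 \<le> M" and Y\<^sub>2: "stratonovich_integral P X\<^sub>2 (W m\<^sub>2) Y\<^sub>2"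
    and Z\<^sub>1: "stratonovich_integral P (\<lambda>t w. Y\<^sub>2 t w * X\<^sub>1 t w) (W m\<^sub>1) Z\<^sub>1"
    and Z\<^sub>2: "stratonovich_integral P (\<lambda>t w. Y\<^sub>1 t w * X\<^sub>2 t w) (W m\<^sub>2) Z\<^sub>2"
    and h: "0 \<le> h" "h \<le> 1"
  shows "AE w in P. Y\<^sub>1 h w * Y\<^sub>2 h w = Z\<^sub>1 h w + Z\<^sub>2 h w"
proof -
  have rY\<^sub>1: "regular Y\<^sub>1" and rY\<^sub>2: "regular Y\<^sub>2"
    by (rule regular_stratonovich_integral[OF X\<^sub>1 m\<^sub>1 Y\<^sub>1], rule regular_stratonovich_integral[OF X\<^sub>2 m\<^sub>2 Y\<^sub>2])
  have meas: "Z t \<in> borel_measurable P" if "stratonovich_integral P X V Z" "0 \<le> t" for X V Z t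
    using that by (simp add: stratonovich_integral_def continuous_process_def)
  have measX: "X t \<in> borel_measurable P" if "regular X" "0 \<le> t" "t \<le> 1" for X t
    using that regular_withD(4) unfolding regular_def by blast
  define J where "J s t w = (Y\<^sub>1 t w * Y\<^sub>2 t w - Y\<^sub>1 s w * Y\<^sub>2 s w) - (Z\<^sub>1 t w - Z\<^sub>1 s w) - (Z\<^sub>2 t w - Z\<^sub>2 s w)"
    for s t w
  have Jm: "J s t \<in> borel_measurable P" if "0 \<le> s" "0 \<le> t" for s t
    unfolding J_def[abs_def]
    using meas[OF Y\<^sub>1] meas[OF Y\<^sub>2] meas[OF Z\<^sub>1] meas[OF Z\<^sub>2] that
    by (intro borel_measurable_diff borel_measurable_times) auto
  define B\<^sub>1 where "B\<^sub>1 s t n w = (\<Sum>k<Suc n. cross X\<^sub>1 Y\<^sub>1 Y\<^sub>2 m\<^sub>1 s (grid s t n k) (grid s t n (Suc k)) w)" for s t n w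
  define B\<^sub>2 where "B\<^sub>2 s t n w = (\<Sum>k<Suc n. cross X\<^sub>2 Y\<^sub>2 Y\<^sub>1 m\<^sub>2 s (grid s t n k) (grid s t n (Suc k)) w)" for s t n w
  obtain c\<^sub>1 where c\<^sub>1: "\<And>n s t. 0 \<le> s \<Longrightarrow> s \<le> t \<Longrightarrow> t \<le> 1 \<Longrightarrow> mbound c\<^sub>1 (B\<^sub>1 s t n) ((t - s) ^ 3)"
    using cross_sum_bound[OF X\<^sub>1 m\<^sub>1 Y\<^sub>1 rY\<^sub>2] unfolding B\<^sub>1_def[abs_def] by blast
  obtain c\<^sub>2 where c\<^sub>2: "\<And>n s t. 0 \<le> s \<Longrightarrow> s \<le> t \<Longrightarrow> t \<le> 1 \<Longrightarrow> mbound c\<^sub>2 (B\<^sub>2 s t n) ((t - s) ^ 3)"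
    using cross_sum_bound[OF X\<^sub>2 m\<^sub>2 Y\<^sub>2 rY\<^sub>1] unfolding B\<^sub>2_def[abs_def] by blast
  define c where "c r = 4 ^ r * (c\<^sub>1 r + c\<^sub>2 r)" for r
  have c0: "0 \<le> c r" for r
    using mboundD(2)[OF c\<^sub>1[of 0 0 0]] mboundD(2)[OF c\<^sub>2[of 0 0 0]] by (simp add: c_def)
  have J: "mbound c (J s t) ((t - s) ^ 3)" if st: "0 \<le> s" "s \<le> t" "t \<le> 1" for s t
  proof (cases "s = t")
    case True
    then show ?thesis using mbound_zero[OF c0, of 0] by (simp add: J_def[abs_def])
  next
    case False
    then have st': "s < t" using st by simp
    define T where "T X m n w = stratonovich_sum X (W m) (Suc n) (grid s t n) w" for X m n w
    have null: "null_in_prob (\<lambda>n w. T X m n w - (Y t w - Y s w))"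
      if "stratonovich_integral P X (W m) Y" "m \<le> M" "regular X" for X m Y
      unfolding T_def
      by (rule stratonovich_increment_null[OF that(1) st(1) st' st(3) measX[OF that(3)] W_measurable[OF that(2)]]) auto
    show ?thesis
    proof (rule mbound_limit[of c "\<lambda>n w. B\<^sub>1 s t n w + B\<^sub>2 s t n w"])
      show "mbound c (\<lambda>w. B\<^sub>1 s t n w + B\<^sub>2 s t n w) ((t - s) ^ 3)" for n
        unfolding c_def by (rule mbound_add[OF c\<^sub>1 c\<^sub>2]) (use st in auto)
      show "J s t \<in> borel_measurable P" using Jm st by simp
      define D where "D f g n w = (\<Sum>k<Suc n. (f (grid s t n k) w + f (grid s t n (Suc k)) w) / 2 *
          (g (grid s t n (Suc k)) w - g (grid s t n k) w))" for f g :: "real \<Rightarrow> 'w \<Rightarrow> real" and n w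
      have "null_in_prob (\<lambda>n w. Y\<^sub>2 s w * (T X\<^sub>1 m\<^sub>1 n w - (Y\<^sub>1 t w - Y\<^sub>1 s w)) +
          Y\<^sub>1 s w * (T X\<^sub>2 m\<^sub>2 n w - (Y\<^sub>2 t w - Y\<^sub>2 s w)) -
          (T (\<lambda>t w. Y\<^sub>2 t w * X\<^sub>1 t w) m\<^sub>1 n w - (Z\<^sub>1 t w - Z\<^sub>1 s w)) -
          (T (\<lambda>t w. Y\<^sub>1 t w * X\<^sub>2 t w) m\<^sub>2 n w - (Z\<^sub>2 t w - Z\<^sub>2 s w)))" (is "null_in_prob ?A")
        by (intro null_in_prob_diff null_in_prob_add null_in_prob_mult null
            Y\<^sub>1 Y\<^sub>2 Z\<^sub>1 Z\<^sub>2 m\<^sub>1 m\<^sub>2 X\<^sub>1 X\<^sub>2 regular_mult rY\<^sub>1 rY\<^sub>2 meas[OF Y\<^sub>1] meas[OF Y\<^sub>2] st(1))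
      moreover have "?A n w = B\<^sub>1 s t n w + B\<^sub>2 s t n w - J s t w" for n w
      proof -
        have eq: "B\<^sub>1 s t n w = D Y\<^sub>2 Y\<^sub>1 n w - T (\<lambda>t w. Y\<^sub>2 t w * X\<^sub>1 t w) m\<^sub>1 n w
            - Y\<^sub>2 s w * ((Y\<^sub>1 t w - Y\<^sub>1 s w) - T X\<^sub>1 m\<^sub>1 n w)"
          "B\<^sub>2 s t n w = D Y\<^sub>1 Y\<^sub>2 n w - T (\<lambda>t w. Y\<^sub>1 t w * X\<^sub>2 t w) m\<^sub>2 n w
            - Y\<^sub>1 s w * ((Y\<^sub>2 t w - Y\<^sub>2 s w) - T X\<^sub>2 m\<^sub>2 n w)"
          unfolding B\<^sub>1_def B\<^sub>2_def T_def D_def cross_sum_eq by (simp_all only: grid_0 grid_last)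
        have tel: "D Y\<^sub>2 Y\<^sub>1 n w + D Y\<^sub>1 Y\<^sub>2 n w = Y\<^sub>2 t w * Y\<^sub>1 t w - Y\<^sub>2 s w * Y\<^sub>1 s w"
          using sum_product_telescope[of "\<lambda>k. Y\<^sub>2 (grid s t n k) w" "\<lambda>k. Y\<^sub>1 (grid s t n k) w" "Suc n"]
          unfolding D_def by (simp only: grid_0 grid_last)
        show ?thesis
          using eq tel unfolding J_def by (simp only: algebra_simps)
      qed
      ultimately show "null_in_prob (\<lambda>n w. B\<^sub>1 s t n w + B\<^sub>2 s t n w - J s t w)" by (simp only:)
    qed
  qed
  \<comment> \<open>Now [0, h] is cut into \<open>Suc n\<close> blocks. The triangle inequality
    multiplies the squared block bound by the square of their number, still leaving a factor 1 / (n
    + 1).\<close>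
  have small: "mbound c (J 0 h) (h ^ 3 / real (Suc n))" for n
  proof -
    have "mbound c (\<lambda>w. \<Sum>k<Suc n. J (grid 0 h n k) (grid 0 h n (Suc k)) w) ((real (Suc n))\<^sup>2 * (h / real (Suc n)) ^ 3)"
    proof (rule mbound_sum[OF _ c0])
      fix k assume k: "k < Suc n"
      have "mbound c (J (grid 0 h n k) (grid 0 h n (Suc k))) ((grid 0 h n (Suc k) - grid 0 h n k) ^ 3)"
        by (rule J) (use h k grid_bounds[of 0 h k n] grid_bounds[of 0 h "Suc k" n] grid_mono[of 0 h k "Suc k" n] in auto)
      then show "mbound c (J (grid 0 h n k) (grid 0 h n (Suc k))) ((h / real (Suc n)) ^ 3)"
        unfolding grid_step by simp
    qed
    moreover have "(\<Sum>k<Suc n. J (grid 0 h n k) (grid 0 h n (Suc k)) w) = J 0 h w" for w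
    proof -
      define F where "F t = Y\<^sub>1 t w * Y\<^sub>2 t w - Z\<^sub>1 t w - Z\<^sub>2 t w" for t
      have "J s t w = F t - F s" for s t by (simp add: J_def F_def)
      then have "(\<Sum>k<Suc n. J (grid 0 h n k) (grid 0 h n (Suc k)) w)
          = (\<Sum>k<Suc n. F (grid 0 h n (Suc k)) - F (grid 0 h n k))" by simp
      also have "\<dots> = F (grid 0 h n (Suc n)) - F (grid 0 h n 0)" by (rule sum_lessThan_telescope)
      also have "\<dots> = J 0 h w" by (simp add: J_def F_def)
      finally show ?thesis .
    qed
    moreover have "(real (Suc n))\<^sup>2 * (h / real (Suc n)) ^ 3 = h ^ 3 / real (Suc n)"
      by (simp add: power2_eq_square power3_eq_cube field_simps del: of_nat_Suc)
    ultimately show ?thesis by (simp only:)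
  qed
  have i: "integrable P (\<lambda>w. (J 0 h w)\<^sup>2)" using mboundD(3)[OF small, of 1] by simp
  have "expectation (\<lambda>w. (J 0 h w)\<^sup>2) \<le> 0"
  proof (rule LIMSEQ_le_const)
    have "(\<lambda>n. c 1 * (h ^ 3 / real (Suc n))) \<longlonglongrightarrow> c 1 * 0"
      by (intro tendsto_mult_left LIMSEQ_Suc[OF lim_const_over_n])
    then show "(\<lambda>n. c 1 * (h ^ 3 / real (Suc n))) \<longlonglongrightarrow> 0" by simp
    show "\<exists>N. \<forall>n\<ge>N. expectation (\<lambda>w. (J 0 h w)\<^sup>2) \<le> c 1 * (h ^ 3 / real (Suc n))"
      using mboundD(4)[OF small, of 1] by auto
  qed
  then have "expectation (\<lambda>w. (J 0 h w)\<^sup>2) = 0"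
    by (intro antisym Bochner_Integration.integral_nonneg) auto
  then have "AE w in P. (J 0 h w)\<^sup>2 = 0"
    by (subst (asm) integral_nonneg_eq_0_iff_AE[OF i]) auto
  then show ?thesis
    using stratonovich_integral_0[OF Y\<^sub>1] stratonovich_integral_0[OF Z\<^sub>1] stratonovich_integral_0[OF Z\<^sub>2]
    by eventually_elim (simp add: J_def)
qed

end

subsection \<open>Time integrals as Stratonovich integrals\<close>

lemma trapezoid_integral_bound:
  fixes f :: "real \<Rightarrow> real"
  assumes ab: "a \<le> b" and f: "continuous_on {a..b} f"
    and e: "\<And>x y. x \<in> {a..b} \<Longrightarrow> y \<in> {a..b} \<Longrightarrow> \<bar>f x - f y\<bar> \<le> e"
  shows "\<bar>(f a + f b) / 2 * (b - a) - integral {a..b} f\<bar> \<le> e * (b - a)"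
proof -
  let ?c = "(f a + f b) / 2"
  have "(f a + f b) / 2 * (b - a) - integral {a..b} f = integral {a..b} (\<lambda>x. ?c - f x)"
    using ab f by (subst Henstock_Kurzweil_Integration.integral_diff) (auto intro: integrable_continuous_interval)
  moreover have "norm (integral {a..b} (\<lambda>x. ?c - f x)) \<le> e * (b - a)"
  proof (rule integral_bound[OF ab])
    show "continuous_on {a..b} (\<lambda>x. ?c - f x)" by (intro continuous_intros f)
    fix x assume x: "x \<in> {a..b}"
    have "\<bar>f a - f x\<bar> \<le> e" "\<bar>f b - f x\<bar> \<le> e" using e[of a x] e[of b x] x ab by auto
    then show "norm (?c - f x) \<le> e" by (auto simp: abs_le_iff field_simps)
  qed
  ultimately show ?thesis by simp
qed

lemma trapezoidal_sums_converge:
  fixes f :: "real \<Rightarrow> real"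
  assumes f: "continuous_on {0..h} f" and h: "0 \<le> h"
    and p: "\<And>n. is_partition h (N n) (p n)"
    and mesh: "\<And>n k. k < N n \<Longrightarrow> p n (Suc k) - p n k < 1 / real (Suc n)"
  shows "(\<lambda>n. \<Sum>k<N n. (f (p n k) + f (p n (Suc k))) / 2 * (p n (Suc k) - p n k)) \<longlonglongrightarrow> integral {0..h} f"
proof (rule LIMSEQ_I)
  fix e :: real assume e: "0 < e"
  \<comment> \<open>The denominator \<open>h + 1\<close> also covers \<open>h = 0\<close>.\<close>
  define e' where "e' = e / (h + 1)"
  have e': "0 < e'" "e' * h < e" using e h by (auto simp: e'_def field_simps)
  have "uniformly_continuous_on {0..h} f" by (rule compact_uniformly_continuous[OF f compact_Icc])
  then obtain d where d: "d > 0" "\<And>x y. x \<in> {0..h} \<Longrightarrow> y \<in> {0..h} \<Longrightarrow> dist x y < d \<Longrightarrow> dist (f x) (f y) < e'"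
    using e' unfolding uniformly_continuous_on_def by metis
  from reals_Archimedean[OF d(1)] obtain N0 where N0: "inverse (real (Suc N0)) < d" by blast
  show "\<exists>N0. \<forall>n\<ge>N0. norm ((\<Sum>k<N n. (f (p n k) + f (p n (Suc k))) / 2 * (p n (Suc k) - p n k)) - integral {0..h} f) < e"
  proof (intro exI allI impI)
    fix n assume n: "N0 \<le> n"
    have small: "p n (Suc k) - p n k < d" if "k < N n" for k
    proof -
      have "1 / real (Suc n) \<le> inverse (real (Suc N0))" using n by (simp add: field_simps)
      then show ?thesis using mesh[OF that] N0 by linarith
    qed
    have "\<bar>(\<Sum>j<k. (f (p n j) + f (p n (Suc j))) / 2 * (p n (Suc j) - p n j)) - integral {0..p n k} f\<bar> \<le> e' * p n k"
      if "k \<le> N n" for k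
      using that
    proof (induction k)
      case 0
      then show ?case using p[of n] by (simp add: is_partition_def)
    next
      case (Suc k)
      let ?a = "p n k" and ?b = "p n (Suc k)"
      have b: "0 \<le> ?a" "?a \<le> ?b" "?b \<le> h"
        using is_partition_nonneg[OF p, of k n] is_partition_nonneg[OF p, of "Suc k" n] Suc p[of n]
        by (auto simp: is_partition_def less_imp_le)
      have cont: "continuous_on {0..?b} f" "continuous_on {?a..?b} f"
        by (rule continuous_on_subset[OF f]; use b in auto)+
      have "\<bar>(f ?a + f ?b) / 2 * (?b - ?a) - integral {?a..?b} f\<bar> \<le> e' * (?b - ?a)"
      proof (rule trapezoid_integral_bound[OF b(2) cont(2)])
        fix x y assume "x \<in> {?a..?b}" "y \<in> {?a..?b}"
        moreover have "?b - ?a < d" using small Suc by simp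
        ultimately have "dist (f x) (f y) < e'" using b by (intro d(2)) (auto simp: dist_real_def)
        then show "\<bar>f x - f y\<bar> \<le> e'" by (simp add: dist_real_def)
      qed
      moreover have "integral {0..?a} f + integral {?a..?b} f = integral {0..?b} f"
        by (rule Henstock_Kurzweil_Integration.integral_combine[OF b(1,2) integrable_continuous_interval[OF cont(1)]])
      moreover have "e' * ?a + e' * (?b - ?a) = e' * ?b" by (simp add: algebra_simps)
      moreover have "(\<Sum>j<Suc k. (f (p n j) + f (p n (Suc j))) / 2 * (p n (Suc j) - p n j))
          = (\<Sum>j<k. (f (p n j) + f (p n (Suc j))) / 2 * (p n (Suc j) - p n j)) + (f ?a + f ?b) / 2 * (?b - ?a)" by simp
      ultimately show ?case using Suc by linarith
    qed
    from this[OF order_refl] have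
      "\<bar>(\<Sum>j<N n. (f (p n j) + f (p n (Suc j))) / 2 * (p n (Suc j) - p n j)) - integral {0..h} f\<bar> \<le> e' * h"
      using p[of n] by (simp add: is_partition_def)
    then show "norm ((\<Sum>k<N n. (f (p n k) + f (p n (Suc k))) / 2 * (p n (Suc k) - p n k)) - integral {0..h} f) < e"
      using e' by simp
  qed
qed

context driven_space
begin

lemma AE_null_imp_prob_tendsto:
  fixes Z :: "nat \<Rightarrow> 'w \<Rightarrow> real"
  assumes m: "\<And>n. Z n \<in> borel_measurable P" and lim: "AE w in P. (\<lambda>n. Z n w) \<longlonglongrightarrow> 0" and e: "0 < e"
  shows "(\<lambda>n. prob {w\<in>space P. \<bar>Z n w\<bar> > e}) \<longlonglongrightarrow> 0"
proof -
  define A where "A n = {w\<in>space P. \<bar>Z n w\<bar> > e}" for n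
  have A: "A n \<in> events" for n unfolding A_def using m[of n] by measurable
  have "(\<lambda>n. expectation (indicator (A n))) \<longlonglongrightarrow> expectation (\<lambda>_. 0 :: real)"
  proof (rule integral_dominated_convergence[where w = "\<lambda>_. 1"])
    show "AE w in P. (\<lambda>n. indicator (A n) w :: real) \<longlonglongrightarrow> 0"
      using lim
    proof eventually_elim
      case (elim w)
      from LIMSEQ_D[OF elim e] obtain N where "\<And>n. n \<ge> N \<Longrightarrow> \<bar>Z n w\<bar> < e" by auto
      then have "\<And>n. n \<ge> N \<Longrightarrow> indicator (A n) w = (0 :: real)" by (force simp: A_def indicator_def)
      then show ?case by (intro tendsto_eventually eventually_sequentiallyI)
    qed
  qed (use A in auto)
  then show ?thesis using A by (simp add: A_def)
qed

text \<open>The definition asks for one mesh bound that serves all partitions, whereas dominated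
  convergence works along sequences. If every bound 1 / (j + 1) failed, a sequence of bad partitions
  would exist; along it the sums converge almost surely, so the probabilities, all at least
  \<open>e\<close>, would tend to 0.\<close>

lemma stratonovich_integral_time:
  assumes X: "continuous_process P X" and Y: "time_integral P X Y"
  shows "stratonovich_integral P X (W 0) Y"
  unfolding stratonovich_integral_def
proof (intro conjI allI impI)
  show Yc: "continuous_process P Y" using Y by (simp add: time_integral_def)
  fix h e :: real assume h: "0 \<le> h" and e: "0 < e"
  show "\<exists>\<delta>>0. \<forall>n t. is_partition h n t \<and> (\<forall>k<n. t (Suc k) - t k < \<delta>) \<longrightarrow>
      prob {w \<in> space P. \<bar>stratonovich_sum X (W 0) n t w - Y h w\<bar> > e} < e"
  proof (rule ccontr)
    assume neg: "\<not> ?thesis"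
    define Q where "Q j n t \<longleftrightarrow> is_partition h n t \<and> (\<forall>k<n. t (Suc k) - t k < 1 / real (Suc j)) \<and>
        e \<le> prob {w \<in> space P. \<bar>stratonovich_sum X (W 0) n t w - Y h w\<bar> > e}" for j n t
    have "\<exists>n t. Q j n t" for j
    proof -
      have "0 < 1 / real (Suc j)" by simp
      then show ?thesis using neg unfolding Q_def by (meson not_less)
    qed
    then obtain N p where Q: "\<And>j. Q j (N j) (p j)" by metis
    have p: "\<And>j. is_partition h (N j) (p j)"
      "\<And>j k. k < N j \<Longrightarrow> p j (Suc k) - p j k < 1 / real (Suc j)"
      "\<And>j. e \<le> prob {w \<in> space P. \<bar>stratonovich_sum X (W 0) (N j) (p j) w - Y h w\<bar> > e}"
      using Q unfolding Q_def by auto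
    have Xm: "X t \<in> borel_measurable P" if "0 \<le> t" for t
      using X that by (simp add: continuous_process_def)
    have lim: "(\<lambda>j. prob {w \<in> space P. \<bar>stratonovich_sum X (W 0) (N j) (p j) w - Y h w\<bar> > e}) \<longlonglongrightarrow> 0"
    proof (rule AE_null_imp_prob_tendsto[OF _ _ e])
      show "(\<lambda>w. stratonovich_sum X (W 0) (N j) (p j) w - Y h w) \<in> borel_measurable P" for j
        using Yc h is_partition_nonneg(1)[OF p(1)]
        by (intro borel_measurable_diff stratonovich_sum_measurable Xm W_measurable)
          (auto simp: continuous_process_def)
      have "AE w in P. continuous_on {0..} (\<lambda>t. X t w)" using X by (simp add: continuous_process_def)
      moreover have "AE w in P. \<forall>h\<ge>0. Y h w = integral {0..h} (\<lambda>s. X s w)"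
        using Y by (simp add: time_integral_def)
      ultimately show "AE w in P. (\<lambda>j. stratonovich_sum X (W 0) (N j) (p j) w - Y h w) \<longlonglongrightarrow> 0"
      proof eventually_elim
        case (elim w)
        have "continuous_on {0..h} (\<lambda>t. X t w)" by (rule continuous_on_subset[OF elim(1)]) auto
        from trapezoidal_sums_converge[OF this h p(1,2)]
        have "(\<lambda>j. stratonovich_sum X (W 0) (N j) (p j) w) \<longlonglongrightarrow> Y h w"
          using elim(2) h by (simp add: stratonovich_sum_def W_0)
        then show ?case by (rule LIM_zero)
      qed
    qed
    have "e \<le> 0" by (rule LIMSEQ_le_const[OF lim]) (use p(3) in blast)
    then show False using e by simp
  qed
qed

end

subsection \<open>The weights of the exact solution\<close>

lemma continuous_process_prod_mset:
  assumes "\<And>\<tau>. \<tau> \<in># ts \<Longrightarrow> continuous_process P (f \<tau>)"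
  shows "continuous_process P (\<lambda>t w. \<Prod>\<tau>\<in>#ts. f \<tau> t w)"
  using assms
proof (induction ts)
  case (add \<tau> ts)
  let ?g = "\<lambda>t w. \<Prod>\<tau>\<in>#ts. f \<tau> t w"
  have f: "continuous_process P (f \<tau>)" and g: "continuous_process P ?g" using add by auto
  have "AE w in P. continuous_on {0..} (\<lambda>t. f \<tau> t w)" "AE w in P. continuous_on {0..} (\<lambda>t. ?g t w)"
    using f g by (auto simp: continuous_process_def)
  then have "AE w in P. continuous_on {0..} (\<lambda>t. f \<tau> t w * ?g t w)"
    by eventually_elim (rule continuous_on_mult)
  moreover have "(\<lambda>w. f \<tau> t w * ?g t w) \<in> borel_measurable P" if "0 \<le> t" for t
    using f g that by (intro borel_measurable_times) (simp_all add: continuous_process_def)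
  ultimately show ?case by (simp add: continuous_process_def)
qed (simp add: continuous_process_def)

locale exact_solution = driven_space P M W for P :: "'w measure" and M W +
  fixes \<phi> :: "tree \<Rightarrow> real \<Rightarrow> 'w \<Rightarrow> real"
  assumes exact: "exact_weights P M W \<phi>"
begin

lemma continuous_process_W: "m \<le> M \<Longrightarrow> continuous_process P (W m)"
proof (cases "m = 0")
  case True
  then have "W m = (\<lambda>t _. t)" using W_0 by auto
  then show ?thesis by (simp add: continuous_process_def)
next
  assume "m \<le> M" "m \<noteq> 0"
  then show ?thesis using wiener[of m] by (simp add: wiener_process_def)
qed

lemma exact_leaf: "m \<le> M \<Longrightarrow> 0 \<le> h \<Longrightarrow> w \<in> space P \<Longrightarrow> \<phi> (Node q m {#}) h w = W m h w"
  using exact by (simp add: exact_weights_def)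

lemma exact_Empty: "0 \<le> h \<Longrightarrow> w \<in> space P \<Longrightarrow> \<phi> (Empty q) h w = 1"
  using exact by (simp add: exact_weights_def)

lemma exact_node:
  assumes "ts \<noteq> {#}" "Node q m ts \<in> trees M"
  shows "if m = 0 then time_integral P (\<lambda>s w. \<Prod>\<tau>\<in>#ts. \<phi> \<tau> s w) (\<phi> (Node q m ts))
    else stratonovich_integral P (\<lambda>s w. \<Prod>\<tau>\<in>#ts. \<phi> \<tau> s w) (W m) (\<phi> (Node q m ts))"
proof -
  have "\<forall>q m ts. ts \<noteq> {#} \<and> Node q m ts \<in> trees M \<longrightarrow>
      (if m = 0 then time_integral P (\<lambda>s w. \<Prod>\<tau>\<in>#ts. \<phi> \<tau> s w) (\<phi> (Node q m ts))
       else stratonovich_integral P (\<lambda>s w. \<Prod>\<tau>\<in>#ts. \<phi> \<tau> s w) (W m) (\<phi> (Node q m ts)))"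
    using exact unfolding exact_weights_def by (elim conjE)
  then show ?thesis using assms by (elim allE[of _ q] allE[of _ m] allE[of _ ts] mp) simp
qed

lemma Node_in_trees_iff:
  "Node q m ts \<in> trees M \<longleftrightarrow> m \<le> M \<and> (\<forall>\<tau>\<in>#ts. \<tau> \<in> trees M \<and> (\<forall>q'. \<tau> \<noteq> Empty q'))"
  by (auto elim: trees.cases intro: trees.Node)

lemma continuous_process_cong:
  assumes X: "continuous_process P X" and eq: "\<And>t w. 0 \<le> t \<Longrightarrow> w \<in> space P \<Longrightarrow> X t w = Y t w"
  shows "continuous_process P Y"
  unfolding continuous_process_def
proof (intro conjI allI impI)
  show "Y t \<in> borel_measurable P" if "0 \<le> t" for t
  proof -
    have "X t \<in> borel_measurable P" using X that by (simp add: continuous_process_def)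
    then show ?thesis using measurable_cong[of P "X t" "Y t" borel] eq[OF that] by simp
  qed
  have "AE w in P. continuous_on {0..} (\<lambda>t. X t w)" using X by (simp add: continuous_process_def)
  moreover have "continuous_on {0..} (\<lambda>t. X t w) = continuous_on {0..} (\<lambda>t. Y t w)" if "w \<in> space P" for w
    by (rule continuous_on_cong) (use eq that in auto)
  ultimately show "AE w in P. continuous_on {0..} (\<lambda>t. Y t w)"
    using AE_space by (auto elim!: eventually_elim2)
qed

lemma continuous_process_exact:
  assumes "\<tau> \<in> trees M"
  shows "continuous_process P (\<phi> \<tau>)"
proof (cases \<tau>)
  case (Empty q)
  have "continuous_process P (\<lambda>_ _. 1)" by (simp add: continuous_process_def)
  then show ?thesis unfolding Empty by (rule continuous_process_cong) (simp add: exact_Empty)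
next
  case (Node q m ts)
  show ?thesis
  proof (cases "ts = {#}")
    case True
    have m: "m \<le> M" using assms Node by (simp add: Node_in_trees_iff)
    show ?thesis unfolding Node True
      by (rule continuous_process_cong[OF continuous_process_W[OF m]]) (simp add: exact_leaf m)
  next
    case False
    from exact_node[OF False, of q m] assms show ?thesis
      unfolding Node by (auto simp: time_integral_def stratonovich_integral_def split: if_splits)
  qed
qed

lemma W_start: "m \<le> M \<Longrightarrow> AE w in P. W m 0 w = 0"
  using wiener[of m] by (cases "m = 0") (auto simp: W_0 wiener_process_def)

text \<open>Removes the case distinctions of \<open>exact_weights\<close>: a time integral is an
  integral against \<open>W 0\<close>, and a one-vertex tree is the integral of the empty
  product.\<close>

lemma exact_stratonovich:
  assumes "Node q m ts \<in> trees M"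
  shows "stratonovich_integral P (\<lambda>t w. \<Prod>\<tau>\<in>#ts. \<phi> \<tau> t w) (W m) (\<phi> (Node q m ts))"
proof (cases "ts = {#}")
  case False
  have "continuous_process P (\<lambda>t w. \<Prod>\<tau>\<in>#ts. \<phi> \<tau> t w)"
    by (rule continuous_process_prod_mset) (use assms continuous_process_exact in \<open>auto simp: Node_in_trees_iff\<close>)
  then show ?thesis
    using exact_node[OF False assms] stratonovich_integral_time by (auto split: if_splits)
next
  case True
  have m: "m \<le> M" using assms by (simp add: Node_in_trees_iff)
  have c: "continuous_process P (\<phi> (Node q m {#}))"
    using continuous_process_exact assms True by blast
  have "prob {w \<in> space P. \<bar>stratonovich_sum (\<lambda>t w. 1) (W m) n t w - \<phi> (Node q m {#}) h w\<bar> > e} < e"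
    if h: "0 \<le> h" and e: "0 < e" and p: "is_partition h n t" for h e n t
  proof -
    \<comment> \<open>For the integrand 1 the sum telescopes for every partition, so any mesh bound
      will do; the discrepancy is the starting value alone.\<close>
    have eq: "stratonovich_sum (\<lambda>t w. 1) (W m) n t w - \<phi> (Node q m {#}) h w = - W m 0 w" if "w \<in> space P" for w
    proof -
      have "stratonovich_sum (\<lambda>t w. 1) (W m) n t w = (\<Sum>k<n. W m (t (Suc k)) w - W m (t k) w)"
        by (simp add: stratonovich_sum_def)
      also have "\<dots> = W m (t n) w - W m (t 0) w" by (rule sum_lessThan_telescope)
      finally show ?thesis using p exact_leaf[OF m h that] by (simp add: is_partition_def)
    qed
    have W0: "W m 0 \<in> borel_measurable P" by (rule W_measurable[OF m]) simp
    have "{w \<in> space P. \<bar>stratonovich_sum (\<lambda>t w. 1) (W m) n t w - \<phi> (Node q m {#}) h w\<bar> > e}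
        = {w \<in> space P. \<bar>W m 0 w\<bar> > e}" using eq by auto
    moreover have "prob {w \<in> space P. \<bar>W m 0 w\<bar> > e} = 0"
    proof (subst prob_Collect_eq_0)
      show "{w \<in> space P. \<bar>W m 0 w\<bar> > e} \<in> events" using W0 by measurable
      show "AE w in P. \<not> \<bar>W m 0 w\<bar> > e" using W_start[OF m] by eventually_elim (use e in simp)
    qed
    ultimately show ?thesis using e by simp
  qed
  then show ?thesis
    using c unfolding True stratonovich_integral_def by (auto intro!: exI[of _ 1])
qed

lemma regular_exact: "\<tau> \<in> trees M \<Longrightarrow> (\<And>q. \<tau> \<noteq> Empty q) \<Longrightarrow> regular (\<phi> \<tau>)"
proof (induction rule: trees.induct)
  case (Node m ts q)
  have "regular (\<lambda>t w. \<Prod>\<tau>\<in>#ts. \<phi> \<tau> t w)" by (rule regular_prod_mset) (use Node in auto)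
  moreover have "Node q m ts \<in> trees M" using Node by (auto simp: Node_in_trees_iff)
  ultimately show ?case
    using regular_stratonovich_integral[OF _ _ exact_stratonovich] Node(1) by blast
next
  case (Empty q)
  then show ?case using Empty.prems[of q] by simp
qed

lemma exact_product:
  assumes 1: "Node q\<^sub>1 m\<^sub>1 ts\<^sub>1 \<in> trees M" and 2: "Node q\<^sub>2 m\<^sub>2 ts\<^sub>2 \<in> trees M" and h: "0 \<le> h" "h \<le> 1"
  shows "AE w in P. \<phi> (Node q\<^sub>1 m\<^sub>1 ts\<^sub>1) h w * \<phi> (Node q\<^sub>2 m\<^sub>2 ts\<^sub>2) h w =
    \<phi> (Node q\<^sub>1 m\<^sub>1 (add_mset (Node q\<^sub>2 m\<^sub>2 ts\<^sub>2) ts\<^sub>1)) h w +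
    \<phi> (Node q\<^sub>2 m\<^sub>2 (add_mset (Node q\<^sub>1 m\<^sub>1 ts\<^sub>1) ts\<^sub>2)) h w"
proof (rule stratonovich_product_rule[OF _ _ exact_stratonovich[OF 1] _ _ exact_stratonovich[OF 2] _ _ h])
  show "regular (\<lambda>t w. \<Prod>\<tau>\<in>#ts\<^sub>1. \<phi> \<tau> t w)" "regular (\<lambda>t w. \<Prod>\<tau>\<in>#ts\<^sub>2. \<phi> \<tau> t w)"
    by (rule regular_prod_mset, rule regular_exact; use 1 2 in \<open>auto simp: Node_in_trees_iff\<close>)+
  show "m\<^sub>1 \<le> M" "m\<^sub>2 \<le> M" using 1 2 by (auto simp: Node_in_trees_iff)
  show "stratonovich_integral P (\<lambda>t w. \<phi> (Node q\<^sub>2 m\<^sub>2 ts\<^sub>2) t w * (\<Prod>\<tau>\<in>#ts\<^sub>1. \<phi> \<tau> t w)) (W m\<^sub>1)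
      (\<phi> (Node q\<^sub>1 m\<^sub>1 (add_mset (Node q\<^sub>2 m\<^sub>2 ts\<^sub>2) ts\<^sub>1)))"
    using exact_stratonovich[of q\<^sub>1 m\<^sub>1 "add_mset (Node q\<^sub>2 m\<^sub>2 ts\<^sub>2) ts\<^sub>1"] 1 2
    by (auto simp: Node_in_trees_iff)
  show "stratonovich_integral P (\<lambda>t w. \<phi> (Node q\<^sub>1 m\<^sub>1 ts\<^sub>1) t w * (\<Prod>\<tau>\<in>#ts\<^sub>2. \<phi> \<tau> t w)) (W m\<^sub>2)
      (\<phi> (Node q\<^sub>2 m\<^sub>2 (add_mset (Node q\<^sub>1 m\<^sub>1 ts\<^sub>1) ts\<^sub>2)))"
    using exact_stratonovich[of q\<^sub>2 m\<^sub>2 "add_mset (Node q\<^sub>1 m\<^sub>1 ts\<^sub>1) ts\<^sub>2"] 1 2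
    by (auto simp: Node_in_trees_iff)
qed

text \<open>The weight vanishes at time 0, so its size is that of its increment over [0, h]. The
  order of the tree is not reflected, since a positive power of \<open>h\<close> is all that the
  multiplication of errors requires.\<close>

lemma exact_mbound:
  assumes \<tau>: "\<tau> \<in> trees M" "\<And>q. \<tau> \<noteq> Empty q"
  shows "\<exists>c. \<forall>h. 0 \<le> h \<and> h \<le> 1 \<longrightarrow> mbound c (\<phi> \<tau> h) h"
proof -
  obtain c d where R: "regular_with c d (\<phi> \<tau>)" using regular_exact[OF \<tau>] unfolding regular_def by blast
  obtain q m ts where Node: "\<tau> = Node q m ts" using \<tau>(2) by (cases \<tau>) auto
  have "mbound d (\<phi> \<tau> h) h" if h: "0 \<le> h" "h \<le> 1" for h
  proof (rule mbound_cong_AE)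
    show "mbound d (\<lambda>w. \<phi> \<tau> h w - \<phi> \<tau> 0 w) h" using regular_withD(3)[OF R, of 0 h] h by simp
    show "AE w in P. \<phi> \<tau> h w - \<phi> \<tau> 0 w = \<phi> \<tau> h w"
      using stratonovich_integral_0[OF exact_stratonovich[of q m ts]] \<tau>(1) unfolding Node
      by (auto elim: eventually_mono)
  qed (rule regular_withD(4)[OF R h])
  then show ?thesis by blast
qed

end

context prob_space
begin

subsection \<open>Orders of random variables\<close>

lemma L2_bigo_iff:
  "L2_bigo M X r \<longleftrightarrow> (\<exists>C. \<forall>\<^sub>F h in at_right 0. moment_le 1 (X h) (C * (h powr r)\<^sup>2))"
proof
  assume X: "L2_bigo M X r"
  then obtain C where "\<forall>\<^sub>F h in at_right 0. norm (sqrt (expectation (\<lambda>w. (X h w)\<^sup>2))) \<le> C * norm (h powr r)"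
    unfolding L2_bigo_def by (auto elim: landau_o.bigE)
  moreover have "\<forall>\<^sub>F h in at_right 0. X h \<in> borel_measurable M \<and> integrable M (\<lambda>w. (X h w)\<^sup>2)"
    using X by (simp add: L2_bigo_def)
  ultimately have "\<forall>\<^sub>F h in at_right 0. moment_le 1 (X h) (C\<^sup>2 * (h powr r)\<^sup>2)"
  proof eventually_elim
    case (elim h)
    have E: "0 \<le> expectation (\<lambda>w. (X h w)\<^sup>2)" by (rule Bochner_Integration.integral_nonneg) simp
    then have "sqrt (expectation (\<lambda>w. (X h w)\<^sup>2)) \<le> C * h powr r" using elim by simp
    from power_mono[OF this, of 2] E elim show ?case by (simp add: power_mult_distrib moment_le_def)
  qed
  then show "\<exists>C. \<forall>\<^sub>F h in at_right 0. moment_le 1 (X h) (C * (h powr r)\<^sup>2)" by blast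
next
  assume "\<exists>C. \<forall>\<^sub>F h in at_right 0. moment_le 1 (X h) (C * (h powr r)\<^sup>2)"
  then obtain C where C: "\<forall>\<^sub>F h in at_right 0. moment_le 1 (X h) (C * (h powr r)\<^sup>2)" by blast
  have "(\<lambda>h. sqrt (expectation (\<lambda>w. (X h w)\<^sup>2))) \<in> O[at_right 0](\<lambda>h. h powr r)"
  proof (rule bigoI)
    show "\<forall>\<^sub>F h in at_right 0. norm (sqrt (expectation (\<lambda>w. (X h w)\<^sup>2))) \<le> sqrt C * norm (h powr r)"
      using C
    proof eventually_elim
      case (elim h)
      have "sqrt (expectation (\<lambda>w. (X h w)\<^sup>2)) \<le> sqrt (C * (h powr r)\<^sup>2)" using moment_leD(3)[OF elim] by simp
      then show ?case by (simp add: real_sqrt_mult)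
    qed
  qed
  moreover have "\<forall>\<^sub>F h in at_right 0. X h \<in> borel_measurable M \<and> integrable M (\<lambda>w. (X h w)\<^sup>2)"
    using C by eventually_elim (simp add: moment_le_def)
  ultimately show "L2_bigo M X r" by (simp add: L2_bigo_def)
qed

lemma L2_bigoE:
  assumes "L2_bigo M X r"
  obtains C where "\<forall>\<^sub>F h in at_right 0. moment_le 1 (X h) (C * (h powr r)\<^sup>2)"
  using assms unfolding L2_bigo_iff by (elim exE) (rule that)

lemma L2_bigo_add:
  assumes "L2_bigo M X r" "L2_bigo M Y r"
  shows "L2_bigo M (\<lambda>h w. X h w + Y h w) r"
proof -
  obtain C where C: "\<forall>\<^sub>F h in at_right 0. moment_le 1 (X h) (C * (h powr r)\<^sup>2)" using L2_bigoE[OF assms(1)] .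
  obtain D where D: "\<forall>\<^sub>F h in at_right 0. moment_le 1 (Y h) (D * (h powr r)\<^sup>2)" using L2_bigoE[OF assms(2)] .
  have "\<forall>\<^sub>F h in at_right 0. moment_le 1 (\<lambda>w. X h w + Y h w) ((4 * (C + D)) * (h powr r)\<^sup>2)"
    using C D by eventually_elim (drule (1) moment_le_add, simp add: algebra_simps)
  then show ?thesis unfolding L2_bigo_iff by (rule exI)
qed

lemma L2_bigo_diff:
  assumes "L2_bigo M X r" "L2_bigo M Y r"
  shows "L2_bigo M (\<lambda>h w. X h w - Y h w) r"
proof -
  have "L2_bigo M (\<lambda>h w. - Y h w) r" using assms(2) unfolding L2_bigo_def by simp
  from L2_bigo_add[OF assms(1) this] show ?thesis by simp
qed

lemma L2_bigo_cong_AE: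
  assumes X: "L2_bigo M X r"
    and eq: "\<forall>\<^sub>F h in at_right 0. Y h \<in> borel_measurable M \<and> (AE w in M. X h w = Y h w)"
  shows "L2_bigo M Y r"
proof -
  obtain C where C: "\<forall>\<^sub>F h in at_right 0. moment_le 1 (X h) (C * (h powr r)\<^sup>2)" using L2_bigoE[OF X] .
  have "\<forall>\<^sub>F h in at_right 0. moment_le 1 (Y h) (C * (h powr r)\<^sup>2)"
    using C eq by eventually_elim (blast intro: moment_le_cong_AE)
  then show ?thesis unfolding L2_bigo_iff by (rule exI)
qed

lemma moment_le_1_integrable:
  assumes "moment_le 1 X C"
  shows "integrable M X" "\<bar>expectation X\<bar> \<le> sqrt C"
proof -
  have i: "integrable M (\<lambda>w. (X w)\<^sup>2)" "expectation (\<lambda>w. (X w)\<^sup>2) \<le> C" using assms by (simp_all add: moment_le_def)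
  note CS = expectation_Cauchy_Schwarz[of "\<lambda>_. 1" X, OF _ moment_leD(1)[OF assms] _ i(1)]
  show "integrable M X" using CS(1) by simp
  have "(expectation (\<lambda>w. \<bar>X w\<bar>))\<^sup>2 \<le> C" using CS(2) i(2) by (simp add: prob_space)
  then have "expectation (\<lambda>w. \<bar>X w\<bar>) \<le> sqrt C" by (rule real_le_rsqrt)
  then show "\<bar>expectation X\<bar> \<le> sqrt C" by (rule order_trans[OF integral_abs_bound])
qed

lemma L2_bigo_expectation:
  assumes "L2_bigo M X r"
  shows "(\<lambda>h. expectation (X h)) \<in> O[at_right 0](\<lambda>h. h powr r)"
proof -
  obtain C where C: "\<forall>\<^sub>F h in at_right 0. moment_le 1 (X h) (C * (h powr r)\<^sup>2)" using L2_bigoE[OF assms] .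
  show ?thesis
  proof (rule bigoI)
    show "\<forall>\<^sub>F h in at_right 0. norm (expectation (X h)) \<le> sqrt C * norm (h powr r)"
      using C by eventually_elim (drule moment_le_1_integrable(2), simp add: real_sqrt_mult)
  qed
qed

text \<open>O(sqrt h) in every L^(2k): 1/2 is the least order of a nonempty tree, so the weights of
  both solutions qualify.\<close>

definition small_moments :: "(real \<Rightarrow> 'a \<Rightarrow> real) \<Rightarrow> bool" where
  "small_moments X \<longleftrightarrow> (\<forall>k>0. \<exists>C. \<forall>\<^sub>F h in at_right 0. moment_le k (X h) (C * h ^ k))"

lemma small_momentsE:
  assumes "small_moments X" "k > 0"
  obtains C where "\<forall>\<^sub>F h in at_right 0. moment_le k (X h) (C * h ^ k)"
proof -
  from assms(1)[unfolded small_moments_def, rule_format, OF assms(2)] show thesis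
    by (elim exE) (rule that)
qed

lemma small_moments_diff:
  assumes X: "small_moments X" and Y: "small_moments Y"
  shows "small_moments (\<lambda>h w. X h w - Y h w)"
  unfolding small_moments_def
proof (intro allI impI)
  fix k :: nat assume k: "k > 0"
  obtain C where C: "\<forall>\<^sub>F h in at_right 0. moment_le k (X h) (C * h ^ k)" using small_momentsE[OF X k] .
  obtain D where D: "\<forall>\<^sub>F h in at_right 0. moment_le k (Y h) (D * h ^ k)" using small_momentsE[OF Y k] .
  have "\<forall>\<^sub>F h in at_right 0. moment_le k (\<lambda>w. X h w - Y h w) ((4 ^ k * (C + D)) * h ^ k)"
    using C D by eventually_elim (drule (1) moment_le_diff, simp add: algebra_simps)
  then show "\<exists>C. \<forall>\<^sub>F h in at_right 0. moment_le k (\<lambda>w. X h w - Y h w) (C * h ^ k)" by (rule exI)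
qed

lemma at_right_0_eventually_less_1: "\<forall>\<^sub>F h in at_right (0 :: real). 0 < h \<and> h < 1"
  by (rule eventually_at_rightI[of 0 1]) auto

text \<open>
  An $L^2$ bound alone does not survive multiplication, but the factor \<open>Y\<close> may be replaced by
  \<open>1 + \<bar>Y\<bar>\<^sup>N\<close>, where \<open>Y\<^sup>N\<close> is small enough for a crude bound on the fourth moment of \<open>D\<close> to suffice.
\<close>

lemma L2_bigo_mult:
  assumes D: "L2_bigo M D r" and mD: "small_moments D" and mY: "small_moments Y"
  shows "L2_bigo M (\<lambda>h w. D h w * Y h w) r"
proof -
  obtain n :: nat where n: "2 * r \<le> real n" using real_arch_simple by blast
  \<comment> \<open>\<open>N\<close> is positive and at least \<open>2 * r\<close>, so that
    \<open>h ^ N\<close> is at most h^(2r), the square of the required rate.\<close>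
  define N where "N = Suc n"
  have N: "2 * r \<le> real N" "0 < N" "0 < 2 * N" using n by (auto simp: N_def)
  obtain C where C: "\<forall>\<^sub>F h in at_right 0. moment_le 1 (D h) (C * (h powr r)\<^sup>2)" using L2_bigoE[OF D] .
  obtain A where A: "\<forall>\<^sub>F h in at_right 0. moment_le 2 (D h) (A * h ^ 2)"
    using small_momentsE[OF mD, of 2] by auto
  obtain B where B: "\<forall>\<^sub>F h in at_right 0. moment_le (2 * N) (Y h) (B * h ^ (2 * N))"
    using small_momentsE[OF mY N(3)] .
  have "\<forall>\<^sub>F h in at_right 0. moment_le 1 (\<lambda>w. D h w * Y h w) ((C + sqrt (A * B)) * (h powr r)\<^sup>2)"
    using C A B at_right_0_eventually_less_1
  proof eventually_elim
    case (elim h)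
    have h: "0 < h" "h < 1" using elim by auto
    note DC = elim(1)
    \<comment> \<open>Boundedness of the fourth moment of \<open>D\<close> is enough, since all the
      smallness is supplied by the power of \<open>Y\<close>.\<close>
    have DA: "moment_le 2 (D h) A"
      by (rule moment_le_mono[OF elim(2)])
        (use moment_leD(4)[OF elim(2)] h in \<open>auto simp: zero_le_mult_iff power_le_one intro!: mult_left_le\<close>)
    have YB: "moment_le 2 (\<lambda>w. Y h w ^ N) (B * h ^ (2 * N))"
    proof -
      have "(\<lambda>w. Y h w ^ N) \<in> borel_measurable M"
        using moment_leD(1)[OF elim(3)] by (rule borel_measurable_power)
      then show ?thesis
        using elim(3) unfolding moment_le_def by (simp add: mult.commute flip: power_mult)
    qed
    have "0 < h ^ (2 * N)" using h by simp
    then have B0: "0 \<le> B" using moment_leD(4)[OF elim(3)] by (auto simp: zero_le_mult_iff)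
    have "h ^ N \<le> (h powr r)\<^sup>2"
    proof -
      have "h ^ N = h powr real N" using h by (simp add: powr_realpow)
      also have "\<dots> \<le> h powr (2 * r)" using h N by (intro powr_mono') auto
      also have "\<dots> = (h powr r)\<^sup>2" by (simp add: power2_eq_square flip: powr_add)
      finally show ?thesis .
    qed
    then have le: "sqrt (A * B) * h ^ N \<le> sqrt (A * B) * (h powr r)\<^sup>2"
      using moment_leD(4)[OF DA] B0 by (intro mult_left_mono) auto
    have "sqrt (A * (B * h ^ (2 * N))) = sqrt (A * B) * h ^ N"
      using h by (simp add: real_sqrt_mult power_even_eq)
    then have "sqrt (A * (B * h ^ (2 * N))) \<le> sqrt (A * B) * (h powr r)\<^sup>2" using le by simp
    moreover have "moment_le 1 (\<lambda>w. D h w * Y h w ^ N) (sqrt (A * (B * h ^ (2 * N))))"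
      by (rule moment_le_mult) (use DA YB in simp_all)
    ultimately have DY: "moment_le 1 (\<lambda>w. D h w * Y h w ^ N) (sqrt (A * B) * (h powr r)\<^sup>2)"
      by (rule moment_le_mono[rotated])
    \<comment> \<open>The summand without \<open>Y\<close> keeps the rate assumed for
      \<open>D\<close>; where |Y| exceeds 1, the power \<open>N\<close> dominates.\<close>
    have le: "(D h w * Y h w)\<^sup>2 \<le> (D h w)\<^sup>2 + (D h w * Y h w ^ N)\<^sup>2" for w
    proof -
      have "(Y h w)\<^sup>2 \<le> 1 + (Y h w ^ N)\<^sup>2"
      proof (cases "\<bar>Y h w\<bar> \<le> 1")
        case True
        then have "(Y h w)\<^sup>2 \<le> 1" by (simp add: abs_square_le_1)
        moreover have "0 \<le> (Y h w ^ N)\<^sup>2" by simp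
        ultimately show ?thesis by linarith
      next
        case False
        then have "\<bar>Y h w\<bar> ^ 2 \<le> \<bar>Y h w\<bar> ^ (2 * N)" using N by (intro power_increasing) auto
        then show ?thesis by (simp add: power_even_eq flip: power_abs)
      qed
      then have "(D h w)\<^sup>2 * (Y h w)\<^sup>2 \<le> (D h w)\<^sup>2 * (1 + (Y h w ^ N)\<^sup>2)"
        by (rule mult_left_mono) simp
      then show ?thesis by (simp add: power_mult_distrib algebra_simps)
    qed
    have int: "integrable M (\<lambda>w. (D h w)\<^sup>2 + (D h w * Y h w ^ N)\<^sup>2)"
      using moment_leD(2)[OF DC] moment_leD(2)[OF DY] by simp
    have "Y h \<in> borel_measurable M" using elim(3) by (rule moment_leD(1))
    then have m: "(\<lambda>w. D h w * Y h w) \<in> borel_measurable M"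
      by (intro borel_measurable_times moment_leD(1)[OF DC])
    have i: "integrable M (\<lambda>w. (D h w * Y h w)\<^sup>2)"
      by (rule Bochner_Integration.integrable_bound[OF int])
        (use m le in \<open>auto intro!: AE_I2 simp del: power_mult_distrib\<close>)
    have "expectation (\<lambda>w. (D h w * Y h w)\<^sup>2) \<le> expectation (\<lambda>w. (D h w)\<^sup>2 + (D h w * Y h w ^ N)\<^sup>2)"
      by (rule integral_mono[OF i int le])
    also have "\<dots> = expectation (\<lambda>w. (D h w)\<^sup>2) + expectation (\<lambda>w. (D h w * Y h w ^ N)\<^sup>2)"
      using moment_leD(2)[OF DC] moment_leD(2)[OF DY] by simp
    also have "\<dots> \<le> C * (h powr r)\<^sup>2 + sqrt (A * B) * (h powr r)\<^sup>2"
      using moment_leD(3)[OF DC] moment_leD(3)[OF DY] by simp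
    finally show ?case using m i by (simp add: moment_le_def distrib_right)
  qed
  then show ?thesis unfolding L2_bigo_iff by (rule exI)
qed

lemma small_moments_integrable:
  assumes "small_moments X"
  shows "\<forall>\<^sub>F h in at_right 0. integrable M (X h)"
proof -
  obtain C where "\<forall>\<^sub>F h in at_right 0. moment_le 1 (X h) (C * h ^ 1)"
    using small_momentsE[OF assms zero_less_one] .
  then show ?thesis by eventually_elim (rule moment_le_1_integrable)
qed

end

lemma (in exact_solution) small_moments_exact:
  assumes "\<tau> \<in> trees M" "\<And>q. \<tau> \<noteq> Empty q"
  shows "small_moments (\<phi> \<tau>)"
  unfolding small_moments_def
proof (intro allI impI)
  fix k :: nat assume k: "k > 0"
  obtain c where c: "\<And>h. 0 \<le> h \<Longrightarrow> h \<le> 1 \<Longrightarrow> mbound c (\<phi> \<tau> h) h" using exact_mbound[OF assms] by blast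
  have "\<forall>\<^sub>F h in at_right 0. moment_le k (\<phi> \<tau> h) (c k * h ^ k)"
    using at_right_0_eventually_less_1
    by eventually_elim (rule mboundD(5)[OF c k], auto)
  then show "\<exists>C. \<forall>\<^sub>F h in at_right 0. moment_le k (\<phi> \<tau> h) (C * h ^ k)" by (rule exI)
qed

text \<open>The moment condition for products, applied to \<open>2 * k\<close> copies of the same
  tree, is a bound on a single even moment; order at least 1/2 turns it into the rate
  \<open>h ^ k\<close>.\<close>

lemma (in prob_space) small_moments_numerical:
  assumes mc: "moment_condition M K s Z \<gamma>" and \<tau>: "\<tau> \<in> trees K" "order_tree \<tau> \<ge> 1 / 2"
  shows "small_moments (numerical_weight s Z \<gamma> \<tau>)"
  unfolding small_moments_def
proof (intro allI impI)
  let ?\<Phi> = "numerical_weight s Z \<gamma> \<tau>"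
  fix k :: nat assume k: "k > 0"
  have pl: "(\<Prod>\<tau>'\<leftarrow>replicate (2 * k) \<tau>. numerical_weight s Z \<gamma> \<tau>' h w) = ?\<Phi> h w ^ (2 * k)" for h w
    by (simp add: prod_list_replicate)
  have sl: "(\<Sum>\<tau>'\<leftarrow>replicate (2 * k) \<tau>. order_tree \<tau>') = 2 * real k * order_tree \<tau>"
    by (simp add: sum_list_replicate)
  have "set (replicate (2 * k) \<tau>) \<subseteq> trees K" using \<tau> by auto
  then have i: "\<forall>\<^sub>F h in at_right 0. integrable M (\<lambda>w. ?\<Phi> h w ^ (2 * k))"
    and O: "(\<lambda>h. expectation (\<lambda>w. ?\<Phi> h w ^ (2 * k))) \<in> O[at_right 0](\<lambda>h. h powr (2 * real k * order_tree \<tau>))"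
    using mc unfolding moment_condition_def pl[symmetric] sl[symmetric] by blast+
  from O obtain C where C: "C > 0"
    "\<forall>\<^sub>F h in at_right 0. norm (expectation (\<lambda>w. ?\<Phi> h w ^ (2 * k))) \<le> C * norm (h powr (2 * real k * order_tree \<tau>))"
    by (rule landau_o.bigE)
  have m: "\<forall>\<^sub>F h in at_right 0. ?\<Phi> h \<in> borel_measurable M"
    using mc \<tau>(1) unfolding moment_condition_def L2_bigo_def by (auto elim: eventually_mono)
  have "\<forall>\<^sub>F h in at_right 0. moment_le k (?\<Phi> h) (C * h ^ k)"
    using i m C(2) at_right_0_eventually_less_1
  proof eventually_elim
    case (elim h)
    have "k \<le> 2 * real k * order_tree \<tau>" using \<tau>(2) mult_left_mono[OF \<tau>(2), of "2 * real k"] by simp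
    then have "h powr (2 * real k * order_tree \<tau>) \<le> h powr real k" using elim by (intro powr_mono') auto
    also have "\<dots> = h ^ k" using elim by (simp add: powr_realpow)
    finally have "C * h powr (2 * real k * order_tree \<tau>) \<le> C * h ^ k" using C(1) by simp
    then show ?case using elim by (simp add: moment_le_def)
  qed
  then show "\<exists>C. \<forall>\<^sub>F h in at_right 0. moment_le k (?\<Phi> h) (C * h ^ k)" by (rule exI)
qed

subsection \<open>Exchange of the root\<close>

lemma (in exact_solution) match_exchange:
  fixes s :: nat and Z :: "'w Z_coeffs" and \<gamma> :: "'w \<gamma>_coeffs"
  defines "\<Phi> \<equiv> numerical_weight s Z \<gamma>"
  assumes mc: "moment_condition P M s Z \<gamma>"
    and cond: "\<forall>i\<in>{1..s}. \<forall>j\<in>{1..s}. \<forall>m\<^sub>1\<le>M. \<forall>m\<^sub>2\<le>M. \<forall>h>0. AE w in P.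
      \<gamma> Shape1 m\<^sub>1 i h w * \<gamma> Shape2 m\<^sub>2 j h w =
      \<gamma> Shape2 m\<^sub>2 j h w * Z Shape1 m\<^sub>1 j i h w + \<gamma> Shape1 m\<^sub>1 i h w * Z Shape2 m\<^sub>2 i j h w"
    and T12: "Node q\<^sub>1 m\<^sub>1 (add_mset (Node q\<^sub>2 m\<^sub>2 ts\<^sub>2) ts\<^sub>1) \<in> TS M" (is "?\<tau>12 \<in> _")
    and T21: "Node q\<^sub>2 m\<^sub>2 (add_mset (Node q\<^sub>1 m\<^sub>1 ts\<^sub>1) ts\<^sub>2) \<in> TS M" (is "?\<tau>21 \<in> _")
    and s1: "strong_match P \<phi> \<Phi> r (Node q\<^sub>1 m\<^sub>1 ts\<^sub>1)" (is "strong_match _ _ _ _ ?\<tau>1")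
    and s2: "strong_match P \<phi> \<Phi> r (Node q\<^sub>2 m\<^sub>2 ts\<^sub>2)" (is "strong_match _ _ _ _ ?\<tau>2")
  shows "strong_match P \<phi> \<Phi> r ?\<tau>12 \<Longrightarrow> strong_match P \<phi> \<Phi> r ?\<tau>21"
    and "weak_match P \<phi> \<Phi> r ?\<tau>12 \<Longrightarrow> weak_match P \<phi> \<Phi> r ?\<tau>21"
proof -
  have TS: "?\<tau>1 \<in> TS M" "?\<tau>2 \<in> TS M" using T12 T21 by (auto simp: Node_in_TS_iff)
  have tr: "?\<tau>1 \<in> trees M" "?\<tau>2 \<in> trees M" "?\<tau>12 \<in> trees M" "?\<tau>21 \<in> trees M"
    using TS T12 T21 TS_subset_trees by blast+
  have sm\<phi>: "small_moments (\<phi> ?\<tau>1)" "small_moments (\<phi> ?\<tau>2)" "small_moments (\<phi> ?\<tau>12)" "small_moments (\<phi> ?\<tau>21)"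
    by (rule small_moments_exact; use tr in simp)+
  have sm\<Phi>: "small_moments (\<Phi> ?\<tau>1)" "small_moments (\<Phi> ?\<tau>2)" "small_moments (\<Phi> ?\<tau>12)" "small_moments (\<Phi> ?\<tau>21)"
    unfolding \<Phi>_def by (rule small_moments_numerical[OF mc _ order_tree_Node_ge]; use tr in simp)+
  define U where "U h w = \<phi> ?\<tau>1 h w * \<phi> ?\<tau>2 h w - \<Phi> ?\<tau>1 h w * \<Phi> ?\<tau>2 h w" for h w
  have U: "L2_bigo P U r"
  proof -
    \<comment> \<open>The difference of the two products is split so that each lower-order error is
      multiplied by one weight; errors and weights alike have small moments, as
      \<open>L2_bigo_mult\<close> demands.\<close>
    have "L2_bigo P (\<lambda>h w. (\<phi> ?\<tau>1 h w - \<Phi> ?\<tau>1 h w) * \<phi> ?\<tau>2 h w + (\<phi> ?\<tau>2 h w - \<Phi> ?\<tau>2 h w) * \<Phi> ?\<tau>1 h w) r"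
      using s1 s2 unfolding strong_match_def
      by (intro L2_bigo_add L2_bigo_mult small_moments_diff sm\<phi> sm\<Phi>)
    moreover have "(\<phi> ?\<tau>1 h w - \<Phi> ?\<tau>1 h w) * \<phi> ?\<tau>2 h w + (\<phi> ?\<tau>2 h w - \<Phi> ?\<tau>2 h w) * \<Phi> ?\<tau>1 h w = U h w" for h w
      by (simp add: U_def algebra_simps)
    ultimately show ?thesis by (simp only:)
  qed
  \<comment> \<open>Adjacent nodes of a tree in \<open>TS M\<close> have different shapes; this is
    what puts every edge under the condition, which couples the two partitions.\<close>
  have mM: "m\<^sub>1 \<le> M" "m\<^sub>2 \<le> M" and q: "q\<^sub>1 \<noteq> q\<^sub>2" using T12 T21 by (auto simp: Node_in_TS_iff)
  have num: "AE w in P. \<Phi> ?\<tau>1 h w * \<Phi> ?\<tau>2 h w = \<Phi> ?\<tau>12 h w + \<Phi> ?\<tau>21 h w" if h: "0 < h" for h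
  proof -
    have "AE w in P. \<gamma> q\<^sub>1 m\<^sub>1 i h w * \<gamma> q\<^sub>2 m\<^sub>2 j h w =
      \<gamma> q\<^sub>2 m\<^sub>2 j h w * Z q\<^sub>1 m\<^sub>1 j i h w + \<gamma> q\<^sub>1 m\<^sub>1 i h w * Z q\<^sub>2 m\<^sub>2 i j h w"
      if ij: "i \<in> {1..s}" "j \<in> {1..s}" for i j
    proof (cases q\<^sub>1)
      case Shape1
      then have "q\<^sub>2 = Shape2" using q by (cases q\<^sub>2) auto
      then show ?thesis using cond mM ij h Shape1 by blast
    next
      case Shape2
      \<comment> \<open>The condition names shape 1 first; for roots in the other order it is
        applied with stages and colors exchanged.\<close>
      then have q2: "q\<^sub>2 = Shape1" using q by (cases q\<^sub>2) auto
      have "AE w in P. \<gamma> Shape1 m\<^sub>2 j h w * \<gamma> Shape2 m\<^sub>1 i h w =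
        \<gamma> Shape2 m\<^sub>1 i h w * Z Shape1 m\<^sub>2 i j h w + \<gamma> Shape1 m\<^sub>2 j h w * Z Shape2 m\<^sub>1 j i h w"
        using cond mM ij h by blast
      then show ?thesis unfolding q2 Shape2 by eventually_elim (simp add: mult.commute)
    qed
    then have "AE w in P. \<forall>i\<in>{1..s}. \<forall>j\<in>{1..s}. \<gamma> q\<^sub>1 m\<^sub>1 i h w * \<gamma> q\<^sub>2 m\<^sub>2 j h w =
      \<gamma> q\<^sub>2 m\<^sub>2 j h w * Z q\<^sub>1 m\<^sub>1 j i h w + \<gamma> q\<^sub>1 m\<^sub>1 i h w * Z q\<^sub>2 m\<^sub>2 i j h w"
      by (intro AE_finite_allI) auto
    then show ?thesis
      unfolding \<Phi>_def by eventually_elim (rule numerical_weight_product, blast)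
  qed
  define D12 where "D12 h w = \<phi> ?\<tau>12 h w - \<Phi> ?\<tau>12 h w" for h w
  define D21 where "D21 h w = \<phi> ?\<tau>21 h w - \<Phi> ?\<tau>21 h w" for h w
  have eq: "AE w in P. U h w - D12 h w = D21 h w" if "0 < h \<and> h < 1" for h
    using exact_product[OF tr(1,2), of h] num[of h] that
    by (auto simp: U_def D12_def D21_def elim!: eventually_elim2)
  have int: "\<forall>\<^sub>F h in at_right 0. integrable P (D12 h) \<and> integrable P (D21 h)"
    using small_moments_integrable[OF sm\<phi>(3)] small_moments_integrable[OF sm\<phi>(4)]
      small_moments_integrable[OF sm\<Phi>(3)] small_moments_integrable[OF sm\<Phi>(4)]
    unfolding D12_def[abs_def] D21_def[abs_def] by eventually_elim simp
  show "strong_match P \<phi> \<Phi> r ?\<tau>21" if "strong_match P \<phi> \<Phi> r ?\<tau>12"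
  proof -
    have D12: "L2_bigo P D12 r" using that by (simp add: strong_match_def D12_def[abs_def])
    have "L2_bigo P D21 r"
    proof (rule L2_bigo_cong_AE[OF L2_bigo_diff[OF U D12]])
      show "\<forall>\<^sub>F h in at_right 0. D21 h \<in> borel_measurable P \<and> (AE w in P. U h w - D12 h w = D21 h w)"
        using int at_right_0_eventually_less_1 by eventually_elim (use eq in auto)
    qed
    then show ?thesis by (simp add: strong_match_def D21_def[abs_def])
  qed
  show "weak_match P \<phi> \<Phi> r ?\<tau>21" if "weak_match P \<phi> \<Phi> r ?\<tau>12"
  proof -
    \<comment> \<open>Linearity of the Bochner integral needs integrability of both weights,
      supplied by their small moments; without it the two expectations could be default
      values.\<close>
    have w: "weak_match P \<phi> \<Phi> r \<tau> \<longleftrightarrow> (\<lambda>h. expectation (\<lambda>w. \<phi> \<tau> h w - \<Phi> \<tau> h w)) \<in> O[at_right 0](\<lambda>h. h powr r)"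
      if "small_moments (\<phi> \<tau>)" "small_moments (\<Phi> \<tau>)" for \<tau>
      unfolding weak_match_def
    proof (rule landau_o.big.in_cong)
      show "\<forall>\<^sub>F h in at_right 0. expectation (\<phi> \<tau> h) - expectation (\<Phi> \<tau> h) = expectation (\<lambda>w. \<phi> \<tau> h w - \<Phi> \<tau> h w)"
        using small_moments_integrable[OF that(1)] small_moments_integrable[OF that(2)]
        by eventually_elim simp
    qed
    have "(\<lambda>h. expectation (D12 h)) \<in> O[at_right 0](\<lambda>h. h powr r)"
      using that w[OF sm\<phi>(3) sm\<Phi>(3)] by (simp add: D12_def[abs_def])
    \<comment> \<open>Strong matches at lower order are used here: matching expectations of the
      factors would not control the expectation of their product.\<close>
    with L2_bigo_expectation[OF U]
    have mem: "(\<lambda>h. expectation (U h) - expectation (D12 h)) \<in> O[at_right 0](\<lambda>h. h powr r)"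
      by (rule sum_in_bigo(2))
    have ev: "\<forall>\<^sub>F h in at_right 0. expectation (U h) - expectation (D12 h) = expectation (D21 h)"
      using int at_right_0_eventually_less_1 U[unfolded L2_bigo_def, THEN conjunct1]
    proof eventually_elim
      case (elim h)
      have Ui: "integrable P (U h)" using elim expectation_Cauchy_Schwarz(1)[of "\<lambda>_. 1" "U h"] by simp
      have "expectation (U h) - expectation (D12 h) = expectation (\<lambda>w. U h w - D12 h w)"
        using Ui elim by simp
      also have "\<dots> = expectation (D21 h)"
        by (rule integral_cong_AE) (use Ui elim eq in auto)
      finally show ?case .
    qed
    have "(\<lambda>h. expectation (D21 h)) \<in> O[at_right 0](\<lambda>h. h powr r)"
      by (rule iffD1[OF landau_o.big.in_cong[OF ev] mem])
    then show ?thesis using w[OF sm\<phi>(4) sm\<Phi>(4)] by (simp add: D21_def[abs_def])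
  qed
qed

theorem theorem5:
  fixes P :: "'w measure" and M s :: nat
    and W :: "nat \<Rightarrow> real \<Rightarrow> 'w \<Rightarrow> real"
    and \<phi> :: "tree \<Rightarrow> real \<Rightarrow> 'w \<Rightarrow> real"
    and Z :: "'w Z_coeffs" and \<gamma> :: "'w \<gamma>_coeffs"
    and p :: real
    and G :: "'v labelled_graph"
  assumes "prob_space P"
    and "driving_processes P M W"
    and "exact_weights P M W \<phi>"
    and "method_coefficients P M s Z \<gamma>"
    and "moment_condition P M s Z \<gamma>"
    and "\<forall>i\<in>{1..s}. \<forall>j\<in>{1..s}. \<forall>m\<^sub>1\<le>M. \<forall>m\<^sub>2\<le>M. \<forall>h>0. AE \<omega> in P.
      \<gamma> Shape1 m\<^sub>1 i h \<omega> * \<gamma> Shape2 m\<^sub>2 j h \<omega> =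
      \<gamma> Shape2 m\<^sub>2 j h \<omega> * Z Shape1 m\<^sub>1 j i h \<omega> + \<gamma> Shape1 m\<^sub>1 i h \<omega> * Z Shape2 m\<^sub>2 i j h \<omega>"
    and "p > 0" and "2 * p \<in> \<nat>"
    and "unrooted_tree G" and "TS_hat M G \<noteq> {}"
    and "order_unrooted G \<le> p"
  shows
    "((\<exists>\<tau>\<in>TS_hat M G. strong_match P \<phi> (numerical_weight s Z \<gamma>) (p + 1 / 2) \<tau>) \<and>
      (\<forall>\<tau>\<in>TS M. order_tree \<tau> < order_unrooted G \<longrightarrow> strong_match P \<phi> (numerical_weight s Z \<gamma>) (p + 1 / 2) \<tau>)
      \<longrightarrow> (\<forall>\<tau>\<in>TS_hat M G. strong_match P \<phi> (numerical_weight s Z \<gamma>) (p + 1 / 2) \<tau>)) \<and>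
     ((\<exists>\<tau>\<in>TS_hat M G. weak_match P \<phi> (numerical_weight s Z \<gamma>) (p + 1 / 2) \<tau>) \<and>
      (\<forall>\<tau>\<in>TS M. order_tree \<tau> < order_unrooted G \<longrightarrow> strong_match P \<phi> (numerical_weight s Z \<gamma>) (p + 1 / 2) \<tau>)
      \<longrightarrow> (\<forall>\<tau>\<in>TS_hat M G. weak_match P \<phi> (numerical_weight s Z \<gamma>) (p + 1 / 2) \<tau>))"
proof -
  let ?\<Phi> = "numerical_weight s Z \<gamma>"
  interpret exact_solution P M W \<phi>
    by (intro exact_solution.intro driven_space.intro driven_space_axioms.intro
        exact_solution_axioms.intro assms(1-3))
  note exchange = match_exchange[OF assms(5,6)]
  let ?strong = "strong_match P \<phi> ?\<Phi> (p + 1 / 2)" and ?weak = "weak_match P \<phi> ?\<Phi> (p + 1 / 2)"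
  \<comment> \<open>\<open>Q\<close> is left open so that the same walk serves strong and weak
    matching; the trees of lower order match strongly in either case.\<close>
  have walk: "\<forall>\<tau>\<in>TS_hat M G. Q \<tau>"
    if ex: "\<exists>\<tau>\<in>TS_hat M G. Q \<tau>" and low: "\<forall>\<tau>\<in>TS M. order_tree \<tau> < order_unrooted G \<longrightarrow> ?strong \<tau>"
      and step: "\<And>q\<^sub>1 m\<^sub>1 ts\<^sub>1 q\<^sub>2 m\<^sub>2 ts\<^sub>2. Node q\<^sub>1 m\<^sub>1 (add_mset (Node q\<^sub>2 m\<^sub>2 ts\<^sub>2) ts\<^sub>1) \<in> TS M \<Longrightarrow>
        Node q\<^sub>2 m\<^sub>2 (add_mset (Node q\<^sub>1 m\<^sub>1 ts\<^sub>1) ts\<^sub>2) \<in> TS M \<Longrightarrow>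
        ?strong (Node q\<^sub>1 m\<^sub>1 ts\<^sub>1) \<Longrightarrow> ?strong (Node q\<^sub>2 m\<^sub>2 ts\<^sub>2) \<Longrightarrow>
        Q (Node q\<^sub>1 m\<^sub>1 (add_mset (Node q\<^sub>2 m\<^sub>2 ts\<^sub>2) ts\<^sub>1)) \<Longrightarrow>
        Q (Node q\<^sub>2 m\<^sub>2 (add_mset (Node q\<^sub>1 m\<^sub>1 ts\<^sub>1) ts\<^sub>2))" for Q
  proof
    fix \<tau> assume \<tau>: "\<tau> \<in> TS_hat M G"
    from ex obtain \<tau>\<^sub>0 where \<tau>\<^sub>0: "\<tau>\<^sub>0 \<in> TS_hat M G" "Q \<tau>\<^sub>0" by (elim bexE)
    show "Q \<tau>"
    proof (rule TS_hat_induct[where Q = Q, OF assms(9) \<tau>\<^sub>0 \<tau>])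
      fix q\<^sub>1 m\<^sub>1 ts\<^sub>1 q\<^sub>2 m\<^sub>2 ts\<^sub>2
      assume T: "Node q\<^sub>1 m\<^sub>1 (add_mset (Node q\<^sub>2 m\<^sub>2 ts\<^sub>2) ts\<^sub>1) \<in> TS M"
          "Node q\<^sub>2 m\<^sub>2 (add_mset (Node q\<^sub>1 m\<^sub>1 ts\<^sub>1) ts\<^sub>2) \<in> TS M"
        and o: "order_tree (Node q\<^sub>1 m\<^sub>1 ts\<^sub>1) < order_unrooted G" "order_tree (Node q\<^sub>2 m\<^sub>2 ts\<^sub>2) < order_unrooted G"
        and Q: "Q (Node q\<^sub>1 m\<^sub>1 (add_mset (Node q\<^sub>2 m\<^sub>2 ts\<^sub>2) ts\<^sub>1))"
      have "Node q\<^sub>1 m\<^sub>1 ts\<^sub>1 \<in> TS M" "Node q\<^sub>2 m\<^sub>2 ts\<^sub>2 \<in> TS M" using T by (auto simp: Node_in_TS_iff)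
      then show "Q (Node q\<^sub>2 m\<^sub>2 (add_mset (Node q\<^sub>1 m\<^sub>1 ts\<^sub>1) ts\<^sub>2))"
        by (intro step[OF T _ _ Q] low[rule_format] o)
    qed
  qed
  show ?thesis
    by (intro conjI impI; elim conjE; rule walk) (blast intro: exchange)+
qed

end
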